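(* Let $d\ge1$. Then $\mathcal{G}_{\tau}^{\infty}(\mathbb{R}^{d})\cap\mathcal{S}^{\prime}(\mathbb{R}^{d})=\mathcal{O}_{M}(\mathbb{R}^{d})$, where $\mathcal{S}'(\mathbb{R}^d)$ is regarded as a subspace of $\mathcal{G}_\tau(\mathbb{R}^d)$ through the embedding $\iota_\tau$; that is, for $u\in\mathcal{S}'(\mathbb{R}^d)$, one has $\iota_\tau(u)\in\mathcal{G}_\tau^\infty(\mathbb{R}^d)$ if and only if $u\in\mathcal{O}_M(\mathbb{R}^d)$.
   Context: $\mathbb{N}=\{0,1,2,\dots\}$; $\langle x\rangle=(1+|x|^2)^{1/2}$. $\mathcal{S}(\mathbb{R}^d)$ is the Schwartz space, $\mathcal{S}'(\mathbb{R}^d)$ the space of tempered distributions, and $\mathcal{O}_M(\mathbb{R}^d)$ is the space of $f\in C^\infty(\mathbb{R}^d)$ such that for all $l\in\mathbb{N}$ there is $q\in\mathbb{N}$ with $\sup_{x\in\mathbb{R}^d,|\alpha|\le l}\langle x\rangle^{-q}|\partial^\alpha f(x)|<+\infty$; it is canonically contained in $\mathcal{S}'(\mathbb{R}^d)$. For $\varphi\in\mathcal{S}(\mathbb{R}^d)$, $l\in\mathbb{N}$, put $\nu_{\varphi,l}(f)=\sup_{x\in\mathbb{R}^d,\,|\alpha|\le l}|\varphi(x)\partial^\alpha f(x)|$. Elements of $\mathcal{O}_M(\mathbb{R}^d)^{(0,1]}$ are nets $(f_\varepsilon)_\varepsilon$, $\varepsilon\in(0,1]$; all asymptotics are as $\varepsilon\to0$.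 Define $\mathcal{M}_{\mathcal{O}_M}(\mathbb{R}^d)=\{(f_\varepsilon)_\varepsilon\in\mathcal{O}_M(\mathbb{R}^d)^{(0,1]} : \forall \varphi\in\mathcal{S}(\mathbb{R}^d),\ \forall l\in\mathbb{N},\ \exists m\in\mathbb{N}:\ \nu_{\varphi,l}(f_\varepsilon)=\mathrm{o}(\varepsilon^{-m})\}$, $\mathcal{N}_{\mathcal{O}_M}(\mathbb{R}^d)=\{(f_\varepsilon)_\varepsilon\in\mathcal{O}_M(\mathbb{R}^d)^{(0,1]} : \forall \varphi\in\mathcal{S}(\mathbb{R}^d),\ \forall l\in\mathbb{N},\ \forall m\in\mathbb{N}:\ \nu_{\varphi,l}(f_\varepsilon)=\mathrm{o}(\varepsilon^{m})\}$, $\mathcal{M}^\infty_{\mathcal{O}_M}(\mathbb{R}^d)=\{(f_\varepsilon)_\varepsilon\in\mathcal{O}_M(\mathbb{R}^d)^{(0,1]} : \forall \varphi\in\mathcal{S}(\mathbb{R}^d),\ \exists m\in\mathbb{N},\ \forall l\in\mathbb{N}:\ \nu_{\varphi,l}(f_\varepsilon)=\mathrm{o}(\varepsilon^{-m})\}$, and $\mathcal{G}_\tau(\mathbb{R}^d)=\mathcal{M}_{\mathcal{O}_M}(\mathbb{R}^d)/\mathcal{N}_{\mathcal{O}_M}(\mathbb{R}^d)$, $\mathcal{G}^\infty_\tau(\mathbb{R}^d)=\mathcal{M}^\infty_{\mathcal{O}_M}(\mathbb{R}^d)/\mathcal{N}_{\mathcal{O}_M}(\mathbb{R}^d)\subset\mathcal{G}_\tau(\mathbb{R}^d)$.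 Fix $\rho\in\mathcal{S}(\mathbb{R}^d)$ with $\int\rho(x)\,dx=1$ and $\int x^\alpha\rho(x)\,dx=0$ for all $\alpha\in\mathbb{N}^d\setminus\{0\}$, and set $\rho_\varepsilon(x)=\varepsilon^{-d}\rho(x/\varepsilon)$. The map $\iota_\tau:\mathcal{S}'(\mathbb{R}^d)\to\mathcal{G}_\tau(\mathbb{R}^d)$, $T\mapsto (T*\rho_\varepsilon)_\varepsilon+\mathcal{N}_{\mathcal{O}_M}(\mathbb{R}^d)$, is a linear embedding. *)

theory Defs
  imports "HOL-Analysis.Analysis" "HOL-Library.Landau_Symbols" "HOL-Library.Multiset"
begin

section \<open>Smooth functions on \<open>\<real>\<^sup>d\<close>\<close>

text \<open>
  The space \<open>\<real>\<^sup>d\<close> is \<^typ>\<open>real ^ 'n\<close> with \<open>d = CARD('n) \<ge> 1\<close>; functions are complex valued.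
  A multi-index is a function \<^typ>\<open>'n \<Rightarrow> nat\<close>.
\<close>

definition mi_size :: "('n::finite \<Rightarrow> nat) \<Rightarrow> nat" where
  "mi_size \<alpha> = (\<Sum>i\<in>UNIV. \<alpha> i)"

definition mi_power :: "real ^ 'n \<Rightarrow> ('n::finite \<Rightarrow> nat) \<Rightarrow> real" where
  "mi_power x \<alpha> = (\<Prod>i\<in>UNIV. (x $ i) ^ \<alpha> i)"

definition partial_deriv :: "'n::finite \<Rightarrow> (real ^ 'n \<Rightarrow> complex) \<Rightarrow> real ^ 'n \<Rightarrow> complex" where
  "partial_deriv i f = (\<lambda>x. frechet_derivative f (at x) (axis i 1))"

text \<open>Iterated partial derivatives; the head of the list is applied last.\<close>

fun iter_partial :: "'n::finite list \<Rightarrow> (real ^ 'n \<Rightarrow> complex) \<Rightarrow> real ^ 'n \<Rightarrow> complex" where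
  "iter_partial [] f = f"
| "iter_partial (i # js) f = partial_deriv i (iter_partial js f)"

definition smooth :: "(real ^ 'n::finite \<Rightarrow> complex) \<Rightarrow> bool" where
  "smooth f \<longleftrightarrow> (\<forall>js x. iter_partial js f differentiable (at x))"

text \<open>
  The index type carries no order, so \<open>\<partial>\<^sup>\<alpha>\<close> applies the partial derivatives in some fixed order
  in which the index \<open>i\<close> occurs \<open>\<alpha> i\<close> times. For smooth functions the order is irrelevant,
  see \<open>iter_partial_eq_mi_deriv\<close> below.
\<close>

definition mi_deriv :: "('n::finite \<Rightarrow> nat) \<Rightarrow> (real ^ 'n \<Rightarrow> complex) \<Rightarrow> real ^ 'n \<Rightarrow> complex" where
  "mi_deriv \<alpha> = iter_partial (SOME js. \<forall>i. count_list js i = \<alpha> i)"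

text \<open>The partial derivatives of a smooth function commute, so \<open>mi_deriv\<close> is well defined.\<close>

lemma second_difference:
  fixes F :: "real ^ 'n::finite \<Rightarrow> real"
  assumes Fa: "\<And>x t. ((\<lambda>t. F (x + t *\<^sub>R a)) has_real_derivative Fa (x + t *\<^sub>R a)) (at t)"
    and Fab: "\<And>x t. ((\<lambda>t. Fa (x + t *\<^sub>R b)) has_real_derivative Fab (x + t *\<^sub>R b)) (at t)"
    and h: "0 < h"
  shows "\<exists>s t. 0 < s \<and> s < h \<and> 0 < t \<and> t < h \<and>
    F (x + h *\<^sub>R a + h *\<^sub>R b) - F (x + h *\<^sub>R a) - F (x + h *\<^sub>R b) + F x
      = h * h * Fab (x + s *\<^sub>R a + t *\<^sub>R b)"
proof -
  have D: "((\<lambda>s. F ((x + h *\<^sub>R b) + s *\<^sub>R a) - F (x + s *\<^sub>R a)) has_real_derivative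
     Fa ((x + h *\<^sub>R b) + s *\<^sub>R a) - Fa (x + s *\<^sub>R a)) (at s)" for s
    by (intro DERIV_diff Fa)
  obtain s where s: "0 < s" "s < h"
    and e1: "(F ((x + h *\<^sub>R b) + h *\<^sub>R a) - F (x + h *\<^sub>R a)) - (F ((x + h *\<^sub>R b) + 0 *\<^sub>R a) - F (x + 0 *\<^sub>R a))
       = (h - 0) * (Fa ((x + h *\<^sub>R b) + s *\<^sub>R a) - Fa (x + s *\<^sub>R a))"
    using MVT2[OF h D] by blast
  obtain t where t: "0 < t" "t < h"
    and e2: "Fa ((x + s *\<^sub>R a) + h *\<^sub>R b) - Fa ((x + s *\<^sub>R a) + 0 *\<^sub>R b)
       = (h - 0) * Fab ((x + s *\<^sub>R a) + t *\<^sub>R b)"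
    using MVT2[OF h Fab[of "x + s *\<^sub>R a"]] by blast
  have "F (x + h *\<^sub>R a + h *\<^sub>R b) - F (x + h *\<^sub>R a) - F (x + h *\<^sub>R b) + F x
      = h * h * Fab (x + s *\<^sub>R a + t *\<^sub>R b)"
    using e1 e2 by (simp add: add_ac)
  with s t show ?thesis by blast
qed

lemma mixed_partials_commute:
  fixes F :: "real ^ 'n::finite \<Rightarrow> real"
  assumes Fa: "\<And>x t. ((\<lambda>t. F (x + t *\<^sub>R a)) has_real_derivative Fa (x + t *\<^sub>R a)) (at t)"
    and Fab: "\<And>x t. ((\<lambda>t. Fa (x + t *\<^sub>R b)) has_real_derivative Fab (x + t *\<^sub>R b)) (at t)"
    and Fb: "\<And>x t. ((\<lambda>t. F (x + t *\<^sub>R b)) has_real_derivative Fb (x + t *\<^sub>R b)) (at t)"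
    and Fba: "\<And>x t. ((\<lambda>t. Fb (x + t *\<^sub>R a)) has_real_derivative Fba (x + t *\<^sub>R a)) (at t)"
    and cont: "isCont Fab x" "isCont Fba x"
  shows "Fab x = Fba x"
proof -
  define h where "h n = inverse (real (Suc n))" for n
  have hpos: "0 < h n" for n by (simp add: h_def)
  have h0: "h \<longlonglongrightarrow> 0" unfolding h_def by (rule LIMSEQ_inverse_real_of_nat)
  have "\<forall>n. \<exists>p. 0 < fst p \<and> fst p < h n \<and> 0 < snd p \<and> snd p < h n \<and>
    F (x + h n *\<^sub>R a + h n *\<^sub>R b) - F (x + h n *\<^sub>R a) - F (x + h n *\<^sub>R b) + F x
      = h n * h n * Fab (x + fst p *\<^sub>R a + snd p *\<^sub>R b)"
    using second_difference[OF Fa Fab hpos, where x = x] by (metis fst_conv snd_conv)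
  then obtain p where p: "\<And>n. 0 < fst (p n) \<and> fst (p n) < h n \<and> 0 < snd (p n) \<and> snd (p n) < h n \<and>
    F (x + h n *\<^sub>R a + h n *\<^sub>R b) - F (x + h n *\<^sub>R a) - F (x + h n *\<^sub>R b) + F x
      = h n * h n * Fab (x + fst (p n) *\<^sub>R a + snd (p n) *\<^sub>R b)" by metis
  have "\<forall>n. \<exists>p. 0 < fst p \<and> fst p < h n \<and> 0 < snd p \<and> snd p < h n \<and>
    F (x + h n *\<^sub>R b + h n *\<^sub>R a) - F (x + h n *\<^sub>R b) - F (x + h n *\<^sub>R a) + F x
      = h n * h n * Fba (x + fst p *\<^sub>R b + snd p *\<^sub>R a)"
    using second_difference[OF Fb Fba hpos, where x = x] by (metis fst_conv snd_conv)
  then obtain r where r: "\<And>n. 0 < fst (r n) \<and> fst (r n) < h n \<and> 0 < snd (r n) \<and> snd (r n) < h n \<and>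
    F (x + h n *\<^sub>R b + h n *\<^sub>R a) - F (x + h n *\<^sub>R b) - F (x + h n *\<^sub>R a) + F x
      = h n * h n * Fba (x + fst (r n) *\<^sub>R b + snd (r n) *\<^sub>R a)" by metis
  have squeeze: "y \<longlonglongrightarrow> 0" if "\<And>n. 0 < y n \<and> y n < h n" for y :: "nat \<Rightarrow> real"
    by (rule tendsto_sandwich[OF _ _ tendsto_const h0])
       (use that in \<open>auto intro!: always_eventually less_imp_le\<close>)
  have lim: "(\<lambda>n. x + u n *\<^sub>R c + v n *\<^sub>R d) \<longlonglongrightarrow> x"
    if "\<And>n. 0 < u n \<and> u n < h n" "\<And>n. 0 < v n \<and> v n < h n" for u v :: "nat \<Rightarrow> real" and c d
  proof -
    have "(\<lambda>n. x + u n *\<^sub>R c + v n *\<^sub>R d) \<longlonglongrightarrow> x + 0 *\<^sub>R c + 0 *\<^sub>R d"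
      by (intro tendsto_intros squeeze that)
    then show ?thesis by simp
  qed
  have eq: "Fab (x + fst (p n) *\<^sub>R a + snd (p n) *\<^sub>R b) = Fba (x + fst (r n) *\<^sub>R b + snd (r n) *\<^sub>R a)" for n
  proof -
    have "h n * h n * Fab (x + fst (p n) *\<^sub>R a + snd (p n) *\<^sub>R b)
        = h n * h n * Fba (x + fst (r n) *\<^sub>R b + snd (r n) *\<^sub>R a)"
    proof -
      have "F (x + h n *\<^sub>R a + h n *\<^sub>R b) = F (x + h n *\<^sub>R b + h n *\<^sub>R a)"
        by (simp add: add_ac)
      with p[of n] r[of n] show ?thesis by linarith
    qed
    then show ?thesis using hpos[of n] by simp
  qed
  have "(\<lambda>n. Fab (x + fst (p n) *\<^sub>R a + snd (p n) *\<^sub>R b)) \<longlonglongrightarrow> Fab x"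
    by (rule isCont_tendsto_compose[OF cont(1) lim]) (use p in auto)
  moreover have "(\<lambda>n. Fba (x + fst (r n) *\<^sub>R b + snd (r n) *\<^sub>R a)) \<longlonglongrightarrow> Fba x"
    by (rule isCont_tendsto_compose[OF cont(2) lim]) (use r in auto)
  ultimately show ?thesis unfolding eq by (rule LIMSEQ_unique)
qed

lemma iter_partial_append: "iter_partial (js @ ks) f = iter_partial js (iter_partial ks f)"
  by (induction js) auto

lemma iter_partial_conv_fold: "iter_partial js f = fold partial_deriv (rev js) f"
  by (induction js) auto

lemma smooth_partial_deriv:
  assumes "smooth f"
  shows "smooth (partial_deriv i f)"
proof -
  have "iter_partial js (partial_deriv i f) = iter_partial (js @ [i]) f" for js
    by (simp add: iter_partial_append)
  with assms show ?thesis by (simp add: smooth_def)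
qed

lemma smooth_differentiable: "smooth f \<Longrightarrow> f differentiable (at x)"
  unfolding smooth_def by (metis iter_partial.simps(1))

lemma partial_deriv_line:
  assumes "\<And>x. f differentiable (at x)"
  shows "((\<lambda>t. f (x + t *\<^sub>R axis i 1)) has_vector_derivative
    partial_deriv i f (x + t *\<^sub>R axis i 1)) (at t)"
proof -
  let ?D = "frechet_derivative f (at (x + t *\<^sub>R axis i 1))"
  have f: "(f has_derivative ?D) (at (x + t *\<^sub>R axis i 1))"
    using assms frechet_derivative_works by blast
  have g: "((\<lambda>t. x + t *\<^sub>R axis i 1) has_derivative (\<lambda>t. t *\<^sub>R axis i 1)) (at t)"
    by (auto intro!: derivative_eq_intros)
  have "((\<lambda>t. f (x + t *\<^sub>R axis i 1)) has_derivative (\<lambda>t. ?D (t *\<^sub>R axis i 1))) (at t)"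
    by (rule has_derivative_compose[OF g f])
  then show ?thesis
    unfolding has_vector_derivative_def partial_deriv_def
    by (simp add: linear_cmul[OF has_derivative_linear[OF f]])
qed

lemma partial_deriv_commute:
  assumes "smooth f"
  shows "partial_deriv i (partial_deriv j f) = partial_deriv j (partial_deriv i f)"
proof
  fix x
  note d = smooth_differentiable[OF assms]
    and di = smooth_differentiable[OF smooth_partial_deriv[OF assms]]
    and dij = smooth_differentiable[OF smooth_partial_deriv[OF smooth_partial_deriv[OF assms]]]
  have c: "isCont (partial_deriv k (partial_deriv l f)) x" for k l
    by (rule differentiable_imp_continuous_within[OF dij])
  note re = has_vector_derivative_complex_iff[THEN iffD1, THEN conjunct1]
    and im = has_vector_derivative_complex_iff[THEN iffD1, THEN conjunct2]
  have "Re (partial_deriv i (partial_deriv j f) x) = Re (partial_deriv j (partial_deriv i f) x)"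
    by (rule mixed_partials_commute[where F = "\<lambda>x. Re (f x)",
          OF re[OF partial_deriv_line[OF d]] re[OF partial_deriv_line[OF di]]
             re[OF partial_deriv_line[OF d]] re[OF partial_deriv_line[OF di]]])
       (intro isCont_Re c)+
  moreover have "Im (partial_deriv i (partial_deriv j f) x) = Im (partial_deriv j (partial_deriv i f) x)"
    by (rule mixed_partials_commute[where F = "\<lambda>x. Im (f x)",
          OF im[OF partial_deriv_line[OF d]] im[OF partial_deriv_line[OF di]]
             im[OF partial_deriv_line[OF d]] im[OF partial_deriv_line[OF di]]])
       (intro isCont_Im c)+
  ultimately show "partial_deriv i (partial_deriv j f) x = partial_deriv j (partial_deriv i f) x"
    by (rule complex_eqI)
qed

lemma iter_partial_perm:
  assumes "smooth f" "mset js = mset ks"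
  shows "iter_partial js f = iter_partial ks f"
  unfolding iter_partial_conv_fold
  by (rule fold_permuted_eq[where P = smooth])
     (use assms in \<open>auto intro: smooth_partial_deriv partial_deriv_commute\<close>)

lemma ex_list_of_multi_index:
  fixes \<alpha> :: "'n::finite \<Rightarrow> nat"
  shows "\<exists>js. \<forall>i. count_list js i = \<alpha> i"
proof -
  obtain js where js: "mset js = Abs_multiset \<alpha>" using ex_mset by blast
  have "count (Abs_multiset \<alpha>) = \<alpha>" by (rule count_Abs_multiset) simp
  then have "count_list js i = \<alpha> i" for i
    by (metis js count_mset)
  then show ?thesis by blast
qed

lemma iter_partial_eq_mi_deriv:
  assumes "smooth f" and "\<And>i. count_list js i = \<alpha> i"
  shows "iter_partial js f = mi_deriv \<alpha> f"
proof -
  let ?ks = "SOME js. \<forall>i. count_list js i = \<alpha> i"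
  have "\<forall>i. count_list ?ks i = \<alpha> i"
    by (rule someI_ex[OF ex_list_of_multi_index])
  with assms(2) have "mset js = mset ?ks"
    by (intro multiset_eqI) (simp add: count_mset)
  then show ?thesis
    unfolding mi_deriv_def by (rule iter_partial_perm[OF assms(1)])
qed

definition jap :: "real ^ 'n::finite \<Rightarrow> real" where
  "jap x = sqrt (1 + (norm x)\<^sup>2)"


section \<open>Schwartz functions, tempered distributions and multipliers\<close>

definition schwartz :: "(real ^ 'n::finite \<Rightarrow> complex) set" where
  "schwartz = {f. smooth f \<and>
     (\<forall>q l. bdd_above ((\<lambda>(x, \<alpha>). jap x ^ q * norm (mi_deriv \<alpha> f x)) ` (UNIV \<times> {\<alpha>. mi_size \<alpha> \<le> l})))}"

definition schwartz_seminorm :: "nat \<Rightarrow> nat \<Rightarrow> (real ^ 'n::finite \<Rightarrow> complex) \<Rightarrow> real" where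
  "schwartz_seminorm q l f =
     (SUP (x, \<alpha>) \<in> UNIV \<times> {\<alpha>. mi_size \<alpha> \<le> l}. jap x ^ q * norm (mi_deriv \<alpha> f x))"

definition schwartz_topology :: "(real ^ 'n::finite \<Rightarrow> complex) topology" where
  "schwartz_topology = topology_generated_by
     {{g \<in> schwartz. schwartz_seminorm q l (\<lambda>x. g x - f x) < r} |f q l r. f \<in> schwartz \<and> 0 < r}"

text \<open>
  Distributions are functionals with unspecified value outside the Schwartz space
  (\<^const>\<open>extensional\<close>), so that two of them are equal iff they agree on Schwartz functions.
\<close>

definition tempered :: "((real ^ 'n::finite \<Rightarrow> complex) \<Rightarrow> complex) set" where
  "tempered = {T \<in> extensional schwartz.
     (\<forall>f\<in>schwartz. \<forall>g\<in>schwartz. T (\<lambda>x. f x + g x) = T f + T g) \<and>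
     (\<forall>c. \<forall>f\<in>schwartz. T (\<lambda>x. c * f x) = c * T f) \<and>
     continuous_map schwartz_topology euclidean T}"

definition O_M :: "(real ^ 'n::finite \<Rightarrow> complex) set" where
  "O_M = {f. smooth f \<and>
     (\<forall>l. \<exists>q. bdd_above ((\<lambda>(x, \<alpha>). norm (mi_deriv \<alpha> f x) / jap x ^ q) ` (UNIV \<times> {\<alpha>. mi_size \<alpha> \<le> l})))}"

text \<open>The canonical inclusion of \<open>O_M\<close> into the tempered distributions.\<close>

definition distr_of :: "(real ^ 'n::finite \<Rightarrow> complex) \<Rightarrow> (real ^ 'n \<Rightarrow> complex) \<Rightarrow> complex" where
  "distr_of f = (\<lambda>\<phi>\<in>schwartz. LINT x|lborel. f x * \<phi> x)"

definition distr_conv ::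
  "((real ^ 'n::finite \<Rightarrow> complex) \<Rightarrow> complex) \<Rightarrow> (real ^ 'n \<Rightarrow> complex) \<Rightarrow> real ^ 'n \<Rightarrow> complex" where
  "distr_conv T g = (\<lambda>x. T (\<lambda>y. g (x - y)))"


section \<open>The algebra of tempered generalized functions\<close>

text \<open>
  For \<open>\<phi> \<in> schwartz\<close> and \<open>f \<in> O_M\<close> the supremum is over a bounded set, so the real-valued
  supremum is the usual one. Nets \<open>(f\<^sub>\<epsilon>)\<close> with \<open>0 < \<epsilon> \<le> 1\<close> are extensional functions of \<open>\<epsilon>\<close>.
\<close>

definition nu :: "(real ^ 'n::finite \<Rightarrow> complex) \<Rightarrow> nat \<Rightarrow> (real ^ 'n \<Rightarrow> complex) \<Rightarrow> real" where
  "nu \<phi> l f = (SUP (x, \<alpha>) \<in> UNIV \<times> {\<alpha>. mi_size \<alpha> \<le> l}. norm (\<phi> x * mi_deriv \<alpha> f x))"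

definition OM_nets :: "(real \<Rightarrow> real ^ 'n::finite \<Rightarrow> complex) set" where
  "OM_nets = {0<..1} \<rightarrow>\<^sub>E O_M"

definition moderate :: "(real \<Rightarrow> real ^ 'n::finite \<Rightarrow> complex) set" where
  "moderate = {u \<in> OM_nets. \<forall>\<phi>\<in>schwartz. \<forall>l. \<exists>m::nat.
     (\<lambda>\<epsilon>. nu \<phi> l (u \<epsilon>)) \<in> o[at_right 0](\<lambda>\<epsilon>. \<epsilon> powi (- int m))}"

definition negligible_nets :: "(real \<Rightarrow> real ^ 'n::finite \<Rightarrow> complex) set" where
  "negligible_nets = {u \<in> OM_nets. \<forall>\<phi>\<in>schwartz. \<forall>l. \<forall>m::nat.
     (\<lambda>\<epsilon>. nu \<phi> l (u \<epsilon>)) \<in> o[at_right 0](\<lambda>\<epsilon>. \<epsilon> ^ m)}"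

definition moderate_inf :: "(real \<Rightarrow> real ^ 'n::finite \<Rightarrow> complex) set" where
  "moderate_inf = {u \<in> OM_nets. \<forall>\<phi>\<in>schwartz. \<exists>m::nat. \<forall>l.
     (\<lambda>\<epsilon>. nu \<phi> l (u \<epsilon>)) \<in> o[at_right 0](\<lambda>\<epsilon>. \<epsilon> powi (- int m))}"

text \<open>The coset \<open>u + N\<close> of a net modulo the negligible nets.\<close>

definition net_class ::
  "(real \<Rightarrow> real ^ 'n::finite \<Rightarrow> complex) \<Rightarrow> (real \<Rightarrow> real ^ 'n \<Rightarrow> complex) set" where
  "net_class u = {(\<lambda>\<epsilon>\<in>{0<..1}. \<lambda>x. u \<epsilon> x + v \<epsilon> x) |v. v \<in> negligible_nets}"

definition G_tau :: "(real \<Rightarrow> real ^ 'n::finite \<Rightarrow> complex) set set" where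
  "G_tau = net_class ` moderate"

definition G_tau_inf :: "(real \<Rightarrow> real ^ 'n::finite \<Rightarrow> complex) set set" where
  "G_tau_inf = net_class ` moderate_inf"

lemma moderate_inf_subset_moderate: "moderate_inf \<subseteq> moderate"
  unfolding moderate_inf_def moderate_def by blast

lemma G_tau_inf_subset_G_tau: "G_tau_inf \<subseteq> G_tau"
  unfolding G_tau_inf_def G_tau_def by (intro image_mono moderate_inf_subset_moderate)

definition mollifier :: "(real ^ 'n::finite \<Rightarrow> complex) \<Rightarrow> bool" where
  "mollifier \<rho> \<longleftrightarrow> \<rho> \<in> schwartz \<and> (LINT x|lborel. \<rho> x) = 1 \<and>
     (\<forall>\<alpha>. \<alpha> \<noteq> (\<lambda>_. 0) \<longrightarrow> (LINT x|lborel. of_real (mi_power x \<alpha>) * \<rho> x) = 0)"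

definition rescale :: "(real ^ 'n::finite \<Rightarrow> complex) \<Rightarrow> real \<Rightarrow> real ^ 'n \<Rightarrow> complex" where
  "rescale \<rho> \<epsilon> = (\<lambda>x. of_real (\<epsilon> powi (- int CARD('n))) * \<rho> (x /\<^sub>R \<epsilon>))"

definition iota_tau :: "(real ^ 'n::finite \<Rightarrow> complex) \<Rightarrow>
    ((real ^ 'n \<Rightarrow> complex) \<Rightarrow> complex) \<Rightarrow> (real \<Rightarrow> real ^ 'n \<Rightarrow> complex) set" where
  "iota_tau \<rho> T = net_class (\<lambda>\<epsilon>\<in>{0<..1}. distr_conv T (rescale \<rho> \<epsilon>))"

end

theory Submission
  imports Defs
begin

text \<open>
  Multipliers are regular because, for \<open>f\<close> in \<open>O_M\<close>, all derivatives of \<open>f * \<rho>\<^sub>\<epsilon>\<close> are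
  polynomially bounded uniformly in \<open>\<epsilon>\<close>.

  Conversely let \<open>g\<^sub>\<epsilon> = u * \<rho>\<^sub>\<epsilon>\<close> be regular. A gliding-hump argument turns the estimates
  against Schwartz functions into \<open>\<bar>\<partial>\<^sup>\<alpha>g\<^sub>\<epsilon>(x)\<bar> \<le> C \<epsilon>\<^sup>-\<^sup>m \<langle>x\<rangle>\<^sup>k\<close> with \<open>m\<close> independent of \<open>\<alpha>\<close>
  (and \<open>C\<close>, \<open>k\<close> depending on it). Convolution commutes, so with \<open>\<delta> = \<epsilon>/2\<close>
  \<open>g\<^sub>\<epsilon> - g\<^sub>\<delta> = (g\<^sub>\<epsilon> - g\<^sub>\<epsilon> * \<rho>\<^sub>\<delta>) - (g\<^sub>\<delta> - g\<^sub>\<delta> * \<rho>\<^sub>\<epsilon>)\<close>, and Taylor expansion to order \<open>N = m + 1\<close>,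
  where the vanishing moments of \<open>\<rho>\<close> enter, bounds each derivative of this by
  \<open>C \<epsilon>\<^sup>N \<epsilon>\<^sup>-\<^sup>m \<langle>x\<rangle>\<^sup>k = C \<epsilon> \<langle>x\<rangle>\<^sup>k\<close>. Hence \<open>g\<^sub>\<epsilon>\<close> converges along \<open>\<epsilon> = 2\<^sup>-\<^sup>j\<close> to a multiplier, which
  represents \<open>u\<close> since also \<open>g\<^sub>\<epsilon> \<rightarrow> u\<close> weakly.
\<close>

section \<open>Calculus with iterated partial derivatives\<close>

text \<open>Why one order m must serve all derivatives: Taylor expansion to order N estimates a
  derivative of order l through derivatives of order l + N. If m grew with the order of
  differentiation, the loss \<epsilon>^(-m) at order l + N could cancel the gain \<epsilon>^N for
  every choice of N. The weight exponent k may grow, because \<open>O_M\<close> permits it. Why two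
  regularisations are compared: u has no pointwise derivatives to expand, whereas g_\<epsilon> and
  g_\<delta> are both smooth with known bounds. Their errors are of size \<delta>^N \<epsilon>^(-m)
  and \<epsilon>^N \<delta>^(-m), and both are O(\<epsilon>) when \<epsilon> and \<delta> are
  comparable, but the second explodes if \<delta> tends to 0 for fixed \<epsilon>. Hence the halving
  and a telescoping series. Series of functions are integrals over the counting measure on the
  naturals, so one theorem on differentiation under the integral covers mollification, the test
  function of the gliding hump and the telescoping series.\<close>

lemma partial_deriv_eq:
  assumes "(f has_derivative D) (at x)"
  shows "partial_deriv i f x = D (axis i 1)"
  unfolding partial_deriv_def using frechet_derivative_at[OF assms] by simp

lemma has_derivative_partials:
  fixes f :: "real ^ 'n::finite \<Rightarrow> complex"
  assumes "f differentiable (at x)"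
  shows "(f has_derivative (\<lambda>v. \<Sum>i\<in>UNIV. v $ i *\<^sub>R partial_deriv i f x)) (at x)"
proof -
  let ?D = "frechet_derivative f (at x)"
  have f: "(f has_derivative ?D) (at x)"
    using assms frechet_derivative_works by blast
  note lin = has_derivative_linear[OF f]
  have "?D v = (\<Sum>i\<in>UNIV. v $ i *\<^sub>R partial_deriv i f x)" for v
  proof -
    have "?D v = ?D (\<Sum>i\<in>UNIV. v $ i *\<^sub>R axis i 1)"
      using basis_expansion[of v] by (simp add: scalar_mult_eq_scaleR)
    also have "\<dots> = (\<Sum>i\<in>UNIV. v $ i *\<^sub>R partial_deriv i f x)"
      by (simp add: linear_sum[OF lin] linear_cmul[OF lin] partial_deriv_def)
    finally show ?thesis .
  qed
  then have "?D = (\<lambda>v. \<Sum>i\<in>UNIV. v $ i *\<^sub>R partial_deriv i f x)" by blast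
  with f show ?thesis by simp
qed

lemma smooth_has_derivative:
  assumes "smooth f"
  shows "(iter_partial js f has_derivative (\<lambda>v. \<Sum>i\<in>UNIV. v $ i *\<^sub>R iter_partial (i # js) f x)) (at x)"
  using has_derivative_partials[of "iter_partial js f" x] assms by (simp add: smooth_def)

text \<open>Iterated partial derivatives are determined by their recursion, so a family indexed by
  lists and closed under total differentiation must consist of them. Guessing such a family
  \<open>D\<close> yields smoothness and the derivative formula together, for every operation
  below.\<close>

lemma
  fixes D :: "'n::finite list \<Rightarrow> real ^ 'n \<Rightarrow> complex"
  assumes D0: "D [] = f"
    and D: "\<And>js x. (D js has_derivative (\<lambda>v. \<Sum>i\<in>UNIV. v $ i *\<^sub>R D (i # js) x)) (at x)"
  shows iter_partial_familyI: "iter_partial js f = D js"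
    and smooth_familyI: "smooth f"
proof -
  have *: "iter_partial js f = D js" for js
  proof (induction js)
    case (Cons i js)
    have "partial_deriv i (D js) x = D (i # js) x" for x
      by (simp add: partial_deriv_eq[OF D] axis_def if_distrib[of "\<lambda>t. t *\<^sub>R _"] cong: if_cong)
    with Cons show ?case by auto
  qed (simp add: D0)
  then show "iter_partial js f = D js" .
  show "smooth f"
    unfolding smooth_def * using D differentiableI by blast
qed

section \<open>Linear operations, conjugation and affine substitution on smooth functions\<close>

lemma
  fixes f g :: "real ^ 'n::finite \<Rightarrow> complex"
  assumes "smooth f" "smooth g"
  shows iter_partial_add: "iter_partial js (\<lambda>x. f x + g x) = (\<lambda>x. iter_partial js f x + iter_partial js g x)"
    and smooth_add: "smooth (\<lambda>x. f x + g x)"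
proof -
  let ?D = "\<lambda>js x. iter_partial js f x + iter_partial js g x"
  have "(?D js has_derivative (\<lambda>v. \<Sum>i\<in>UNIV. v $ i *\<^sub>R ?D (i # js) x)) (at x)" for js x
    by (rule has_derivative_eq_rhs[OF has_derivative_add[OF assms[THEN smooth_has_derivative]]])
       (simp only: scaleR_add_right sum.distrib)
  note D = this
  show "iter_partial js (\<lambda>x. f x + g x) = ?D js"
    by (rule iter_partial_familyI[where D = ?D]) (simp, rule D)
  show "smooth (\<lambda>x. f x + g x)"
    by (rule smooth_familyI[where D = ?D]) (simp, rule D)
qed

lemma
  fixes f :: "real ^ 'n::finite \<Rightarrow> complex"
  assumes "smooth f"
  shows iter_partial_cmult: "iter_partial js (\<lambda>x. c * f x) = (\<lambda>x. c * iter_partial js f x)"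
    and smooth_cmult: "smooth (\<lambda>x. c * f x)"
proof -
  let ?D = "\<lambda>js x. c * iter_partial js f x"
  have "(?D js has_derivative (\<lambda>v. \<Sum>i\<in>UNIV. v $ i *\<^sub>R ?D (i # js) x)) (at x)" for js x
    by (rule has_derivative_eq_rhs[OF has_derivative_mult_right[OF assms[THEN smooth_has_derivative]]])
       (simp only: sum_distrib_left mult_scaleR_right)
  note D = this
  show "iter_partial js (\<lambda>x. c * f x) = ?D js"
    by (rule iter_partial_familyI[where D = ?D]) (simp, rule D)
  show "smooth (\<lambda>x. c * f x)"
    by (rule smooth_familyI[where D = ?D]) (simp, rule D)
qed

lemma
  fixes f g :: "real ^ 'n::finite \<Rightarrow> complex"
  assumes "smooth f" "smooth g"
  shows iter_partial_diff: "iter_partial js (\<lambda>x. f x - g x) = (\<lambda>x. iter_partial js f x - iter_partial js g x)"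
    and smooth_diff: "smooth (\<lambda>x. f x - g x)"
  using iter_partial_add[OF assms(1) smooth_cmult[OF assms(2), of "-1"], of js]
    smooth_add[OF assms(1) smooth_cmult[OF assms(2), of "-1"]]
    iter_partial_cmult[OF assms(2), of js "-1"] by simp_all

lemma
  fixes f :: "real ^ 'n::finite \<Rightarrow> complex"
  assumes "smooth f"
  shows iter_partial_cnj: "iter_partial js (\<lambda>x. cnj (f x)) = (\<lambda>x. cnj (iter_partial js f x))"
    and smooth_cnj: "smooth (\<lambda>x. cnj (f x))"
proof -
  let ?D = "\<lambda>js x. cnj (iter_partial js f x)"
  have "(?D js has_derivative (\<lambda>v. \<Sum>i\<in>UNIV. v $ i *\<^sub>R ?D (i # js) x)) (at x)" for js x
    by (rule has_derivative_eq_rhs[OF bounded_linear.has_derivative[OF bounded_linear_cnj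
            assms[THEN smooth_has_derivative]]])
       (simp only: cnj_sum complex_cnj_scaleR)
  note D = this
  show "iter_partial js (\<lambda>x. cnj (f x)) = ?D js"
    by (rule iter_partial_familyI[where D = ?D]) (simp, rule D)
  show "smooth (\<lambda>x. cnj (f x))"
    by (rule smooth_familyI[where D = ?D]) (simp, rule D)
qed

lemma
  fixes f :: "real ^ 'n::finite \<Rightarrow> complex"
  assumes "smooth f"
  shows iter_partial_affine: "iter_partial js (\<lambda>x. f (a + c *\<^sub>R x))
      = (\<lambda>x. c ^ length js *\<^sub>R iter_partial js f (a + c *\<^sub>R x))"
    and smooth_affine: "smooth (\<lambda>x. f (a + c *\<^sub>R x))"
proof -
  let ?D = "\<lambda>js x. c ^ length js *\<^sub>R iter_partial js f (a + c *\<^sub>R x)"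
  have "(?D js has_derivative (\<lambda>v. \<Sum>i\<in>UNIV. v $ i *\<^sub>R ?D (i # js) x)) (at x)" for js x
  proof -
    have g: "((\<lambda>x. a + c *\<^sub>R x) has_derivative (\<lambda>v. c *\<^sub>R v)) (at x)"
      by (auto intro!: derivative_eq_intros)
    show ?thesis
      by (rule has_derivative_eq_rhs[OF has_derivative_scaleR_right[OF has_derivative_compose[OF g
            assms[THEN smooth_has_derivative]]]])
         (simp add: scaleR_sum_right mult_ac del: iter_partial.simps)
  qed
  note D = this
  show "iter_partial js (\<lambda>x. f (a + c *\<^sub>R x)) = ?D js"
    by (rule iter_partial_familyI[where D = ?D]) (simp, rule D)
  show "smooth (\<lambda>x. f (a + c *\<^sub>R x))"
    by (rule smooth_familyI[where D = ?D]) (simp, rule D)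
qed

lemma
  shows iter_partial_zero: "iter_partial js (\<lambda>x. 0) = (\<lambda>x. 0)"
    and smooth_zero: "smooth (\<lambda>x. 0)"
  by (rule iter_partial_familyI[where D = "\<lambda>_ _. 0"] smooth_familyI[where D = "\<lambda>_ _. 0"]; simp)+

text \<open>The argument is the reverse of the index list of \<^const>\<open>iter_partial\<close>, so that the recursion
  applies the innermost derivative first.\<close>

fun leibniz :: "'n::finite list \<Rightarrow> (real ^ 'n \<Rightarrow> complex) \<Rightarrow> (real ^ 'n \<Rightarrow> complex) \<Rightarrow> real ^ 'n \<Rightarrow> complex" where
  "leibniz [] f g = (\<lambda>x. f x * g x)"
| "leibniz (i # is) f g = (\<lambda>x. leibniz is (partial_deriv i f) g x + leibniz is f (partial_deriv i g) x)"

text \<open>\<open>leibniz\<close> consumes the innermost derivative at the head, while a further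
  differentiation adds an outermost one at the end. The induction therefore runs with arbitrary
  factors, since its hypothesis is needed for pairs in which one factor has already been
  differentiated.\<close>

lemma leibniz_has_derivative:
  assumes "smooth f" "smooth g"
  shows "(leibniz is f g has_derivative (\<lambda>v. \<Sum>i\<in>UNIV. v $ i *\<^sub>R leibniz (is @ [i]) f g x)) (at x)"
  using assms
proof (induction "is" arbitrary: f g)
  case Nil
  show ?case
    using has_derivative_mult[OF smooth_has_derivative[OF Nil(1), of "[]"] smooth_has_derivative[OF Nil(2), of "[]"], of x]
    by (simp add: sum_distrib_left sum_distrib_right scaleR_add_right sum.distrib add.commute)
next
  case (Cons j "is")
  show ?case
    using has_derivative_add[OF Cons.IH[OF smooth_partial_deriv[OF Cons.prems(1)] Cons.prems(2)]
       Cons.IH[OF Cons.prems(1) smooth_partial_deriv[OF Cons.prems(2)]]]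
    by (simp add: scaleR_add_right sum.distrib)
qed

lemma
  fixes f g :: "real ^ 'n::finite \<Rightarrow> complex"
  assumes "smooth f" "smooth g"
  shows iter_partial_mult: "iter_partial js (\<lambda>x. f x * g x) = leibniz (rev js) f g"
    and smooth_mult: "smooth (\<lambda>x. f x * g x)"
proof -
  have D: "(leibniz (rev js) f g has_derivative (\<lambda>v. \<Sum>i\<in>UNIV. v $ i *\<^sub>R leibniz (rev (i # js)) f g x)) (at x)" for js x
    using leibniz_has_derivative[OF assms] by simp
  show "iter_partial js (\<lambda>x. f x * g x) = leibniz (rev js) f g"
    by (rule iter_partial_familyI[where D = "\<lambda>js. leibniz (rev js) f g"]) (simp, rule D)
  show "smooth (\<lambda>x. f x * g x)"
    by (rule smooth_familyI[where D = "\<lambda>js. leibniz (rev js) f g"]) (simp, rule D)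
qed

lemma continuous_on_iter_partial: "smooth f \<Longrightarrow> continuous_on UNIV (iter_partial js f)"
  by (auto simp: smooth_def intro!: continuous_at_imp_continuous_on differentiable_imp_continuous_within)

lemma borel_measurable_iter_partial:
  "smooth f \<Longrightarrow> iter_partial js f \<in> borel_measurable borel"
  by (intro borel_measurable_continuous_onI continuous_on_iter_partial)

lemma borel_measurable_smooth: "smooth f \<Longrightarrow> f \<in> borel_measurable borel"
  using borel_measurable_iter_partial[of f "[]"] by simp

section \<open>The weight \<open>jap\<close>\<close>

lemma jap_ge_1: "1 \<le> jap x"
  by (simp add: jap_def)

lemma jap_pos [simp]: "0 < jap x"
  using jap_ge_1[of x] by linarith

lemma jap_nonneg [simp]: "0 \<le> jap x"
  using jap_ge_1[of x] by linarith

lemma jap_nonzero [simp]: "jap x \<noteq> 0"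
  using jap_pos[of x] by linarith

lemma norm_le_jap: "norm x \<le> jap x"
  unfolding jap_def by (rule real_le_rsqrt) simp

lemma jap_le: "jap x \<le> 1 + norm x"
  unfolding jap_def by (rule real_le_lsqrt) (auto simp: power2_eq_square algebra_simps)

lemma jap_mono: "norm x \<le> norm y \<Longrightarrow> jap x \<le> jap y"
  unfolding jap_def by (auto intro!: real_sqrt_le_mono power_mono)

lemma jap_scaleR: "\<bar>c\<bar> \<le> 1 \<Longrightarrow> jap (c *\<^sub>R x) \<le> jap x"
  by (rule jap_mono) (simp add: mult_left_le_one_le)

lemma jap_minus [simp]: "jap (- x) = jap x"
  by (simp add: jap_def)

text \<open>A form of Peetre's inequality. It moves a weight from one point to another at a cost
  polynomial in their difference, which is how translates are estimated throughout.\<close>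

lemma jap_add: "jap (x + y) \<le> 2 * jap x * jap y"
proof -
  have "(norm (x + y))\<^sup>2 \<le> (norm x + norm y)\<^sup>2"
    by (intro power_mono norm_triangle_ineq) simp
  also have "\<dots> \<le> 2 * (norm x)\<^sup>2 + 2 * (norm y)\<^sup>2"
    using sum_squares_bound[of "norm x" "norm y"] by (simp add: power2_sum)
  finally have "1 + (norm (x + y))\<^sup>2 \<le> 1 + 2 * (norm x)\<^sup>2 + 2 * (norm y)\<^sup>2" by simp
  also have "1 + 2 * a + 2 * b \<le> 4 * ((1 + a) * (1 + b))" if "0 \<le> a" "0 \<le> b" for a b :: real
    using mult_nonneg_nonneg[OF that] that by (simp add: algebra_simps)
  then have "1 + 2 * (norm x)\<^sup>2 + 2 * (norm y)\<^sup>2 \<le> 4 * ((1 + (norm x)\<^sup>2) * (1 + (norm y)\<^sup>2))" by simp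
  finally have "1 + (norm (x + y))\<^sup>2 \<le> 4 * ((1 + (norm x)\<^sup>2) * (1 + (norm y)\<^sup>2))" .
  then have "sqrt (1 + (norm (x + y))\<^sup>2) \<le> sqrt (4 * ((1 + (norm x)\<^sup>2) * (1 + (norm y)\<^sup>2)))"
    by (rule real_sqrt_le_mono)
  then show ?thesis by (simp add: jap_def real_sqrt_mult)
qed

lemma jap_diff: "jap (x - y) \<le> 2 * jap x * jap y"
  using jap_add[of x "- y"] by simp

lemma jap_add_power: "jap (x + y) ^ q \<le> 2 ^ q * jap x ^ q * jap y ^ q"
  using power_mono[OF jap_add, of x y q] by (simp add: power_mult_distrib)

lemma jap_diff_power: "jap (x - y) ^ q \<le> 2 ^ q * jap x ^ q * jap y ^ q"
  using jap_add_power[of x "- y"] by simp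

lemma jap_power_mono: "p \<le> q \<Longrightarrow> jap x ^ p \<le> jap x ^ q"
  by (intro power_increasing jap_ge_1)

lemma jap_power_ge_1: "1 \<le> jap x ^ q"
  by (simp add: jap_ge_1)

text \<open>The weight is positive, so any bound of this shape forces its constant to be
  nonnegative. Existential growth conditions therefore need not record the sign.\<close>

lemma jap_bound_nonneg:
  assumes "norm a \<le> C * jap x ^ q"
  shows "0 \<le> C"
proof (rule ccontr)
  assume "\<not> 0 \<le> C"
  then have "C * jap x ^ q < 0" by (intro mult_neg_pos) auto
  with assms norm_ge_zero[of a] show False by linarith
qed

lemma continuous_on_jap [continuous_intros]:
  "continuous_on S f \<Longrightarrow> continuous_on S (\<lambda>x. jap (f x))"
  unfolding jap_def by (intro continuous_intros)

lemma borel_measurable_jap [measurable]: "jap \<in> borel_measurable borel"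
  by (intro borel_measurable_continuous_onI continuous_on_jap continuous_on_id)

text \<open>Domination by multiples of indicators of the balls of radius k + 1. The volume grows
  like (k + 1)^d and the weight decays like (k + 1)^(-(d + 2)), so the integrals sum like 1/(k +
  1)^2. The balls overlap, which is harmless for an upper bound.\<close>

lemma integrable_inverse_jap:
  "integrable lborel (\<lambda>x::real ^ 'n::finite. inverse (jap x ^ (CARD('n) + 2)))"
proof -
  let ?n = "CARD('n)"
  define g where "g k x = (2 / real (Suc k)) ^ (?n + 2) * indicator (cball (0::real ^ 'n) (real (Suc k))) x" for k x
  have [measurable]: "g k \<in> borel_measurable borel" for k
    unfolding g_def by (intro borel_measurable_times borel_measurable_const borel_measurable_indicator) auto
  define V where "V = unit_ball_vol (real ?n)"
  have V: "0 \<le> V" by (simp add: V_def)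
  have le: "ennreal (inverse (jap x ^ (?n + 2))) \<le> (\<Sum>k. ennreal (g k x))" for x :: "real ^ 'n"
  proof -
    define k where "k = nat \<lfloor>norm x\<rfloor>"
    have k: "real k \<le> norm x" "norm x \<le> real (Suc k)"
    proof -
      have "real k = of_int \<lfloor>norm x\<rfloor>" by (simp add: k_def)
      then show "real k \<le> norm x" "norm x \<le> real (Suc k)" by linarith+
    qed
    \<comment> \<open>For k = 0 this is \<open>jap_ge_1\<close>; for k \<ge> 1 one has (k + 1)/2
      \<le> k \<le> norm x.\<close>
    have "real (Suc k) / 2 \<le> jap x"
      using k(1) jap_ge_1[of x] norm_le_jap[of x] by (cases k) auto
    then have "(real (Suc k) / 2) ^ (?n + 2) \<le> jap x ^ (?n + 2)"
      by (intro power_mono) auto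
    then have "inverse (jap x ^ (?n + 2)) \<le> inverse ((real (Suc k) / 2) ^ (?n + 2))"
      by (intro le_imp_inverse_le) auto
    also have "\<dots> = g k x"
      using k(2) by (simp add: g_def power_divide del: of_nat_Suc)
    finally have "ennreal (inverse (jap x ^ (?n + 2))) \<le> ennreal (g k x)"
      by (rule ennreal_leI)
    also have "\<dots> = (\<Sum>k\<in>{k}. ennreal (g k x))" by simp
    also have "\<dots> \<le> (\<Sum>k. ennreal (g k x))"
      by (rule sum_le_suminf) auto
    finally show ?thesis .
  qed
  have gi: "(\<integral>\<^sup>+x. ennreal (g k x) \<partial>lborel) = ennreal (4 * 2 ^ ?n * V * inverse (real (Suc k) ^ 2))" for k
  proof -
    have "(\<integral>\<^sup>+x. ennreal (g k x) \<partial>lborel)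
        = (\<integral>\<^sup>+x. ennreal ((2 / real (Suc k)) ^ (?n + 2)) * indicator (cball (0::real ^ 'n) (real (Suc k))) x \<partial>lborel)"
      by (intro nn_integral_cong) (auto simp: g_def ennreal_mult' split: split_indicator)
    also have "\<dots> = ennreal ((2 / real (Suc k)) ^ (?n + 2)) * ennreal (V * real (Suc k) ^ ?n)"
      by (subst nn_integral_cmult_indicator) (auto simp: emeasure_cball V_def)
    also have "\<dots> = ennreal ((2 / real (Suc k)) ^ (?n + 2) * (V * real (Suc k) ^ ?n))"
      by (rule ennreal_mult[symmetric]) (use V in auto)
    also have "(2 / real (Suc k)) ^ (?n + 2) * (V * real (Suc k) ^ ?n) = 4 * 2 ^ ?n * V * inverse (real (Suc k) ^ 2)"
      by (simp add: power_divide power_add divide_simps power2_eq_square del: of_nat_Suc)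
    finally show ?thesis .
  qed
  have "nn_integral lborel (\<lambda>x::real ^ 'n. ennreal (inverse (jap x ^ (?n + 2)))) \<le> (\<integral>\<^sup>+x. (\<Sum>k. ennreal (g k x)) \<partial>lborel)"
    by (intro nn_integral_mono le)
  also have "\<dots> = (\<Sum>k. (\<integral>\<^sup>+x. ennreal (g k x) \<partial>lborel))"
    by (rule nn_integral_suminf) simp
  also have "\<dots> = ennreal (\<Sum>k. 4 * 2 ^ ?n * V * inverse (real (Suc k) ^ 2))"
  proof -
    have "summable (\<lambda>k. inverse (real (Suc k) ^ 2))"
      using inverse_power_summable[of 2, where 'a = real] summable_Suc_iff[of "\<lambda>k. inverse (real k ^ 2)"] by simp
    then show ?thesis
      unfolding gi using V by (intro suminf_ennreal2 summable_mult) auto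
  qed
  also have "\<dots> < \<infinity>" by simp
  finally show ?thesis
    by (intro integrableI_nonneg) auto
qed

section \<open>Characterisations by lists of indices\<close>

lemma mi_deriv_ex_list: "\<exists>js. length js = mi_size \<alpha> \<and> mi_deriv \<alpha> f = iter_partial js f"
proof -
  let ?js = "SOME js. \<forall>i. count_list js i = \<alpha> i"
  have "\<forall>i. count_list ?js i = \<alpha> i"
    by (rule someI_ex[OF ex_list_of_multi_index])
  then have "length ?js = mi_size \<alpha>"
    using sum_count_set[of ?js UNIV] by (simp add: mi_size_def)
  then show ?thesis unfolding mi_deriv_def by blast
qed

lemma iter_partial_ex_mi:
  assumes "smooth f"
  shows "\<exists>\<alpha>. mi_size \<alpha> = length js \<and> iter_partial js f = mi_deriv \<alpha> f"
  using iter_partial_eq_mi_deriv[OF assms, of js "count_list js"] sum_count_set[of js UNIV]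
  by (auto simp: mi_size_def intro!: exI[of _ "count_list js"])

text \<open>The definitions quantify over multi-indices, the calculus over lists. The passage
  between them preserves the order of differentiation, and the predicate \<open>P\<close> is free so
  that the same transfer serves all weights.\<close>

lemma ball_mi_deriv_iff:
  assumes "smooth f"
  shows "(\<forall>x \<alpha>. mi_size \<alpha> \<le> l \<longrightarrow> P x (mi_deriv \<alpha> f x)) \<longleftrightarrow>
    (\<forall>x js. length js \<le> l \<longrightarrow> P x (iter_partial js f x))"
  by (metis iter_partial_ex_mi[OF assms] mi_deriv_ex_list)

lemma finite_index_lists: "finite {js :: 'n::finite list. length js \<le> l}"
  using finite_lists_length_le[of "UNIV :: 'n set" l] by simp

text \<open>The definition wants one exponent for all derivatives of order at most l, whereas here
  each list has its own. There are only finitely many such lists, so the sums of their exponents and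
  constants serve all of them.\<close>

lemma O_M_iff:
  "f \<in> O_M \<longleftrightarrow> smooth f \<and> (\<forall>js. \<exists>q C. \<forall>x. norm (iter_partial js f x) \<le> C * jap x ^ q)"
proof -
  have "(\<forall>l. \<exists>q. bdd_above ((\<lambda>(x, \<alpha>). norm (mi_deriv \<alpha> f x) / jap x ^ q) ` (UNIV \<times> {\<alpha>. mi_size \<alpha> \<le> l})))
     \<longleftrightarrow> (\<forall>js. \<exists>q C. \<forall>x. norm (iter_partial js f x) \<le> C * jap x ^ q)" (is "?L \<longleftrightarrow> ?R") if f: "smooth f"
  proof -
    have "?L \<longleftrightarrow> (\<forall>l. \<exists>q C. \<forall>x \<alpha>. mi_size \<alpha> \<le> l \<longrightarrow> norm (mi_deriv \<alpha> f x) / jap x ^ q \<le> C)"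
      by (auto simp: bdd_above_def)
    also have "\<dots> \<longleftrightarrow> (\<forall>l. \<exists>q C. \<forall>x js. length js \<le> l \<longrightarrow> norm (iter_partial js f x) / jap x ^ q \<le> C)"
      by (simp only: ball_mi_deriv_iff[OF f, where P = "\<lambda>x y. norm y / jap x ^ q \<le> C" for q C])
    also have "\<dots> \<longleftrightarrow> (\<forall>l. \<exists>q C. \<forall>x js. length js \<le> l \<longrightarrow> norm (iter_partial js f x) \<le> C * jap x ^ q)"
      by (simp add: pos_divide_le_eq)
    also have "\<dots> \<longleftrightarrow> ?R"
    proof
      assume R: ?R
      then obtain q C where qC: "\<And>js x. norm (iter_partial js f x) \<le> C js * jap x ^ q js" by metis
      show "\<forall>l. \<exists>q C. \<forall>x js. length js \<le> l \<longrightarrow> norm (iter_partial js f x) \<le> C * jap x ^ q"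
      proof (intro allI)
        fix l
        let ?A = "{js :: 'a list. length js \<le> l}"
        have fin: "finite ?A" by (rule finite_index_lists)
        have C0: "0 \<le> C js" for js
          by (rule jap_bound_nonneg[OF qC])
        have "norm (iter_partial js f x) \<le> (\<Sum>js\<in>?A. C js) * jap x ^ (\<Sum>js\<in>?A. q js)" if "length js \<le> l" for x js
          by (rule order_trans[OF qC mult_mono])
             (use that in \<open>auto intro!: member_le_sum sum_nonneg jap_power_mono C0 fin\<close>)
        then show "\<exists>q C. \<forall>x js. length js \<le> l \<longrightarrow> norm (iter_partial js f x) \<le> C * jap x ^ q" by blast
      qed
    qed blast
    finally show ?thesis .
  qed
  then show ?thesis unfolding O_M_def by blast
qed

lemma schwartz_bound_finite:
  assumes "\<forall>js q. \<exists>C. \<forall>x. jap x ^ q * norm (iter_partial js f x) \<le> C"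
  shows "\<exists>C. \<forall>x js. length js \<le> l \<longrightarrow> jap x ^ q * norm (iter_partial js f x) \<le> C"
proof -
  have "\<forall>js. \<exists>C. \<forall>x. jap x ^ q * norm (iter_partial js f x) \<le> C" using assms by blast
  then obtain C where C: "\<And>js x. jap x ^ q * norm (iter_partial js f x) \<le> C js" by metis
  have C0: "0 \<le> C js" for js
    using order_trans[OF _ C[of 0 js], of 0] by simp
  have "jap x ^ q * norm (iter_partial js f x) \<le> (\<Sum>js\<in>{js. length js \<le> l}. C js)" if "length js \<le> l" for x js
    by (rule order_trans[OF C]) (use that in \<open>auto intro!: member_le_sum C0 finite_index_lists\<close>)
  then show ?thesis by blast
qed

lemma schwartz_iff:
  "f \<in> schwartz \<longleftrightarrow> smooth f \<and> (\<forall>js q. \<exists>C. \<forall>x. jap x ^ q * norm (iter_partial js f x) \<le> C)"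
proof -
  have eq: "(\<forall>q l. bdd_above ((\<lambda>(x, \<alpha>). jap x ^ q * norm (mi_deriv \<alpha> f x)) ` (UNIV \<times> {\<alpha>. mi_size \<alpha> \<le> l})))
     \<longleftrightarrow> (\<forall>js q. \<exists>C. \<forall>x. jap x ^ q * norm (iter_partial js f x) \<le> C)" (is "?L \<longleftrightarrow> ?R") if f: "smooth f"
  proof -
    have "?L \<longleftrightarrow> (\<forall>q l. \<exists>C. \<forall>x \<alpha>. mi_size \<alpha> \<le> l \<longrightarrow> jap x ^ q * norm (mi_deriv \<alpha> f x) \<le> C)"
      by (auto simp: bdd_above_def)
    also have "\<dots> \<longleftrightarrow> (\<forall>q l. \<exists>C. \<forall>x js. length js \<le> l \<longrightarrow> jap x ^ q * norm (iter_partial js f x) \<le> C)"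
      by (simp only: ball_mi_deriv_iff[OF f, where P = "\<lambda>x y. jap x ^ q * norm y \<le> C" for q C])
    also have "\<dots> \<longleftrightarrow> ?R"
    proof (intro iffI allI)
      fix js :: "'a list" and q
      assume "\<forall>q l. \<exists>C. \<forall>x js. length js \<le> l \<longrightarrow> jap x ^ q * norm (iter_partial js f x) \<le> C"
      then obtain C where "\<forall>x ks. length ks \<le> length js \<longrightarrow> jap x ^ q * norm (iter_partial ks f x) \<le> C" by meson
      then show "\<exists>C. \<forall>x. jap x ^ q * norm (iter_partial js f x) \<le> C" by (metis order_refl)
    qed (rule schwartz_bound_finite)
    finally show ?thesis .
  qed
  show ?thesis unfolding schwartz_def mem_Collect_eq by (rule conj_cong[OF refl eq])
qed

lemma schwartz_smooth: "f \<in> schwartz \<Longrightarrow> smooth f"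
  by (simp add: schwartz_def)

lemma O_M_smooth: "f \<in> O_M \<Longrightarrow> smooth f"
  by (simp add: O_M_def)

lemma schwartzD: "f \<in> schwartz \<Longrightarrow> \<exists>C. \<forall>x. jap x ^ q * norm (iter_partial js f x) \<le> C"
  by (simp add: schwartz_iff)

text \<open>A real supremum carries information only for a nonempty set that is bounded above.
  Boundedness comes from membership in \<open>schwartz\<close>, nonemptiness from the zero
  multi-index; afterwards seminorms are handled only through these two rules.\<close>

lemma
  assumes f: "f \<in> schwartz"
  shows schwartz_seminorm_ge: "length js \<le> l \<Longrightarrow> jap x ^ q * norm (iter_partial js f x) \<le> schwartz_seminorm q l f"
    and schwartz_seminorm_le: "(\<And>js x. length js \<le> l \<Longrightarrow> jap x ^ q * norm (iter_partial js f x) \<le> C)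
       \<Longrightarrow> schwartz_seminorm q l f \<le> C"
proof -
  note sm = schwartz_smooth[OF f]
  have "bdd_above ((\<lambda>(x, \<alpha>). jap x ^ q * norm (mi_deriv \<alpha> f x)) ` (UNIV \<times> {\<alpha>. mi_size \<alpha> \<le> l}))"
    using f by (simp add: schwartz_def)
  note upper = cSUP_upper[OF _ this]
  have "\<forall>x \<alpha>. mi_size \<alpha> \<le> l \<longrightarrow> jap x ^ q * norm (mi_deriv \<alpha> f x) \<le> schwartz_seminorm q l f"
  proof (intro allI impI)
    fix x and \<alpha> :: "'a \<Rightarrow> nat" assume "mi_size \<alpha> \<le> l"
    then show "jap x ^ q * norm (mi_deriv \<alpha> f x) \<le> schwartz_seminorm q l f"
      using upper[of "(x, \<alpha>)"] by (simp add: schwartz_seminorm_def)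
  qed
  then have "\<forall>x js. length js \<le> l \<longrightarrow> jap x ^ q * norm (iter_partial js f x) \<le> schwartz_seminorm q l f"
    unfolding ball_mi_deriv_iff[OF sm, where P = "\<lambda>x y. jap x ^ q * norm y \<le> schwartz_seminorm q l f"] .
  then show "length js \<le> l \<Longrightarrow> jap x ^ q * norm (iter_partial js f x) \<le> schwartz_seminorm q l f" by blast
  assume "\<And>js x. length js \<le> l \<Longrightarrow> jap x ^ q * norm (iter_partial js f x) \<le> C"
  then have "\<forall>x js. length js \<le> l \<longrightarrow> jap x ^ q * norm (iter_partial js f x) \<le> C" by blast
  then have *: "\<forall>x \<alpha>. mi_size \<alpha> \<le> l \<longrightarrow> jap x ^ q * norm (mi_deriv \<alpha> f x) \<le> C"
    unfolding ball_mi_deriv_iff[OF sm, where P = "\<lambda>x y. jap x ^ q * norm y \<le> C"] .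
  have "mi_size (\<lambda>_::'a. 0) \<le> l" by (simp add: mi_size_def)
  then have "{\<alpha> :: 'a \<Rightarrow> nat. mi_size \<alpha> \<le> l} \<noteq> {}" by blast
  then show "schwartz_seminorm q l f \<le> C"
    unfolding schwartz_seminorm_def using * by (intro cSUP_least) auto
qed

section \<open>Closure properties of the Schwartz space\<close>

lemma schwartz_add:
  assumes "f \<in> schwartz" "g \<in> schwartz"
  shows "(\<lambda>x. f x + g x) \<in> schwartz"
proof -
  have "\<exists>C. \<forall>x. jap x ^ q * norm (iter_partial js f x + iter_partial js g x) \<le> C" for js q
  proof -
    obtain A B where A: "\<And>x. jap x ^ q * norm (iter_partial js f x) \<le> A"
      and B: "\<And>x. jap x ^ q * norm (iter_partial js g x) \<le> B"
      using assms[THEN schwartzD] by meson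
    have "jap x ^ q * norm (iter_partial js f x + iter_partial js g x) \<le> A + B" for x
      using mult_left_mono[OF norm_triangle_ineq, of "jap x ^ q" "iter_partial js f x" "iter_partial js g x"]
        A[of x] B[of x] by (simp add: distrib_left)
    then show ?thesis by blast
  qed
  with assms show ?thesis
    by (auto simp: schwartz_iff smooth_add iter_partial_add)
qed

lemma schwartz_cmult:
  assumes "f \<in> schwartz"
  shows "(\<lambda>x. c * f x) \<in> schwartz"
proof -
  have "\<exists>C. \<forall>x. jap x ^ q * norm (c * iter_partial js f x) \<le> C" for js q
  proof -
    obtain A where A: "\<And>x. jap x ^ q * norm (iter_partial js f x) \<le> A"
      using assms[THEN schwartzD] by meson
    have "jap x ^ q * norm (c * iter_partial js f x) \<le> norm c * A" for x
      using mult_left_mono[OF A, of "norm c" x] by (simp add: norm_mult mult_ac)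
    then show ?thesis by blast
  qed
  with assms show ?thesis
    by (auto simp: schwartz_iff smooth_cmult iter_partial_cmult)
qed

lemma schwartz_diff:
  assumes "f \<in> schwartz" "g \<in> schwartz"
  shows "(\<lambda>x. f x - g x) \<in> schwartz"
  using schwartz_add[OF assms(1) schwartz_cmult[OF assms(2), of "-1"]] by simp

lemma schwartz_zero: "(\<lambda>x. 0) \<in> schwartz"
  by (auto simp: schwartz_iff smooth_zero iter_partial_zero)

lemma schwartz_sum:
  "finite A \<Longrightarrow> (\<And>i. i \<in> A \<Longrightarrow> f i \<in> schwartz) \<Longrightarrow> (\<lambda>x. \<Sum>i\<in>A. f i x) \<in> schwartz"
  by (induction rule: finite_induct) (auto intro: schwartz_zero schwartz_add)

lemma schwartz_affine:
  assumes "f \<in> schwartz" "c \<noteq> 0"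
  shows "(\<lambda>x. f (a + c *\<^sub>R x)) \<in> schwartz"
proof -
  have "\<exists>C. \<forall>x. jap x ^ q * norm (c ^ length js *\<^sub>R iter_partial js f (a + c *\<^sub>R x)) \<le> C" for js q
  proof -
    obtain A where A: "\<And>x. jap x ^ q * norm (iter_partial js f x) \<le> A"
      using assms(1)[THEN schwartzD] by meson
    \<comment> \<open>r must dominate 1/\<bar>c\<bar> to undo the dilation, and be at least 1 so
      that 1 + (r t)^2 \<le> r^2 (1 + t^2).\<close>
    define r where "r = max 1 (inverse \<bar>c\<bar>)"
    have r: "1 \<le> r" "inverse \<bar>c\<bar> \<le> r" by (auto simp: r_def)
    have j: "jap x ^ q \<le> (r * 2 * jap a) ^ q * jap (a + c *\<^sub>R x) ^ q" for x
    proof -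
      have "x = inverse c *\<^sub>R ((a + c *\<^sub>R x) - a)" using assms(2) by simp
      then have "norm x = inverse \<bar>c\<bar> * norm ((a + c *\<^sub>R x) - a)"
        by (metis abs_inverse norm_scaleR)
      also have "\<dots> \<le> r * norm ((a + c *\<^sub>R x) - a)"
        by (intro mult_right_mono r) auto
      finally have "1 + (norm x)\<^sup>2 \<le> 1 + (r * norm ((a + c *\<^sub>R x) - a))\<^sup>2"
        by (auto intro: power_mono)
      also have "\<dots> \<le> r\<^sup>2 * (1 + (norm ((a + c *\<^sub>R x) - a))\<^sup>2)"
        using r(1) by (simp add: power_mult_distrib distrib_left)
      finally have "jap x \<le> sqrt (r\<^sup>2 * (1 + (norm ((a + c *\<^sub>R x) - a))\<^sup>2))"
        unfolding jap_def by (rule real_sqrt_le_mono)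
      also have "\<dots> = r * jap ((a + c *\<^sub>R x) - a)"
        using r(1) by (simp add: jap_def real_sqrt_mult)
      also have "\<dots> \<le> r * (2 * jap (a + c *\<^sub>R x) * jap a)"
        using r(1) by (intro mult_left_mono jap_diff) auto
      finally have "jap x \<le> (r * 2 * jap a) * jap (a + c *\<^sub>R x)" by (simp add: mult_ac)
      then have "jap x ^ q \<le> ((r * 2 * jap a) * jap (a + c *\<^sub>R x)) ^ q"
        by (intro power_mono) auto
      then show ?thesis by (simp add: power_mult_distrib)
    qed
    have "jap x ^ q * norm (c ^ length js *\<^sub>R iter_partial js f (a + c *\<^sub>R x)) \<le> \<bar>c\<bar> ^ length js * (r * 2 * jap a) ^ q * A" for x
    proof -
      have "jap x ^ q * norm (c ^ length js *\<^sub>R iter_partial js f (a + c *\<^sub>R x))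
         \<le> ((r * 2 * jap a) ^ q * jap (a + c *\<^sub>R x) ^ q) * (\<bar>c\<bar> ^ length js * norm (iter_partial js f (a + c *\<^sub>R x)))"
        unfolding norm_scaleR power_abs by (intro mult_right_mono j) auto
      also have "\<dots> = (\<bar>c\<bar> ^ length js * (r * 2 * jap a) ^ q) * (jap (a + c *\<^sub>R x) ^ q * norm (iter_partial js f (a + c *\<^sub>R x)))"
        by (simp add: mult_ac)
      also have "\<dots> \<le> (\<bar>c\<bar> ^ length js * (r * 2 * jap a) ^ q) * A"
        using r(1) by (intro mult_left_mono A) auto
      finally show ?thesis .
    qed
    then show ?thesis by blast
  qed
  with assms show ?thesis
    by (auto simp: schwartz_iff smooth_affine iter_partial_affine)
qed

lemma schwartz_reflect_translate: "f \<in> schwartz \<Longrightarrow> (\<lambda>y. f (x - y)) \<in> schwartz"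
  using schwartz_affine[of f "-1" x] by simp

lemma schwartz_partial_deriv:
  assumes "f \<in> schwartz"
  shows "partial_deriv i f \<in> schwartz"
proof -
  have "iter_partial js (partial_deriv i f) = iter_partial (js @ [i]) f" for js
    by (simp add: iter_partial_append)
  with assms show ?thesis by (simp add: schwartz_iff smooth_partial_deriv)
qed

lemma schwartz_cnj: "f \<in> schwartz \<Longrightarrow> (\<lambda>x. cnj (f x)) \<in> schwartz"
  by (simp add: schwartz_iff iter_partial_cnj smooth_cnj)

lemma schwartz_mult:
  assumes "f \<in> schwartz" "g \<in> schwartz"
  shows "(\<lambda>x. f x * g x) \<in> schwartz"
proof -
  have "\<exists>C. \<forall>x. jap x ^ q * norm (leibniz is f g x) \<le> C" for "is" q
    using assms
  proof (induction "is" arbitrary: f g)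
    case Nil
    obtain A B where A: "\<And>x. jap x ^ q * norm (f x) \<le> A" and B: "\<And>x. norm (g x) \<le> B"
      using schwartzD[OF Nil(1), of q "[]"] schwartzD[OF Nil(2), of 0 "[]"] by auto
    have "jap x ^ q * norm (f x * g x) \<le> A * B" for x
      using mult_mono[OF A[of x] B[of x]] order_trans[OF _ A[of x], of 0] by (simp add: norm_mult mult_ac)
    then show ?case by auto
  next
    case (Cons j "is")
    obtain A B where A: "\<And>x. jap x ^ q * norm (leibniz is (partial_deriv j f) g x) \<le> A"
      and B: "\<And>x. jap x ^ q * norm (leibniz is f (partial_deriv j g) x) \<le> B"
      using Cons.IH Cons.prems schwartz_partial_deriv by meson
    have "jap x ^ q * norm (leibniz (j # is) f g x) \<le> A + B" for x
      using mult_left_mono[OF norm_triangle_ineq, of "jap x ^ q" "leibniz is (partial_deriv j f) g x" "leibniz is f (partial_deriv j g) x"]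
        A[of x] B[of x] by (simp add: distrib_left)
    then show ?case by blast
  qed
  with assms show ?thesis
    by (auto simp: schwartz_iff smooth_mult iter_partial_mult)
qed

section \<open>Integrability of polynomially growing functions against Schwartz functions\<close>

lemma integrable_jap_schwartz:
  fixes f :: "real ^ 'n::finite \<Rightarrow> complex"
  assumes "f \<in> schwartz"
  shows "integrable lborel (\<lambda>x. jap x ^ q * norm (f x))"
proof -
  \<comment> \<open>Of the available decay, q powers absorb the weight and d + 2 powers pay for
    integrability.\<close>
  obtain C where C: "\<And>x. jap x ^ (CARD('n) + 2 + q) * norm (f x) \<le> C"
    using schwartzD[OF assms, of "CARD('n) + 2 + q" "[]"] unfolding iter_partial.simps by blast
  note [measurable] = borel_measurable_smooth[OF schwartz_smooth[OF assms]]
  show ?thesis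
  proof (rule Bochner_Integration.integrable_bound)
    show "integrable lborel (\<lambda>x::real ^ 'n. C * inverse (jap x ^ (CARD('n) + 2)))"
      by (intro integrable_mult_right integrable_inverse_jap)
    have "jap x ^ q * norm (f x) \<le> C * inverse (jap x ^ (CARD('n) + 2))" for x
      using C[of x] unfolding power_add[of _ "CARD('n) + 2"] 
      by (simp add: divide_inverse[symmetric] pos_le_divide_eq mult_ac del: power_add power_Suc)
    then show "AE x in lborel. norm (jap x ^ q * norm (f x)) \<le> norm (C * inverse (jap x ^ (CARD('n) + 2)))"
      by (intro AE_I2) (smt (verit) jap_nonneg norm_ge_zero real_norm_def zero_le_mult_iff zero_le_power)
  qed measurable
qed

lemma integrable_growth_schwartz:
  fixes f :: "real ^ 'n::finite \<Rightarrow> complex" and h :: "real ^ 'n::finite \<Rightarrow> complex"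
  assumes f: "f \<in> schwartz" and [measurable]: "h \<in> borel_measurable borel" and h: "\<And>x. norm (h x) \<le> C * jap x ^ q"
  shows "integrable lborel (\<lambda>x. h x * f x)"
proof (rule Bochner_Integration.integrable_bound)
  show "integrable lborel (\<lambda>x. C * (jap x ^ q * norm (f x)))"
    by (intro integrable_mult_right integrable_jap_schwartz f)
  show "AE x in lborel. norm (h x * f x) \<le> norm (C * (jap x ^ q * norm (f x)))"
  proof (rule AE_I2)
    fix x
    have "norm (h x * f x) \<le> (C * jap x ^ q) * norm (f x)"
      unfolding norm_mult by (intro mult_right_mono h) auto
    then show "norm (h x * f x) \<le> norm (C * (jap x ^ q * norm (f x)))" by (simp add: mult_ac)
  qed
qed (use borel_measurable_smooth[OF schwartz_smooth[OF f]] in measurable)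

section \<open>Smooth dependence of integrals on a parameter\<close>

text \<open>Differentiation under the integral for the total derivative. The majorant may grow
  polynomially in the parameter y, because dominated convergence is applied along a convergent,
  hence bounded, sequence. The measure is arbitrary so that series can be treated as well.\<close>

lemma has_derivative_integral_dominated:
  fixes \<Phi> :: "real ^ 'n::finite \<Rightarrow> 'b \<Rightarrow> complex" and P :: "'n \<Rightarrow> real ^ 'n \<Rightarrow> 'b \<Rightarrow> complex"
  assumes int: "\<And>x. integrable M (\<Phi> x)"
    and meas [measurable]: "\<And>i. P i x \<in> borel_measurable M"
    and d: "\<And>y z. z \<in> space M \<Longrightarrow> ((\<lambda>y. \<Phi> y z) has_derivative (\<lambda>v. \<Sum>i\<in>UNIV. v $ i *\<^sub>R P i y z)) (at y)"
    and bd: "\<And>i y z. z \<in> space M \<Longrightarrow> norm (P i y z) \<le> jap y ^ q * B z"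
    and B: "integrable M B"
  shows "((\<lambda>y. \<integral>z. \<Phi> y z \<partial>M) has_derivative (\<lambda>v. \<Sum>i\<in>UNIV. v $ i *\<^sub>R (\<integral>z. P i x z \<partial>M))) (at x)"
proof -
  have [measurable]: "\<Phi> y \<in> borel_measurable M" for y by (rule borel_measurable_integrable[OF int])
  have B0: "0 \<le> B z" if "z \<in> space M" for z
    using jap_bound_nonneg bd[OF that] by (metis mult.commute)
  have Pint: "integrable M (P i x)" for i
    by (rule Bochner_Integration.integrable_bound[of _ "\<lambda>z. jap x ^ q * B z"])
       (use B bd B0 in \<open>auto intro!: AE_I2\<close>)
  have "((\<lambda>y. ((\<integral>z. \<Phi> y z \<partial>M) - (\<integral>z. \<Phi> x z \<partial>M) - (\<Sum>i\<in>UNIV. (y - x) $ i *\<^sub>R (\<integral>z. P i x z \<partial>M))) /\<^sub>R norm (y - x))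
     \<longlongrightarrow> 0) (at x)"
    unfolding tendsto_at_iff_sequentially
  proof (intro allI impI)
    fix X :: "nat \<Rightarrow> real ^ 'n"
    assume X: "\<forall>i. X i \<in> UNIV - {x}" and lim: "X \<longlonglongrightarrow> x"
    define s where "s k z = (\<Phi> (X k) z - \<Phi> x z - (\<Sum>i\<in>UNIV. (X k - x) $ i *\<^sub>R P i x z)) /\<^sub>R norm (X k - x)" for k z
    obtain R0 where R0: "\<And>k. norm (X k) \<le> R0"
      using convergent_imp_bounded[OF lim] by (auto simp: bounded_iff)
    define R where "R = max R0 (norm x)"
    have R: "norm (X k) \<le> R" "norm x \<le> R" for k using R0[of k] by (auto simp: R_def)
    \<comment> \<open>A bound for the operator norm of the derivative on the ball of radius R: each
      of the d partial derivatives is at most (1 + R)^q times \<open>B z\<close> there.\<close>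
    define K where "K z = real CARD('n) * ((1 + R) ^ q * B z)" for z
    have on: "norm (\<Sum>i\<in>UNIV. v $ i *\<^sub>R P i y z) \<le> K z * norm v" if "norm y \<le> R" "z \<in> space M" for y z v
    proof -
      have j: "jap y ^ q \<le> (1 + R) ^ q"
        using jap_le[of y] that(1) by (intro power_mono) auto
      have "norm (\<Sum>i\<in>UNIV. v $ i *\<^sub>R P i y z) \<le> (\<Sum>i\<in>(UNIV :: 'n set). norm v * ((1 + R) ^ q * B z))"
      proof (rule sum_norm_le)
        fix i
        have "norm (P i y z) \<le> (1 + R) ^ q * B z"
          by (rule order_trans[OF bd[OF that(2)] mult_right_mono[OF j B0[OF that(2)]]])
        then show "norm (v $ i *\<^sub>R P i y z) \<le> norm v * ((1 + R) ^ q * B z)"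
          unfolding norm_scaleR by (intro mult_mono component_le_norm_cart) auto
      qed
      also have "\<dots> = K z * norm v" by (simp add: K_def)
      finally show ?thesis .
    qed
    \<comment> \<open>The mean value inequality on the convex ball bounds the increment of \<Phi> by
      \<open>K z\<close> times the step, and its linear part obeys the same bound; this gives the
      factor 2.\<close>
    have bound: "norm (s k z) \<le> 2 * K z" if z: "z \<in> space M" for k z
    proof -
      have "norm (\<Phi> (X k) z - \<Phi> x z) \<le> K z * norm (X k - x)"
      proof (rule differentiable_bound[of "cball 0 R" "\<lambda>y. \<Phi> y z"])
        show "((\<lambda>y. \<Phi> y z) has_derivative (\<lambda>v. \<Sum>i\<in>UNIV. v $ i *\<^sub>R P i y z)) (at y within cball 0 R)" for y
          by (rule has_derivative_at_withinI[OF d[OF z]])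
        show "onorm (\<lambda>v. \<Sum>i\<in>UNIV. v $ i *\<^sub>R P i y z) \<le> K z" if "y \<in> cball 0 R" for y
          using that z by (intro onorm_le on) auto
      qed (use R in auto)
      moreover have "norm (\<Sum>i\<in>UNIV. (X k - x) $ i *\<^sub>R P i x z) \<le> K z * norm (X k - x)"
        by (rule on[OF R(2) z])
      ultimately have "norm (\<Phi> (X k) z - \<Phi> x z - (\<Sum>i\<in>UNIV. (X k - x) $ i *\<^sub>R P i x z)) \<le> 2 * K z * norm (X k - x)"
        using norm_triangle_ineq4[of "\<Phi> (X k) z - \<Phi> x z" "\<Sum>i\<in>UNIV. (X k - x) $ i *\<^sub>R P i x z"] by simp
      moreover have "0 < norm (X k - x)" using X by simp
      moreover have "norm (s k z) = norm (\<Phi> (X k) z - \<Phi> x z - (\<Sum>i\<in>UNIV. (X k - x) $ i *\<^sub>R P i x z)) / norm (X k - x)"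
        by (simp add: s_def divide_inverse mult.commute del: vector_minus_component)
      ultimately show ?thesis by (simp add: pos_divide_le_eq del: vector_minus_component)
    qed
    have "(\<lambda>k. \<integral>z. s k z \<partial>M) \<longlonglongrightarrow> (\<integral>z. 0 \<partial>M)"
    proof (rule integral_dominated_convergence[where w = "\<lambda>z. 2 * K z"])
      show "integrable M (\<lambda>z. 2 * K z)" using B by (simp add: K_def)
      show "AE z in M. (\<lambda>k. s k z) \<longlonglongrightarrow> 0"
      proof (rule AE_I2)
        fix z assume "z \<in> space M"
        from d[OF this, of x] have "((\<lambda>y. (\<Phi> y z - \<Phi> x z - (\<Sum>i\<in>UNIV. (y - x) $ i *\<^sub>R P i x z)) /\<^sub>R norm (y - x)) \<longlongrightarrow> 0) (at x)"
          unfolding has_derivative_at_within by blast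
        then show "(\<lambda>k. s k z) \<longlonglongrightarrow> 0"
          unfolding tendsto_at_iff_sequentially s_def comp_def using X lim by blast
      qed
    qed (use bound in \<open>auto simp: s_def intro!: AE_I2\<close>)
    moreover have "(\<integral>z. s k z \<partial>M) = ((\<integral>z. \<Phi> (X k) z \<partial>M) - (\<integral>z. \<Phi> x z \<partial>M) -
        (\<Sum>i\<in>UNIV. (X k - x) $ i *\<^sub>R (\<integral>z. P i x z \<partial>M))) /\<^sub>R norm (X k - x)" for k
      unfolding s_def using int Pint
      by (simp add: Bochner_Integration.integral_diff Bochner_Integration.integral_sum del: vector_minus_component)
    ultimately show "((\<lambda>y. ((\<integral>z. \<Phi> y z \<partial>M) - (\<integral>z. \<Phi> x z \<partial>M) -
        (\<Sum>i\<in>UNIV. (y - x) $ i *\<^sub>R (\<integral>z. P i x z \<partial>M))) /\<^sub>R norm (y - x)) \<circ> X) \<longlonglongrightarrow> 0"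
      by (simp add: comp_def del: vector_minus_component)
  qed
  then show ?thesis
    unfolding has_derivative_at_within
    by (auto intro!: bounded_linear_sum bounded_linear_compose[OF bounded_linear_scaleR_left bounded_linear_vec_nth])
qed

text \<open>The integrals of the derivatives form a family closed under differentiation, so the
  derivative of every order is obtained without an induction on the order. Exponent and majorant may
  depend on the list.\<close>

lemma
  fixes \<Phi> :: "real ^ 'n::finite \<Rightarrow> 'b \<Rightarrow> complex"
  assumes sm: "\<And>z. z \<in> space M \<Longrightarrow> smooth (\<lambda>x. \<Phi> x z)"
    and meas: "\<And>js x. (\<lambda>z. iter_partial js (\<lambda>x. \<Phi> x z) x) \<in> borel_measurable M"
    and bd: "\<And>js. \<exists>q B. integrable M B \<and> (\<forall>x. \<forall>z\<in>space M. norm (iter_partial js (\<lambda>x. \<Phi> x z) x) \<le> jap x ^ q * B z)"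
  shows integrable_iter_partial_parameter: "integrable M (\<lambda>z. iter_partial js (\<lambda>x. \<Phi> x z) x)"
    and iter_partial_integral: "iter_partial js (\<lambda>x. \<integral>z. \<Phi> x z \<partial>M) = (\<lambda>x. \<integral>z. iter_partial js (\<lambda>x. \<Phi> x z) x \<partial>M)"
    and smooth_integral: "smooth (\<lambda>x. \<integral>z. \<Phi> x z \<partial>M)"
proof -
  obtain q B where B: "\<And>js. integrable M (B js)"
    and bd': "\<And>js x z. z \<in> space M \<Longrightarrow> norm (iter_partial js (\<lambda>x. \<Phi> x z) x) \<le> jap x ^ q js * B js z"
    using bd by metis
  have B0: "0 \<le> B js z" if "z \<in> space M" for z js
    using jap_bound_nonneg bd'[OF that] by (metis mult.commute)
  have int: "integrable M (\<lambda>z. iter_partial js (\<lambda>x. \<Phi> x z) x)" for js x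
    by (rule Bochner_Integration.integrable_bound[of _ "\<lambda>z. jap x ^ q js * B js z"])
       (use B bd' B0 meas in \<open>auto intro!: AE_I2\<close>)
  then show "integrable M (\<lambda>z. iter_partial js (\<lambda>x. \<Phi> x z) x)" .
  let ?D = "\<lambda>js x. \<integral>z. iter_partial js (\<lambda>x. \<Phi> x z) x \<partial>M"
  have D: "(?D js has_derivative (\<lambda>v. \<Sum>i\<in>UNIV. v $ i *\<^sub>R ?D (i # js) x)) (at x)" for js x
  \<comment> \<open>The next partial derivatives come with d different exponents and majorants;
    their sums dominate all of them at once.\<close>
  proof (rule has_derivative_integral_dominated[where
        q = "\<Sum>i\<in>UNIV. q (i # js)" and B = "\<lambda>z. \<Sum>i\<in>UNIV. B (i # js) z"
        and P = "\<lambda>i y z. iter_partial (i # js) (\<lambda>x. \<Phi> x z) y"])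
    show "norm (iter_partial (i # js) (\<lambda>x. \<Phi> x z) y) \<le> jap y ^ (\<Sum>i\<in>UNIV. q (i # js)) * (\<Sum>i\<in>UNIV. B (i # js) z)"
      if z: "z \<in> space M" for i y z
      by (rule order_trans[OF bd'[OF z] mult_mono])
         (auto intro!: jap_power_mono member_le_sum B0[OF z])
  qed (use int meas B sm in \<open>auto intro: smooth_has_derivative simp del: iter_partial.simps\<close>)
  show "iter_partial js (\<lambda>x. \<integral>z. \<Phi> x z \<partial>M) = ?D js"
    by (rule iter_partial_familyI[where D = ?D]) (simp, rule D)
  show "smooth (\<lambda>x. \<integral>z. \<Phi> x z \<partial>M)"
    by (rule smooth_familyI[where D = ?D]) (simp, rule D)
qed

section \<open>Tempered distributions\<close>

lemma
  assumes f: "f \<in> schwartz"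
  shows schwartz_seminorm_nonneg: "0 \<le> schwartz_seminorm q l f"
    and schwartz_seminorm_mono: "q \<le> q' \<Longrightarrow> l \<le> l' \<Longrightarrow> schwartz_seminorm q l f \<le> schwartz_seminorm q' l' f"
    and schwartz_seminorm_cmult: "schwartz_seminorm q l (\<lambda>x. c * f x) \<le> norm c * schwartz_seminorm q l f"
proof -
  show "0 \<le> schwartz_seminorm q l f"
    using schwartz_seminorm_ge[OF f, of "[]" l 0 q] order_trans[of 0 "jap 0 ^ q * norm (f 0)"] by simp
  show "schwartz_seminorm q l f \<le> schwartz_seminorm q' l' f" if "q \<le> q'" "l \<le> l'"
  proof (rule schwartz_seminorm_le[OF f])
    fix js :: "'a list" and x assume "length js \<le> l"
    have "jap x ^ q * norm (iter_partial js f x) \<le> jap x ^ q' * norm (iter_partial js f x)"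
      by (intro mult_right_mono jap_power_mono that) simp
    also have "\<dots> \<le> schwartz_seminorm q' l' f"
      using \<open>length js \<le> l\<close> that by (intro schwartz_seminorm_ge f) simp
    finally show "jap x ^ q * norm (iter_partial js f x) \<le> schwartz_seminorm q' l' f" .
  qed
  show "schwartz_seminorm q l (\<lambda>x. c * f x) \<le> norm c * schwartz_seminorm q l f"
  proof (rule schwartz_seminorm_le[OF schwartz_cmult[OF f]])
    fix js :: "'a list" and x assume "length js \<le> l"
    from mult_left_mono[OF schwartz_seminorm_ge[OF f this, of x q], of "norm c"]
    show "jap x ^ q * norm (iter_partial js (\<lambda>x. c * f x) x) \<le> norm c * schwartz_seminorm q l f"
      by (simp add: iter_partial_cmult[OF schwartz_smooth[OF f]] norm_mult mult_ac)
  qed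
qed

lemma schwartz_seminorm_triangle:
  assumes f: "f \<in> schwartz" and g: "g \<in> schwartz"
  shows "schwartz_seminorm q l (\<lambda>x. f x + g x) \<le> schwartz_seminorm q l f + schwartz_seminorm q l g"
proof (rule schwartz_seminorm_le[OF schwartz_add[OF f g]])
  fix js :: "'a list" and x assume l: "length js \<le> l"
  have "jap x ^ q * norm (iter_partial js (\<lambda>x. f x + g x) x)
      \<le> jap x ^ q * (norm (iter_partial js f x) + norm (iter_partial js g x))"
    by (auto simp: iter_partial_add[OF schwartz_smooth[OF f] schwartz_smooth[OF g]]
        intro!: mult_left_mono norm_triangle_ineq)
  also have "\<dots> \<le> schwartz_seminorm q l f + schwartz_seminorm q l g"
    using schwartz_seminorm_ge[OF f l, of x q] schwartz_seminorm_ge[OF g l, of x q] by (simp add: distrib_left)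
  finally show "jap x ^ q * norm (iter_partial js (\<lambda>x. f x + g x) x)
     \<le> schwartz_seminorm q l f + schwartz_seminorm q l g" .
qed

lemma schwartz_seminorm_zero: "schwartz_seminorm q l (\<lambda>x. 0) = 0"
proof (rule antisym)
  show "schwartz_seminorm q l (\<lambda>x. 0) \<le> 0"
    by (rule schwartz_seminorm_le[OF schwartz_zero]) (simp add: iter_partial_zero)
qed (rule schwartz_seminorm_nonneg[OF schwartz_zero])

lemma topspace_schwartz_topology: "topspace schwartz_topology = schwartz"
proof -
  let ?B = "{{g \<in> schwartz. schwartz_seminorm q l (\<lambda>x. g x - f x) < r} |f q l r. f \<in> schwartz \<and> 0 < r}"
  have "f \<in> \<Union> ?B" if "f \<in> schwartz" for f :: "real ^ 'a::finite \<Rightarrow> complex"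
  proof (rule UnionI)
    show "{g \<in> schwartz. schwartz_seminorm 0 0 (\<lambda>x. g x - f x) < 1} \<in> ?B"
      using that zero_less_one by blast
    show "f \<in> {g \<in> schwartz. schwartz_seminorm 0 0 (\<lambda>x. g x - f x) < 1}"
      using that by (simp add: schwartz_seminorm_zero)
  qed
  then show ?thesis unfolding schwartz_topology_def topology_generated_by_topspace by blast
qed

text \<open>The seminorms increase in both indices, so a finite intersection of seminorm balls
  around a point contains a single one. For a subbasic set with another centre, the triangle
  inequality recentres the ball.\<close>

lemma openin_schwartz_topology_nbhd:
  assumes "openin schwartz_topology U" "f \<in> U"
  shows "\<exists>q l r. 0 < r \<and> {g \<in> schwartz. schwartz_seminorm q l (\<lambda>x. g x - f x) < r} \<subseteq> U"
  using assms unfolding schwartz_topology_def openin_topology_generated_by_iff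
proof (induction arbitrary: f rule: generate_topology_on.induct)
  case (Int U V)
  obtain q l r q' l' r' where *: "0 < r" "{g \<in> schwartz. schwartz_seminorm q l (\<lambda>x. g x - f x) < r} \<subseteq> U"
    "0 < r'" "{g \<in> schwartz. schwartz_seminorm q' l' (\<lambda>x. g x - f x) < r'} \<subseteq> V"
    using Int.IH[of f] Int.prems by (meson IntD1 IntD2)
  have f: "f \<in> schwartz"
  proof -
    have "openin schwartz_topology U"
      unfolding schwartz_topology_def openin_topology_generated_by_iff by (rule Int.hyps)
    from openin_subset[OF this] Int.prems show ?thesis by (auto simp: topspace_schwartz_topology)
  qed
  have "{g \<in> schwartz. schwartz_seminorm (max q q') (max l l') (\<lambda>x. g x - f x) < min r r'} \<subseteq> U \<inter> V"
  proof safe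
    fix g assume g: "g \<in> schwartz" "schwartz_seminorm (max q q') (max l l') (\<lambda>x. g x - f x) < min r r'"
    have "schwartz_seminorm q l (\<lambda>x. g x - f x) < r" "schwartz_seminorm q' l' (\<lambda>x. g x - f x) < r'"
      using schwartz_seminorm_mono[OF schwartz_diff[OF g(1) f], of q "max q q'" l "max l l'"]
        schwartz_seminorm_mono[OF schwartz_diff[OF g(1) f], of q' "max q q'" l' "max l l'"] g(2) by auto
    with * g(1) show "g \<in> U" "g \<in> V" by auto
  qed
  moreover have "0 < min r r'" using * by simp
  ultimately show ?case by blast
next
  case (UN K)
  then show ?case by (meson Sup_upper UnionE subset_trans)
next
  case (Basis s)
  then obtain f0 q l r where f0: "f0 \<in> schwartz" and r: "0 < r"
    and s: "s = {g \<in> schwartz. schwartz_seminorm q l (\<lambda>x. g x - f0 x) < r}" by blast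
  with Basis have f: "f \<in> schwartz" "schwartz_seminorm q l (\<lambda>x. f x - f0 x) < r" by auto
  have "{g \<in> schwartz. schwartz_seminorm q l (\<lambda>x. g x - f x) < r - schwartz_seminorm q l (\<lambda>x. f x - f0 x)} \<subseteq> s"
  proof safe
    fix g assume g: "g \<in> schwartz" "schwartz_seminorm q l (\<lambda>x. g x - f x) < r - schwartz_seminorm q l (\<lambda>x. f x - f0 x)"
    have "schwartz_seminorm q l (\<lambda>x. g x - f0 x) < r"
      using schwartz_seminorm_triangle[OF schwartz_diff[OF g(1) f(1)] schwartz_diff[OF f(1) f0], of q l] g(2) by simp
    with g(1) s show "g \<in> s" by simp
  qed
  with f(2) show ?case by (meson diff_gt_0_iff_gt)
qed auto

lemma
  assumes T: "T \<in> tempered"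
  shows tempered_add: "f \<in> schwartz \<Longrightarrow> g \<in> schwartz \<Longrightarrow> T (\<lambda>x. f x + g x) = T f + T g"
    and tempered_cmult: "f \<in> schwartz \<Longrightarrow> T (\<lambda>x. c * f x) = c * T f"
    and tempered_extensional: "T \<in> extensional schwartz"
  using T by (auto simp: tempered_def)

lemma tempered_diff:
  assumes "T \<in> tempered" "f \<in> schwartz" "g \<in> schwartz"
  shows "T (\<lambda>x. f x - g x) = T f - T g"
  using tempered_add[OF assms(1,2) schwartz_cmult[OF assms(3), of "-1"]] tempered_cmult[OF assms(1,3), of "-1"] by simp

lemma tempered_zero:
  assumes "T \<in> tempered"
  shows "T (\<lambda>x. 0) = 0"
  using tempered_cmult[OF assms schwartz_zero, of 0] by simp

lemma tempered_sum:
  assumes T: "T \<in> tempered" and "finite A" and "\<And>i. i \<in> A \<Longrightarrow> f i \<in> schwartz"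
  shows "T (\<lambda>x. \<Sum>i\<in>A. c i * f i x) = (\<Sum>i\<in>A. c i * T (f i))"
  using assms(2,3)
proof (induction rule: finite_induct)
  case (insert i A)
  then show ?case
    using tempered_add[OF T schwartz_cmult[of "f i" "c i"] schwartz_sum[of A "\<lambda>i x. c i * f i x"]]
    by (simp add: schwartz_cmult tempered_cmult[OF T])
qed (simp add: tempered_zero[OF T])

text \<open>Continuity at 0 puts the image of some seminorm ball into the unit disc; homogeneity
  turns this into a global estimate.\<close>

lemma tempered_bounded:
  assumes T: "T \<in> tempered"
  shows "\<exists>q l C. 0 \<le> C \<and> (\<forall>f\<in>schwartz. norm (T f) \<le> C * schwartz_seminorm q l f)"
proof -
  have "continuous_map schwartz_topology euclidean T" using T by (simp add: tempered_def)
  then have "openin schwartz_topology {f \<in> topspace schwartz_topology. T f \<in> ball 0 1}"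
    by (rule openin_continuous_map_preimage) (simp flip: open_openin)
  moreover have "(\<lambda>x. 0) \<in> {f \<in> topspace schwartz_topology. T f \<in> ball 0 1}"
    by (simp add: topspace_schwartz_topology schwartz_zero tempered_zero[OF T])
  ultimately obtain q l r where r: "0 < r"
    and sub: "{g \<in> schwartz. schwartz_seminorm q l (\<lambda>x. g x - 0) < r} \<subseteq> {f \<in> topspace schwartz_topology. T f \<in> ball 0 1}"
    using openin_schwartz_topology_nbhd by blast
  have "norm (T f) \<le> 2 / r * schwartz_seminorm q l f" if f: "f \<in> schwartz" for f
  proof (cases "schwartz_seminorm q l f = 0")
    \<comment> \<open>Each seminorm dominates the sup norm, so it vanishes only at the zero
      function.\<close>
    case True
    have "norm (f x) \<le> 0" for x
    proof -
      have "jap x ^ q * norm (f x) \<le> 0"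
        using schwartz_seminorm_ge[OF f, of "[]" l x q] True by simp
      moreover have "norm (f x) \<le> jap x ^ q * norm (f x)"
        using mult_right_mono[OF jap_power_ge_1, of "norm (f x)" x q] by simp
      ultimately show ?thesis by linarith
    qed
    then have "f = (\<lambda>x. 0)" by auto
    then show ?thesis using True tempered_zero[OF T] by simp
  next
    case False
    let ?p = "schwartz_seminorm q l f"
    have p: "0 < ?p" using False schwartz_seminorm_nonneg[OF f, of q l] by linarith
    \<comment> \<open>This scaling brings the seminorm down to r/2, strictly inside the
      ball.\<close>
    define c where "c = r / (2 * ?p)"
    have c: "0 < c" using r p by (simp add: c_def)
    have "schwartz_seminorm q l (\<lambda>x. of_real c * f x) \<le> c * ?p"
      using schwartz_seminorm_cmult[OF f, of q l "of_real c"] c by simp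
    also have "\<dots> < r" using r p by (simp add: c_def)
    finally have "(\<lambda>x. of_real c * f x) \<in> {f \<in> topspace schwartz_topology. T f \<in> ball 0 1}"
      using sub schwartz_cmult[OF f, of "of_real c"] by auto
    then have "c * norm (T f) < 1"
      using tempered_cmult[OF T f, of "of_real c"] c by (simp add: norm_mult)
    then have "norm (T f) \<le> 1 / c" using c by (simp add: field_simps)
    also have "\<dots> = 2 / r * ?p" using r p by (simp add: c_def)
    finally show ?thesis .
  qed
  with r show ?thesis by (intro exI[of _ q] exI[of _ l] exI[of _ "2 / r"]) auto
qed

lemma temperedI:
  assumes "T \<in> extensional schwartz"
    and add: "\<And>f g. f \<in> schwartz \<Longrightarrow> g \<in> schwartz \<Longrightarrow> T (\<lambda>x. f x + g x) = T f + T g"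
    and cmult: "\<And>c f. f \<in> schwartz \<Longrightarrow> T (\<lambda>x. c * f x) = c * T f"
    and bd: "\<And>f. f \<in> schwartz \<Longrightarrow> norm (T f) \<le> C * schwartz_seminorm q l f"
  shows "T \<in> tempered"
proof -
  have "openin schwartz_topology {f \<in> topspace schwartz_topology. T f \<in> U}" if U: "open U" for U
  proof (subst openin_subopen, safe)
    fix f assume "f \<in> topspace schwartz_topology" and fU: "T f \<in> U"
    then have f: "f \<in> schwartz" by (simp add: topspace_schwartz_topology)
    obtain e where e: "0 < e" "ball (T f) e \<subseteq> U" using U fU openE by blast
    \<comment> \<open>\<open>C\<close> may have any sign or be 0, so the radius uses \<bar>C\<bar> +
      1.\<close>
    define r where "r = e / (\<bar>C\<bar> + 1)"
    have r: "0 < r" using e by (simp add: r_def)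
    let ?V = "{g \<in> schwartz. schwartz_seminorm q l (\<lambda>x. g x - f x) < r}"
    have "openin schwartz_topology ?V"
      unfolding schwartz_topology_def by (rule topology_generated_by_Basis) (use f r in blast)
    moreover have "f \<in> ?V"
      using f r by (simp add: schwartz_seminorm_zero)
    moreover have "?V \<subseteq> {f \<in> topspace schwartz_topology. T f \<in> U}"
    proof safe
      fix g assume g: "g \<in> schwartz" "schwartz_seminorm q l (\<lambda>x. g x - f x) < r"
      then show "g \<in> topspace schwartz_topology" by (simp add: topspace_schwartz_topology)
      have d: "(\<lambda>x. g x - f x) \<in> schwartz" by (rule schwartz_diff[OF g(1) f])
      have "T g = T (\<lambda>x. (g x - f x) + f x)" by simp
      also have "\<dots> = T (\<lambda>x. g x - f x) + T f" by (rule add[OF d f])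
      finally have "norm (T g - T f) = norm (T (\<lambda>x. g x - f x))" by simp
      also have "\<dots> \<le> C * schwartz_seminorm q l (\<lambda>x. g x - f x)" by (rule bd[OF d])
      also have "\<dots> \<le> (\<bar>C\<bar> + 1) * schwartz_seminorm q l (\<lambda>x. g x - f x)"
        by (intro mult_right_mono schwartz_seminorm_nonneg d) simp
      also have "\<dots> < (\<bar>C\<bar> + 1) * r" using g(2) by (intro mult_strict_left_mono) auto
      also have "\<dots> = e" by (simp add: r_def)
      finally show "T g \<in> U" using e(2) by (auto simp: dist_norm norm_minus_commute)
    qed
    ultimately show "\<exists>V. openin schwartz_topology V \<and> f \<in> V \<and> V \<subseteq> {f \<in> topspace schwartz_topology. T f \<in> U}" by blast
  qed
  then have "continuous_map schwartz_topology euclidean T"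
    by (simp add: continuous_map_def flip: open_openin)
  with assms show ?thesis by (simp add: tempered_def)
qed

lemma O_M_bound: "f \<in> O_M \<Longrightarrow> \<exists>q C. \<forall>x. norm (iter_partial js f x) \<le> C * jap x ^ q"
  by (simp add: O_M_iff)

lemma O_M_integrable:
  assumes f: "f \<in> O_M" and \<phi>: "\<phi> \<in> schwartz"
  shows "integrable lborel (\<lambda>x. f x * \<phi> x)"
proof -
  obtain q C where "\<And>x. norm (f x) \<le> C * jap x ^ q" using O_M_bound[OF f, of "[]"] by auto
  then show ?thesis
    by (rule integrable_growth_schwartz[OF \<phi> borel_measurable_smooth[OF O_M_smooth[OF f]]])
qed

lemma integral_norm_bound_jap:
  fixes f g :: "real ^ 'n::finite \<Rightarrow> complex"
  assumes g: "g \<in> schwartz" and f: "\<And>x. norm (f x) \<le> C * jap x ^ q * norm (g x)"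
  shows "norm (LINT x|lborel. f x) \<le> C * (LINT x|lborel. jap x ^ q * norm (g x))"
proof -
  have int: "integrable lborel (\<lambda>x. C * (jap x ^ q * norm (g x)))"
    by (intro integrable_mult_right integrable_jap_schwartz g)
  have f': "norm (f x) \<le> C * (jap x ^ q * norm (g x))" for x using f[of x] by (simp add: mult.assoc)
  have "norm (LINT x|lborel. f x) \<le> (LINT x|lborel. C * (jap x ^ q * norm (g x)))"
  proof (cases "integrable lborel f")
    case True
    then show ?thesis by (rule Bochner_Integration.integral_norm_bound_integral[OF _ int]) (rule f')
  next
    \<comment> \<open>By convention the integral of \<open>f\<close> is then 0, and it remains to
      see that the right-hand side is nonnegative.\<close>
    case False
    have "0 \<le> (LINT x|lborel. C * (jap x ^ q * norm (g x)))"
      by (rule Bochner_Integration.integral_nonneg) (rule order_trans[OF norm_ge_zero f'])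
    with False show ?thesis by (simp add: not_integrable_integral_eq)
  qed
  then show ?thesis by simp
qed

lemma distr_of_tempered:
  assumes f: "f \<in> O_M"
  shows "distr_of f \<in> tempered"
proof -
  obtain q C where C: "\<And>x. norm (f x) \<le> C * jap x ^ q" using O_M_bound[OF f, of "[]"] by auto
  let ?n = "CARD('a) + 2"
  let ?I = "LINT x|lborel. inverse (jap (x::real ^ 'a) ^ ?n)"
  note int = O_M_integrable[OF f]
  show ?thesis
  \<comment> \<open>q powers of decay compensate the growth of \<open>f\<close>, d + 2 more make the
    remaining weight integrable, and no derivatives are involved.\<close>
  proof (rule temperedI[where C = "C * ?I" and q = "q + ?n" and l = 0])
    show "distr_of f \<in> extensional schwartz" by (simp add: distr_of_def)
    show "distr_of f (\<lambda>x. g x + h x) = distr_of f g + distr_of f h" if "g \<in> schwartz" "h \<in> schwartz" for g h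
      using that int by (simp add: distr_of_def schwartz_add distrib_left)
    show "distr_of f (\<lambda>x. c * g x) = c * distr_of f g" if "g \<in> schwartz" for c g
      using that int[OF that] by (simp add: distr_of_def schwartz_cmult mult.left_commute)
    show "norm (distr_of f g) \<le> C * ?I * schwartz_seminorm (q + ?n) 0 g" if g: "g \<in> schwartz" for g
    proof -
      let ?p = "schwartz_seminorm (q + ?n) 0 g"
      have p: "norm (f x * g x) \<le> C * ?p * inverse (jap x ^ ?n)" for x
      proof -
        have "norm (f x * g x) \<le> C * jap x ^ q * norm (g x)"
          unfolding norm_mult by (intro mult_right_mono C) simp
        also have "\<dots> = C * (jap x ^ (q + ?n) * norm (g x)) * inverse (jap x ^ ?n)"
          by (simp only: power_add[of _ q]) (simp add: power_not_zero[OF jap_nonzero] mult_ac del: power_add power_Suc add_2_eq_Suc')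
        also have "\<dots> \<le> C * ?p * inverse (jap x ^ ?n)"
          using schwartz_seminorm_ge[OF g, of "[]" 0 x "q + ?n"]
          by (intro mult_right_mono mult_left_mono jap_bound_nonneg[OF C]) auto
        finally show ?thesis .
      qed
      have "norm (LINT x|lborel. f x * g x) \<le> (LINT x|lborel. C * ?p * inverse (jap (x :: real ^ 'a) ^ ?n))"
        by (rule Bochner_Integration.integral_norm_bound_integral)
           (intro int g integrable_mult_right integrable_inverse_jap p)+
      also have "\<dots> = C * ?I * ?p" by simp
      finally show ?thesis using g by (simp add: distr_of_def)
    qed
  qed
qed

section \<open>Integrals of translates\<close>

lemma integral_affine:
  fixes f :: "real ^ 'n::finite \<Rightarrow> complex"
  assumes [measurable]: "f \<in> borel_measurable borel" and "c \<noteq> 0"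
  shows "(LINT x|lborel. f x) = \<bar>c\<bar> ^ CARD('n) *\<^sub>R (LINT x|lborel. f (t + c *\<^sub>R x))"
proof -
  have "(LINT x|lborel. f x) = (LINT x|density (distr lborel borel (\<lambda>x. t + c *\<^sub>R x)) (\<lambda>x. ennreal (\<bar>c\<bar> ^ DIM(real ^ 'n))). f x)"
    using lborel_affine[OF assms(2), of t] by simp
  also have "\<dots> = (LINT x|distr lborel borel (\<lambda>x. t + c *\<^sub>R x). \<bar>c\<bar> ^ CARD('n) *\<^sub>R f x)"
    by (subst integral_density) auto
  also have "\<dots> = (LINT x|lborel. \<bar>c\<bar> ^ CARD('n) *\<^sub>R f (t + c *\<^sub>R x))"
    by (subst integral_distr) auto
  finally show ?thesis by simp
qed

text \<open>This is f convolved with the rescaled \<eta>, after substitution, so that the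
  derivatives fall on f. Since \<bar>\<delta>\<bar> \<le> 1 gives jap (\<delta> z) \<le> jap z, the
  bound does not depend on \<delta>; this is the uniformity that makes multipliers regular. Negative
  \<delta> covers the reflected mollifier.\<close>

lemma
  fixes f \<eta> :: "real ^ 'n::finite \<Rightarrow> complex"
  assumes f: "f \<in> O_M" and \<eta>: "\<eta> \<in> schwartz" and \<delta>: "\<bar>\<delta>\<bar> \<le> 1"
  shows iter_partial_O_M_conv: "iter_partial js (\<lambda>x. LINT z|lborel. f (x - \<delta> *\<^sub>R z) * \<eta> z)
      = (\<lambda>x. LINT z|lborel. iter_partial js f (x - \<delta> *\<^sub>R z) * \<eta> z)"
    and smooth_O_M_conv: "smooth (\<lambda>x. LINT z|lborel. f (x - \<delta> *\<^sub>R z) * \<eta> z)"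
    and O_M_conv_bound: "(\<And>x. norm (iter_partial js f x) \<le> C * jap x ^ q) \<Longrightarrow>
      norm (LINT z|lborel. iter_partial js f (x - \<delta> *\<^sub>R z) * \<eta> z)
        \<le> C * 2 ^ q * jap x ^ q * (LINT z|lborel. jap z ^ q * norm (\<eta> z))"
proof -
  note fs = O_M_smooth[OF f]
  note [measurable] = borel_measurable_iter_partial[OF fs] borel_measurable_smooth[OF schwartz_smooth[OF \<eta>]]
  have eq: "iter_partial js (\<lambda>x. f (x - \<delta> *\<^sub>R z) * \<eta> z) = (\<lambda>x. iter_partial js f (x - \<delta> *\<^sub>R z) * \<eta> z)"
    and sm: "smooth (\<lambda>x. f (x - \<delta> *\<^sub>R z) * \<eta> z)" for js z
  proof -
    have aff: "(\<lambda>x. f (x - \<delta> *\<^sub>R z) * \<eta> z) = (\<lambda>x. \<eta> z * f (- (\<delta> *\<^sub>R z) + 1 *\<^sub>R x))"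
      by (simp add: mult.commute)
    show "iter_partial js (\<lambda>x. f (x - \<delta> *\<^sub>R z) * \<eta> z) = (\<lambda>x. iter_partial js f (x - \<delta> *\<^sub>R z) * \<eta> z)"
      unfolding aff iter_partial_cmult[OF smooth_affine[OF fs]] iter_partial_affine[OF fs] by (simp add: mult.commute)
    show "smooth (\<lambda>x. f (x - \<delta> *\<^sub>R z) * \<eta> z)"
      unfolding aff by (intro smooth_cmult smooth_affine fs)
  qed
  have bd: "norm (iter_partial js f (x - \<delta> *\<^sub>R z) * \<eta> z) \<le> C * 2 ^ q * jap x ^ q * (jap z ^ q * norm (\<eta> z))"
    if C: "\<And>x. norm (iter_partial js f x) \<le> C * jap x ^ q" for js q C x z
  proof -
    have C0: "0 \<le> C" by (rule jap_bound_nonneg[OF C])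
    have "norm (iter_partial js f (x - \<delta> *\<^sub>R z)) \<le> C * jap (x - \<delta> *\<^sub>R z) ^ q" by (rule C)
    also have "\<dots> \<le> C * (2 ^ q * jap x ^ q * jap (\<delta> *\<^sub>R z) ^ q)"
      by (intro mult_left_mono jap_diff_power C0)
    also have "\<dots> \<le> C * (2 ^ q * jap x ^ q * jap z ^ q)"
      using C0 by (intro mult_left_mono power_mono jap_scaleR \<delta>) auto
    finally have "norm (iter_partial js f (x - \<delta> *\<^sub>R z)) * norm (\<eta> z) \<le> C * (2 ^ q * jap x ^ q * jap z ^ q) * norm (\<eta> z)"
      by (intro mult_right_mono) auto
    then show ?thesis by (simp add: norm_mult mult_ac)
  qed
  have *: "\<exists>q B. integrable lborel B \<and> (\<forall>x. \<forall>z\<in>space lborel. norm (iter_partial js (\<lambda>x. f (x - \<delta> *\<^sub>R z) * \<eta> z) x) \<le> jap x ^ q * B z)" for js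
  proof -
    obtain q C where C: "\<And>x. norm (iter_partial js f x) \<le> C * jap x ^ q" using O_M_bound[OF f] by blast
    have "integrable lborel (\<lambda>z. C * 2 ^ q * (jap z ^ q * norm (\<eta> z)))"
      by (intro integrable_mult_right integrable_jap_schwartz \<eta>)
    moreover have "norm (iter_partial js (\<lambda>x. f (x - \<delta> *\<^sub>R z) * \<eta> z) x) \<le> jap x ^ q * (C * 2 ^ q * (jap z ^ q * norm (\<eta> z)))" for x z
      using bd[OF C, of x z] unfolding eq by (simp add: mult_ac)
    ultimately show ?thesis by blast
  qed
  note ** = sm _ *
  show "iter_partial js (\<lambda>x. LINT z|lborel. f (x - \<delta> *\<^sub>R z) * \<eta> z)
      = (\<lambda>x. LINT z|lborel. iter_partial js f (x - \<delta> *\<^sub>R z) * \<eta> z)"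
    using iter_partial_integral[where M = lborel and \<Phi> = "\<lambda>x z. f (x - \<delta> *\<^sub>R z) * \<eta> z", OF **] by (simp add: eq)
  show "smooth (\<lambda>x. LINT z|lborel. f (x - \<delta> *\<^sub>R z) * \<eta> z)"
    using smooth_integral[where M = lborel and \<Phi> = "\<lambda>x z. f (x - \<delta> *\<^sub>R z) * \<eta> z", OF **] by (simp add: eq)
  assume C: "\<And>x. norm (iter_partial js f x) \<le> C * jap x ^ q"
  show "norm (LINT z|lborel. iter_partial js f (x - \<delta> *\<^sub>R z) * \<eta> z)
        \<le> C * 2 ^ q * jap x ^ q * (LINT z|lborel. jap z ^ q * norm (\<eta> z))"
    by (rule integral_norm_bound_jap[OF \<eta>]) (use bd[OF C] in \<open>simp add: mult.assoc\<close>)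
qed

lemma O_M_conv:
  fixes f \<eta> :: "real ^ 'n::finite \<Rightarrow> complex"
  assumes f: "f \<in> O_M" and \<eta>: "\<eta> \<in> schwartz" and \<delta>: "\<bar>\<delta>\<bar> \<le> 1"
  shows "(\<lambda>x. LINT z|lborel. f (x - \<delta> *\<^sub>R z) * \<eta> z) \<in> O_M"
  unfolding O_M_iff
proof (intro conjI allI smooth_O_M_conv[OF assms])
  fix js
  obtain q C where C: "\<And>x. norm (iter_partial js f x) \<le> C * jap x ^ q" using O_M_bound[OF f] by blast
  have "norm (iter_partial js (\<lambda>x. LINT z|lborel. f (x - \<delta> *\<^sub>R z) * \<eta> z) x)
     \<le> C * 2 ^ q * (LINT z|lborel. jap z ^ q * norm (\<eta> z)) * jap x ^ q" for x
    using O_M_conv_bound[OF assms C, of x] unfolding iter_partial_O_M_conv[OF assms] by (simp add: mult_ac)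
  then show "\<exists>q C. \<forall>x. norm (iter_partial js (\<lambda>x. LINT z|lborel. f (x - \<delta> *\<^sub>R z) * \<eta> z) x) \<le> C * jap x ^ q" by blast
qed

lemma iter_partial_reflect:
  assumes "smooth a"
  shows "iter_partial js (\<lambda>y. a (x - y)) = (\<lambda>y. (-1) ^ length js *\<^sub>R iter_partial js a (x - y))"
  using iter_partial_affine[OF assms, of js x "-1"] by simp

lemma smooth_reflect: "smooth a \<Longrightarrow> smooth (\<lambda>y. a (x - y))"
  using smooth_affine[of a x "-1"] by simp

lemma jap_le_of_norm_le_2: "norm y \<le> 2 * norm x \<Longrightarrow> jap y \<le> 2 * jap x"
proof -
  assume "norm y \<le> 2 * norm x"
  then have "(norm y)\<^sup>2 \<le> (2 * norm x)\<^sup>2" by (intro power_mono) auto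
  then have "sqrt (1 + (norm y)\<^sup>2) \<le> sqrt (4 * (1 + (norm x)\<^sup>2))"
    by (intro real_sqrt_le_mono) (simp add: power_mult_distrib)
  also have "\<dots> = 2 * sqrt (1 + (norm x)\<^sup>2)" by (simp only: real_sqrt_mult real_sqrt_four)
  finally show ?thesis by (simp only: jap_def)
qed

text \<open>The map \<open>s\<close> allows the translation variable to be replaced by a simple
  function; the identity gives the ordinary convolution. The bound \<open>2 * norm x\<close> is the
  one that the approximating simple functions satisfy, and it keeps jap (s x) comparable to jap x.
  The signs come from differentiating in the reflected variable y.\<close>

lemma
  fixes a \<psi> :: "real ^ 'n::finite \<Rightarrow> complex"
  assumes a: "a \<in> schwartz" and \<psi>: "\<psi> \<in> schwartz"
    and s [measurable]: "s \<in> borel_measurable borel" and s2: "\<And>x. norm (s x) \<le> 2 * norm x"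
  shows integrable_schwartz_conv: "integrable lborel (\<lambda>x. iter_partial js a (s x - y) * \<psi> x)"
    and iter_partial_schwartz_conv: "iter_partial js (\<lambda>y. LINT x|lborel. a (s x - y) * \<psi> x)
      = (\<lambda>y. (-1) ^ length js *\<^sub>R (LINT x|lborel. iter_partial js a (s x - y) * \<psi> x))"
    and schwartz_conv: "(\<lambda>y. LINT x|lborel. a (s x - y) * \<psi> x) \<in> schwartz"
proof -
  note as = schwartz_smooth[OF a]
  note [measurable] = borel_measurable_iter_partial[OF as] borel_measurable_smooth[OF schwartz_smooth[OF \<psi>]]
  have eq: "iter_partial js (\<lambda>y. a (s x - y) * \<psi> x) = (\<lambda>y. (-1) ^ length js *\<^sub>R (iter_partial js a (s x - y) * \<psi> x))"
    and sm: "smooth (\<lambda>y. a (s x - y) * \<psi> x)" for js x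
  proof -
    have comm: "(\<lambda>y. a (s x - y) * \<psi> x) = (\<lambda>y. \<psi> x * a (s x - y))"
      by (simp add: mult.commute)
    show "iter_partial js (\<lambda>y. a (s x - y) * \<psi> x) = (\<lambda>y. (-1) ^ length js *\<^sub>R (iter_partial js a (s x - y) * \<psi> x))"
      unfolding comm iter_partial_cmult[OF smooth_reflect[OF as]] iter_partial_reflect[OF as] by (simp add: mult.commute)
    show "smooth (\<lambda>y. a (s x - y) * \<psi> x)"
      unfolding comm by (intro smooth_cmult smooth_reflect as)
  qed
  have bd: "\<exists>C. \<forall>x y. jap y ^ q * norm (iter_partial js a (s x - y) * \<psi> x) \<le> C * jap x ^ q * norm (\<psi> x)" for js q
  proof -
    obtain C where C: "\<And>x. jap x ^ q * norm (iter_partial js a x) \<le> C" using schwartzD[OF a] by blast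
    have "jap y ^ q * norm (iter_partial js a (s x - y) * \<psi> x) \<le> 4 ^ q * C * jap x ^ q * norm (\<psi> x)" for x y
    proof -
      have "jap y ^ q = jap (s x - (s x - y)) ^ q" by simp
      also have "\<dots> \<le> 2 ^ q * jap (s x) ^ q * jap (s x - y) ^ q" by (rule jap_diff_power)
      also have "\<dots> \<le> 2 ^ q * (2 * jap x) ^ q * jap (s x - y) ^ q"
        by (intro mult_right_mono mult_left_mono power_mono jap_le_of_norm_le_2 s2) auto
      also have "\<dots> = 4 ^ q * jap x ^ q * jap (s x - y) ^ q"
      proof -
        have "(4::real) ^ q = 2 ^ q * 2 ^ q" by (simp flip: power_mult_distrib)
        then show ?thesis by (simp add: power_mult_distrib mult_ac)
      qed
      finally have "jap y ^ q * norm (iter_partial js a (s x - y)) \<le> 4 ^ q * jap x ^ q * jap (s x - y) ^ q * norm (iter_partial js a (s x - y))"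
        by (rule mult_right_mono) simp
      also have "\<dots> = 4 ^ q * jap x ^ q * (jap (s x - y) ^ q * norm (iter_partial js a (s x - y)))" by (simp add: mult_ac)
      also have "\<dots> \<le> 4 ^ q * jap x ^ q * C" by (intro mult_left_mono C) auto
      finally have "jap y ^ q * norm (iter_partial js a (s x - y)) * norm (\<psi> x) \<le> 4 ^ q * jap x ^ q * C * norm (\<psi> x)"
        by (rule mult_right_mono) simp
      then show ?thesis by (simp add: norm_mult mult_ac)
    qed
    then show ?thesis by blast
  qed
  have *: "\<exists>q B. integrable lborel B \<and> (\<forall>y. \<forall>x\<in>space lborel. norm (iter_partial js (\<lambda>y. a (s x - y) * \<psi> x) y) \<le> jap y ^ q * B x)" for js
  proof -
    \<comment> \<open>Differentiation under the integral only needs the unweighted case q = 0; the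
      weighted bounds give the decay afterwards.\<close>
    obtain C where C: "\<And>x y. jap y ^ 0 * norm (iter_partial js a (s x - y) * \<psi> x) \<le> C * jap x ^ 0 * norm (\<psi> x)"
      using bd[of 0 js] by blast
    have "integrable lborel (\<lambda>x. C * (jap x ^ 0 * norm (\<psi> x)))"
      by (intro integrable_mult_right integrable_jap_schwartz \<psi>)
    moreover have "norm (iter_partial js (\<lambda>y. a (s x - y) * \<psi> x) y) \<le> jap y ^ 0 * (C * (jap x ^ 0 * norm (\<psi> x)))" for x y
      using C[of y x] unfolding eq by (simp add: mult_ac)
    ultimately show ?thesis by blast
  qed
  note ** = sm _ *
  have ii: "integrable lborel (\<lambda>x. (-1) ^ length js *\<^sub>R (iter_partial js a (s x - y) * \<psi> x))" for js y
    using integrable_iter_partial_parameter[where M = lborel and \<Phi> = "\<lambda>y x. a (s x - y) * \<psi> x", OF **, of js y] by (simp add: eq)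
  show int: "integrable lborel (\<lambda>x. iter_partial js a (s x - y) * \<psi> x)" for js y
    using integrable_scaleR_right[OF ii[of js y], of "(-1) ^ length js"] by (simp flip: power_mult_distrib)
  show deriv: "iter_partial js (\<lambda>y. LINT x|lborel. a (s x - y) * \<psi> x)
      = (\<lambda>y. (-1) ^ length js *\<^sub>R (LINT x|lborel. iter_partial js a (s x - y) * \<psi> x))" for js
    using iter_partial_integral[where M = lborel and \<Phi> = "\<lambda>y x. a (s x - y) * \<psi> x", OF **, of js] by (simp add: eq)
  have "\<exists>C. \<forall>y. jap y ^ q * norm ((-1) ^ length js *\<^sub>R (LINT x|lborel. iter_partial js a (s x - y) * \<psi> x)) \<le> C" for js q
  proof -
    obtain C where C: "\<And>x y. jap y ^ q * norm (iter_partial js a (s x - y) * \<psi> x) \<le> C * jap x ^ q * norm (\<psi> x)"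
      using bd by blast
    have "jap y ^ q * norm (LINT x|lborel. iter_partial js a (s x - y) * \<psi> x) \<le> C * (LINT x|lborel. jap x ^ q * norm (\<psi> x))" for y
    proof -
      \<comment> \<open>The weight in y is taken inside the integral, where \<open>bd\<close> trades
        it for a weight in x that \<psi> absorbs.\<close>
      have "norm (LINT x|lborel. of_real (jap y ^ q) * (iter_partial js a (s x - y) * \<psi> x)) \<le> C * (LINT x|lborel. jap x ^ q * norm (\<psi> x))"
        by (rule integral_norm_bound_jap[OF \<psi>]) (use C[of y] in \<open>simp add: norm_mult norm_power\<close>)
      then show ?thesis by (simp add: norm_mult norm_power)
    qed
    then show ?thesis by auto
  qed
  moreover have "smooth (\<lambda>y. LINT x|lborel. a (s x - y) * \<psi> x)"
    using smooth_integral[where M = lborel and \<Phi> = "\<lambda>y x. a (s x - y) * \<psi> x", OF **] by (simp add: eq)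
  ultimately show "(\<lambda>y. LINT x|lborel. a (s x - y) * \<psi> x) \<in> schwartz"
    unfolding schwartz_iff deriv by blast
qed

section \<open>Regularisation of tempered distributions\<close>

text \<open>The mean value inequality costs one derivative, hence \<open>Suc l\<close> in the
  seminorm. On the ball of radius r the weight in y passes to w - y at the price (1 + r)^q. The
  explicit dependence on r later lets the estimate be integrated against a Schwartz function with r
  proportional to norm x.\<close>

lemma schwartz_translate_lipschitz:
  fixes a :: "real ^ 'n::finite \<Rightarrow> complex"
  assumes a: "a \<in> schwartz"
  shows "\<exists>K\<ge>0. \<forall>js x x' y r. length js \<le> l \<longrightarrow> norm x \<le> r \<longrightarrow> norm x' \<le> r \<longrightarrow>
    jap y ^ q * norm (iter_partial js a (x - y) - iter_partial js a (x' - y)) \<le> K * (1 + r) ^ q * norm (x - x')"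
proof -
  define A where "A = schwartz_seminorm q (Suc l) a"
  have A0: "0 \<le> A" unfolding A_def by (rule schwartz_seminorm_nonneg[OF a])
  have "jap y ^ q * norm (iter_partial js a (x - y) - iter_partial js a (x' - y))
      \<le> (real CARD('n) * 2 ^ q * A) * (1 + r) ^ q * norm (x - x')"
    if l: "length js \<le> l" and x: "norm x \<le> r" and x': "norm x' \<le> r" for js x x' y r
  proof -
    have r: "0 \<le> r" using x norm_ge_zero order_trans by blast
    define B where "B = 2 ^ q * (1 + r) ^ q * A / jap y ^ q"
    have B: "norm (iter_partial (i # js) a (w - y)) \<le> B" if w: "norm w \<le> r" for i w
    proof -
      let ?d = "norm (iter_partial (i # js) a (w - y))"
      have "jap y ^ q = jap (w - (w - y)) ^ q" by simp
      also have "\<dots> \<le> 2 ^ q * jap w ^ q * jap (w - y) ^ q" by (rule jap_diff_power)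
      also have "\<dots> \<le> 2 ^ q * (1 + r) ^ q * jap (w - y) ^ q"
        using jap_le[of w] w by (intro mult_right_mono mult_left_mono power_mono) auto
      finally have "jap y ^ q * ?d \<le> 2 ^ q * (1 + r) ^ q * jap (w - y) ^ q * ?d"
        by (rule mult_right_mono) simp
      also have "\<dots> = 2 ^ q * (1 + r) ^ q * (jap (w - y) ^ q * ?d)" by (simp add: mult_ac)
      also have "\<dots> \<le> 2 ^ q * (1 + r) ^ q * A"
        unfolding A_def using l r by (intro mult_left_mono schwartz_seminorm_ge[OF a]) auto
      finally show ?thesis by (simp add: B_def pos_le_divide_eq mult.commute del: iter_partial.simps)
    qed
    have "norm (iter_partial js a (x - y) - iter_partial js a (x' - y)) \<le> (real CARD('n) * B) * norm (x - x')"
    proof (rule differentiable_bound[of "cball 0 r" "\<lambda>w. iter_partial js a (w - y)"])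
      fix w :: "real ^ 'n" assume w: "w \<in> cball 0 r"
      have "((\<lambda>w. w - y) has_derivative (\<lambda>v. v)) (at w within cball 0 r)"
        by (auto intro!: derivative_eq_intros)
      from has_derivative_compose[OF this smooth_has_derivative[OF schwartz_smooth[OF a]]]
      show "((\<lambda>w. iter_partial js a (w - y)) has_derivative
        (\<lambda>v. \<Sum>i\<in>UNIV. v $ i *\<^sub>R iter_partial (i # js) a (w - y))) (at w within cball 0 r)" .
      show "onorm (\<lambda>v. \<Sum>i\<in>UNIV. v $ i *\<^sub>R iter_partial (i # js) a (w - y)) \<le> real CARD('n) * B"
      proof (rule onorm_le)
        fix v
        have "norm (\<Sum>i\<in>UNIV. v $ i *\<^sub>R iter_partial (i # js) a (w - y)) \<le> (\<Sum>i\<in>(UNIV :: 'n set). norm v * B)"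
        proof (rule sum_norm_le)
          fix i
          show "norm (v $ i *\<^sub>R iter_partial (i # js) a (w - y)) \<le> norm v * B"
            unfolding norm_scaleR using w by (intro mult_mono component_le_norm_cart B) auto
        qed
        then show "norm (\<Sum>i\<in>UNIV. v $ i *\<^sub>R iter_partial (i # js) a (w - y)) \<le> real CARD('n) * B * norm v"
          by (simp add: mult_ac)
      qed
    qed (use x x' in auto)
    from mult_left_mono[OF this, of "jap y ^ q"] show ?thesis by (simp add: B_def mult_ac)
  qed
  moreover have "0 \<le> real CARD('n) * 2 ^ q * A" using A0 by simp
  ultimately show ?thesis by blast
qed

lemma schwartz_seminorm_translate_diff:
  fixes a :: "real ^ 'n::finite \<Rightarrow> complex"
  assumes a: "a \<in> schwartz"
  shows "\<exists>K\<ge>0. \<forall>x x' r. norm x \<le> r \<longrightarrow> norm x' \<le> r \<longrightarrow>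
    schwartz_seminorm q l (\<lambda>y. a (x - y) - a (x' - y)) \<le> K * (1 + r) ^ q * norm (x - x')"
proof -
  obtain K where "0 \<le> K" and K: "\<And>js x x' y r. length js \<le> l \<Longrightarrow> norm x \<le> r \<Longrightarrow> norm x' \<le> r \<Longrightarrow>
    jap y ^ q * norm (iter_partial js a (x - y) - iter_partial js a (x' - y)) \<le> K * (1 + r) ^ q * norm (x - x')"
    using schwartz_translate_lipschitz[OF a, of l q] by blast
  note as = schwartz_smooth[OF a]
  have "schwartz_seminorm q l (\<lambda>y. a (x - y) - a (x' - y)) \<le> K * (1 + r) ^ q * norm (x - x')"
    if "norm x \<le> r" "norm x' \<le> r" for x x' r
  proof (rule schwartz_seminorm_le[OF schwartz_diff[OF schwartz_reflect_translate[OF a] schwartz_reflect_translate[OF a]]])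
    fix js :: "'n list" and y assume "length js \<le> l"
    from K[OF this that, of y]
    show "jap y ^ q * norm (iter_partial js (\<lambda>y. a (x - y) - a (x' - y)) y) \<le> K * (1 + r) ^ q * norm (x - x')"
      by (simp add: iter_partial_diff[OF smooth_reflect[OF as] smooth_reflect[OF as]] iter_partial_reflect[OF as]
          flip: scaleR_diff_right)
  qed
  with \<open>0 \<le> K\<close> show ?thesis by blast
qed

text \<open>T is controlled by one seminorm, and by Peetre's inequality that seminorm of the
  translate of \<open>a\<close> grows only polynomially in x.\<close>

lemma distr_conv_growth:
  assumes T: "T \<in> tempered" and a: "a \<in> schwartz"
  shows "\<exists>q C. \<forall>x. norm (distr_conv T a x) \<le> C * jap x ^ q"
proof -
  obtain q l C where C: "0 \<le> C" and TC: "\<And>f. f \<in> schwartz \<Longrightarrow> norm (T f) \<le> C * schwartz_seminorm q l f"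
    using tempered_bounded[OF T] by blast
  note as = schwartz_smooth[OF a]
  let ?A = "schwartz_seminorm q l a"
  have "norm (distr_conv T a x) \<le> C * (2 ^ q * ?A) * jap x ^ q" for x
  proof -
    have "schwartz_seminorm q l (\<lambda>y. a (x - y)) \<le> 2 ^ q * ?A * jap x ^ q"
    proof (rule schwartz_seminorm_le[OF schwartz_reflect_translate[OF a]])
      fix js :: "'a list" and y assume l: "length js \<le> l"
      have "jap y ^ q = jap (x - (x - y)) ^ q" by simp
      also have "\<dots> \<le> 2 ^ q * jap x ^ q * jap (x - y) ^ q" by (rule jap_diff_power)
      finally have "jap y ^ q * norm (iter_partial js a (x - y)) \<le> 2 ^ q * jap x ^ q * jap (x - y) ^ q * norm (iter_partial js a (x - y))"
        by (rule mult_right_mono) simp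
      also have "\<dots> = 2 ^ q * jap x ^ q * (jap (x - y) ^ q * norm (iter_partial js a (x - y)))" by (simp add: mult_ac)
      also have "\<dots> \<le> 2 ^ q * jap x ^ q * ?A" by (intro mult_left_mono schwartz_seminorm_ge[OF a l]) auto
      finally show "jap y ^ q * norm (iter_partial js (\<lambda>y. a (x - y)) y) \<le> 2 ^ q * ?A * jap x ^ q"
        by (simp add: iter_partial_reflect[OF as] mult_ac)
    qed
    from mult_left_mono[OF this C] TC[OF schwartz_reflect_translate[OF a], of x] show ?thesis
      by (simp add: distr_conv_def mult_ac)
  qed
  then show ?thesis by blast
qed

lemma continuous_on_distr_conv:
  assumes T: "T \<in> tempered" and a: "a \<in> schwartz"
  shows "continuous_on UNIV (distr_conv T a)"
proof -
  obtain q l C where C: "0 \<le> C" and TC: "\<And>f. f \<in> schwartz \<Longrightarrow> norm (T f) \<le> C * schwartz_seminorm q l f"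
    using tempered_bounded[OF T] by blast
  obtain K where K0: "0 \<le> K" and K: "\<And>x x' r. norm x \<le> r \<Longrightarrow> norm x' \<le> r \<Longrightarrow>
    schwartz_seminorm q l (\<lambda>y. a (x - y) - a (x' - y)) \<le> K * (1 + r) ^ q * norm (x - x')"
    using schwartz_seminorm_translate_diff[OF a] by blast
  note at = schwartz_reflect_translate[OF a]
  have bd: "norm (distr_conv T a x' - distr_conv T a x) \<le> C * (K * (2 + norm x) ^ q * norm (x' - x))"
    if "norm (x' - x) < 1" for x x'
  proof -
    have "norm x' \<le> 1 + norm x" using norm_triangle_sub[of x' x] that by linarith
    then have "schwartz_seminorm q l (\<lambda>y. a (x' - y) - a (x - y)) \<le> K * (1 + (1 + norm x)) ^ q * norm (x' - x)"
      by (intro K) auto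
    from mult_left_mono[OF this C] TC[OF schwartz_diff[OF at at], of x' x]
    show ?thesis by (simp add: distr_conv_def tempered_diff[OF T at at])
  qed
  have "isCont (distr_conv T a) x" for x
  proof -
    have lim: "((\<lambda>x'. C * (K * (2 + norm x) ^ q * norm (x' - x))) \<longlongrightarrow> 0) (at x)"
      by (rule tendsto_eq_intros refl | simp)+
    have "\<forall>\<^sub>F x' in at x. norm (x' - x) < 1"
      unfolding eventually_at by (auto simp: dist_norm intro!: exI[of _ 1])
    then have "\<forall>\<^sub>F x' in at x. norm (distr_conv T a x' - distr_conv T a x) \<le> C * (K * (2 + norm x) ^ q * norm (x' - x))"
      by eventually_elim (rule bd)
    from Lim_null_comparison[OF this lim] show ?thesis
      unfolding isCont_def by (rule LIM_zero_cancel)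
  qed
  then show ?thesis by (simp add: continuous_at_imp_continuous_on)
qed

text \<open>The integral collapses to a finite linear combination of values of G, with coefficients
  independent of G. The same coefficients thus appear for the translates of a test function and for
  the values of T on them.\<close>

lemma integral_simple_function_comp:
  fixes G :: "real ^ 'n::finite \<Rightarrow> complex"
  assumes s: "simple_function lborel s" and \<psi>: "integrable lborel \<psi>"
  shows "(LINT x|lborel. G (s x) * \<psi> x)
    = (\<Sum>v\<in>range s. (LINT x|lborel. indicator (s -` {v}) x *\<^sub>R \<psi> x) * G v)"
proof -
  have fin: "finite (range s)" using simple_functionD(1)[OF s] by simp
  have set: "s -` {v} \<in> sets lborel" for v using simple_functionD(2)[OF s, of "{v}"] by simp
  have eq: "G (s x) * \<psi> x = (\<Sum>v\<in>range s. (indicator (s -` {v}) x *\<^sub>R \<psi> x) * G v)" for x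
  proof -
    have "(\<Sum>v\<in>range s. (indicator (s -` {v}) x *\<^sub>R \<psi> x) * G v) = (\<Sum>v\<in>range s. if v = s x then G v * \<psi> x else 0)"
      by (intro sum.cong) (auto simp: indicator_def)
    also have "\<dots> = G (s x) * \<psi> x" using fin by simp
    finally show ?thesis by simp
  qed
  have "integrable lborel (\<lambda>x. indicator (s -` {v}) x *\<^sub>R \<psi> x)" for v
    by (intro integrable_mult_indicator set \<psi>)
  then have "(LINT x|lborel. G (s x) * \<psi> x) = (\<Sum>v\<in>range s. LINT x|lborel. (indicator (s -` {v}) x *\<^sub>R \<psi> x) * G v)"
    unfolding eq by (intro Bochner_Integration.integral_sum integrable_mult_left)
  then show ?thesis by (simp only: integral_mult_left_zero)
qed

lemma integrable_schwartz: "\<psi> \<in> schwartz \<Longrightarrow> integrable lborel \<psi>"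
  using integrable_growth_schwartz[of \<psi> "\<lambda>_. 1" 1 0] by simp

text \<open>The translation variable is approximated pointwise by simple functions, for which the
  linearity of \<open>T\<close> suffices.\<close>

lemma tempered_conv_integral:
  fixes a \<psi> :: "real ^ 'n::finite \<Rightarrow> complex"
  assumes T: "T \<in> tempered" and a: "a \<in> schwartz" and \<psi>: "\<psi> \<in> schwartz"
  shows "(LINT x|lborel. distr_conv T a x * \<psi> x) = T (\<lambda>y. LINT x|lborel. a (x - y) * \<psi> x)"
proof -
  let ?F = "distr_conv T a"
  note at = schwartz_reflect_translate[OF a]
  note [measurable] = borel_measurable_smooth[OF schwartz_smooth[OF \<psi>]]
    borel_measurable_continuous_onI[OF continuous_on_distr_conv[OF T a]]
  \<comment> \<open>Approximation relative to the base point 0 supplies the bound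
    \<open>2 * norm x\<close> required by \<open>schwartz_conv\<close>.\<close>
  obtain s :: "nat \<Rightarrow> real ^ 'n \<Rightarrow> real ^ 'n" where s: "\<And>i. simple_function lborel (s i)"
    and slim: "\<And>x. (\<lambda>i. s i x) \<longlonglongrightarrow> x" and s2: "\<And>i x. norm (s i x) \<le> 2 * norm x"
    using borel_measurable_implies_sequence_metric[of "\<lambda>x. x" lborel 0] by (auto simp: dist_norm)
  have sm [measurable]: "s i \<in> borel_measurable borel" for i
    using borel_measurable_simple_function[OF s[of i]] by simp
  let ?\<Psi> = "\<lambda>s y. LINT x|lborel. a (s x - y) * \<psi> x"
  have \<Psi>s: "?\<Psi> (s i) \<in> schwartz" for i by (rule schwartz_conv[OF a \<psi> sm s2])
  have \<Psi>: "?\<Psi> (\<lambda>x. x) \<in> schwartz" by (rule schwartz_conv[OF a \<psi>]) auto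
  have T_simple: "T (?\<Psi> (s i)) = (LINT x|lborel. ?F (s i x) * \<psi> x)" for i
  proof -
    let ?c = "\<lambda>v. LINT x|lborel. indicator (s i -` {v}) x *\<^sub>R \<psi> x"
    have "?\<Psi> (s i) = (\<lambda>y. \<Sum>v\<in>range (s i). ?c v * a (v - y))"
      by (intro ext integral_simple_function_comp[OF s integrable_schwartz[OF \<psi>]])
    then have "T (?\<Psi> (s i)) = (\<Sum>v\<in>range (s i). ?c v * T (\<lambda>y. a (v - y)))"
      using tempered_sum[OF T, of "range (s i)" "\<lambda>v y. a (v - y)" ?c] simple_functionD(1)[OF s[of i]] at by simp
    also have "\<dots> = (LINT x|lborel. ?F (s i x) * \<psi> x)"
      unfolding integral_simple_function_comp[OF s integrable_schwartz[OF \<psi>], of ?F] by (simp add: distr_conv_def)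
    finally show ?thesis .
  qed
  \<comment> \<open>First of two limits of the same sequence: continuity and polynomial growth of
    \<open>?F\<close> give dominated convergence.\<close>
  have "(\<lambda>i. LINT x|lborel. ?F (s i x) * \<psi> x) \<longlonglongrightarrow> (LINT x|lborel. ?F x * \<psi> x)"
  proof -
    obtain q C where F: "\<And>x. norm (?F x) \<le> C * jap x ^ q" using distr_conv_growth[OF T a] by blast
    have C: "0 \<le> C" by (rule jap_bound_nonneg[OF F])
    show ?thesis
    proof (rule integral_dominated_convergence)
      show "integrable lborel (\<lambda>x. C * 2 ^ q * (jap x ^ q * norm (\<psi> x)))"
        by (intro integrable_mult_right integrable_jap_schwartz \<psi>)
      show "AE x in lborel. (\<lambda>i. ?F (s i x) * \<psi> x) \<longlonglongrightarrow> ?F x * \<psi> x"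
      proof (intro AE_I2 tendsto_mult tendsto_const)
        fix x show "(\<lambda>i. ?F (s i x)) \<longlonglongrightarrow> ?F x"
          using continuous_on_distr_conv[OF T a] slim[of x]
          by (intro isCont_tendsto_compose[of _ ?F]) (auto simp: continuous_on_eq_continuous_at)
      qed
      show "AE x in lborel. norm (?F (s i x) * \<psi> x) \<le> C * 2 ^ q * (jap x ^ q * norm (\<psi> x))" for i
      proof (rule AE_I2)
        fix x
        have "norm (?F (s i x)) \<le> C * jap (s i x) ^ q" by (rule F)
        also have "\<dots> \<le> C * (2 * jap x) ^ q"
          by (intro mult_left_mono power_mono jap_le_of_norm_le_2 s2 C) auto
        finally have "norm (?F (s i x)) * norm (\<psi> x) \<le> C * (2 * jap x) ^ q * norm (\<psi> x)"
          by (rule mult_right_mono) simp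
        then show "norm (?F (s i x) * \<psi> x) \<le> C * 2 ^ q * (jap x ^ q * norm (\<psi> x))"
          by (simp add: norm_mult power_mult_distrib mult_ac)
      qed
    qed measurable
  qed
  moreover have "(\<lambda>i. T (?\<Psi> (s i))) \<longlonglongrightarrow> T (?\<Psi> (\<lambda>x. x))"
  proof -
    obtain q l C where C: "0 \<le> C" and TC: "\<And>f. f \<in> schwartz \<Longrightarrow> norm (T f) \<le> C * schwartz_seminorm q l f"
      using tempered_bounded[OF T] by blast
    obtain K where K0: "0 \<le> K" and K: "\<And>js x x' y r. length js \<le> l \<Longrightarrow> norm x \<le> r \<Longrightarrow> norm x' \<le> r \<Longrightarrow>
      jap y ^ q * norm (iter_partial js a (x - y) - iter_partial js a (x' - y)) \<le> K * (1 + r) ^ q * norm (x - x')"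
      using schwartz_translate_lipschitz[OF a, of l q] by blast
    \<comment> \<open>Up to the factor \<open>K\<close>, this bounds the seminorm of the error: the
      Lipschitz estimate is used with radius r = \<open>2 * norm x\<close>, a ball containing both x
      and \<open>s i x\<close>.\<close>
    define e where "e i = (LINT x|lborel. norm (s i x - x) * ((1 + 2 * norm x) ^ q * norm (\<psi> x)))" for i
    have dom: "norm (norm (s i x - x) * ((1 + 2 * norm x) ^ q * norm (\<psi> x))) \<le> 3 ^ Suc q * (jap x ^ Suc q * norm (\<psi> x))" for i x
    proof -
      have "norm (s i x - x) \<le> 3 * jap x"
        using norm_triangle_ineq4[of "s i x" x] s2[of i x] norm_le_jap[of x] by linarith
      moreover have "(1 + 2 * norm x) ^ q \<le> (3 * jap x) ^ q"
        using norm_le_jap[of x] jap_ge_1[of x] by (intro power_mono) auto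
      ultimately have "norm (s i x - x) * ((1 + 2 * norm x) ^ q * norm (\<psi> x)) \<le> (3 * jap x) * ((3 * jap x) ^ q * norm (\<psi> x))"
        by (intro mult_mono mult_nonneg_nonneg) auto
      then show ?thesis by (simp add: power_mult_distrib mult_ac)
    qed
    have dint: "integrable lborel (\<lambda>x. 3 ^ Suc q * (jap x ^ Suc q * norm (\<psi> x)))"
      by (intro integrable_mult_right integrable_jap_schwartz \<psi>)
    have eint: "integrable lborel (\<lambda>x. norm (s i x - x) * ((1 + 2 * norm x) ^ q * norm (\<psi> x)))" for i
      by (rule Bochner_Integration.integrable_bound[OF dint]) (use dom in \<open>auto intro!: AE_I2 order_trans[OF dom] simp del: power_Suc\<close>)
    have elim: "e \<longlonglongrightarrow> 0"
    proof -
      have "(\<lambda>i. LINT x|lborel. norm (s i x - x) * ((1 + 2 * norm x) ^ q * norm (\<psi> x))) \<longlonglongrightarrow> (LINT x|(lborel :: (real ^ 'n) measure). 0)"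
      proof (rule integral_dominated_convergence[OF _ _ dint])
        show "AE x in lborel. (\<lambda>i. norm (s i x - x) * ((1 + 2 * norm x) ^ q * norm (\<psi> x))) \<longlonglongrightarrow> 0"
        proof (intro AE_I2 tendsto_mult_left_zero tendsto_norm_zero)
          show "(\<lambda>i. s i x - x) \<longlonglongrightarrow> 0" for x using slim[of x] by (simp add: LIM_zero)
        qed
        show "AE x in lborel. norm (norm (s i x - x) * ((1 + 2 * norm x) ^ q * norm (\<psi> x))) \<le> 3 ^ Suc q * (jap x ^ Suc q * norm (\<psi> x))" for i
          by (rule AE_I2) (rule dom)
      qed measurable
      then show ?thesis by (simp add: e_def[abs_def])
    qed
    have bound: "norm (T (?\<Psi> (s i)) - T (?\<Psi> (\<lambda>x. x))) \<le> C * (K * e i)" for i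
    proof -
      have "schwartz_seminorm q l (\<lambda>y. ?\<Psi> (s i) y - ?\<Psi> (\<lambda>x. x) y) \<le> K * e i"
      proof (rule schwartz_seminorm_le[OF schwartz_diff[OF \<Psi>s \<Psi>]])
        fix js :: "'n list" and y assume l: "length js \<le> l"
        have i1: "integrable lborel (\<lambda>x. iter_partial js a (s i x - y) * \<psi> x)"
          by (rule integrable_schwartz_conv[OF a \<psi> sm s2])
        have i2: "integrable lborel (\<lambda>x. iter_partial js a (x - y) * \<psi> x)"
          by (rule integrable_schwartz_conv[OF a \<psi>, of "\<lambda>x. x"]) auto
        have d2: "iter_partial js (?\<Psi> (\<lambda>x. x)) = (\<lambda>y. (-1) ^ length js *\<^sub>R (LINT x|lborel. iter_partial js a (x - y) * \<psi> x))"
          by (rule iter_partial_schwartz_conv[OF a \<psi>, of "\<lambda>x. x"]) auto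
        have "jap y ^ q * norm (iter_partial js (\<lambda>y. ?\<Psi> (s i) y - ?\<Psi> (\<lambda>x. x) y) y)
          = jap y ^ q * norm (LINT x|lborel. iter_partial js a (s i x - y) * \<psi> x - iter_partial js a (x - y) * \<psi> x)"
          unfolding iter_partial_diff[OF schwartz_smooth[OF \<Psi>s] schwartz_smooth[OF \<Psi>]]
            iter_partial_schwartz_conv[OF a \<psi> sm s2] d2
          using i1 i2 by (simp flip: scaleR_diff_right)
        also have "\<dots> = norm (LINT x|lborel. of_real (jap y ^ q) * (iter_partial js a (s i x - y) * \<psi> x - iter_partial js a (x - y) * \<psi> x))"
          by (simp add: norm_mult norm_power)
        also have "\<dots> \<le> (LINT x|lborel. K * (norm (s i x - x) * ((1 + 2 * norm x) ^ q * norm (\<psi> x))))"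
        proof (rule Bochner_Integration.integral_norm_bound_integral)
          show "integrable lborel (\<lambda>x. of_real (jap y ^ q) * (iter_partial js a (s i x - y) * \<psi> x - iter_partial js a (x - y) * \<psi> x))"
            by (intro integrable_mult_right Bochner_Integration.integrable_diff i1 i2)
          show "integrable lborel (\<lambda>x. K * (norm (s i x - x) * ((1 + 2 * norm x) ^ q * norm (\<psi> x))))"
            by (intro integrable_mult_right eint)
          fix x
          have "jap y ^ q * norm (iter_partial js a (s i x - y) - iter_partial js a (x - y)) \<le> K * (1 + 2 * norm x) ^ q * norm (s i x - x)"
            using s2[of i x] by (intro K l) auto
          note mult_right_mono[OF this, of "norm (\<psi> x)"]
          moreover have "norm (of_real (jap y ^ q) * (iter_partial js a (s i x - y) * \<psi> x - iter_partial js a (x - y) * \<psi> x))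
            = jap y ^ q * norm (iter_partial js a (s i x - y) - iter_partial js a (x - y)) * norm (\<psi> x)"
            by (simp add: norm_mult norm_power flip: left_diff_distrib)
          ultimately show "norm (of_real (jap y ^ q) * (iter_partial js a (s i x - y) * \<psi> x - iter_partial js a (x - y) * \<psi> x))
            \<le> K * (norm (s i x - x) * ((1 + 2 * norm x) ^ q * norm (\<psi> x)))"
            by (simp add: mult_ac)
        qed
        also have "\<dots> = K * e i" by (simp add: e_def)
        finally show "jap y ^ q * norm (iter_partial js (\<lambda>y. ?\<Psi> (s i) y - ?\<Psi> (\<lambda>x. x) y) y) \<le> K * e i" .
      qed
      from mult_left_mono[OF this C] TC[OF schwartz_diff[OF \<Psi>s \<Psi>], of i]
      show ?thesis by (simp add: tempered_diff[OF T \<Psi>s \<Psi>])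
    qed
    have lim: "(\<lambda>i. C * (K * e i)) \<longlonglongrightarrow> 0"
      by (intro tendsto_mult_right_zero elim)
    have "\<forall>\<^sub>F i in sequentially. norm (T (?\<Psi> (s i)) - T (?\<Psi> (\<lambda>x. x))) \<le> C * (K * e i)"
      using bound by (rule always_eventually[OF allI])
    from Lim_null_comparison[OF this lim]
    show ?thesis by (rule LIM_zero_cancel)
  qed
  ultimately show ?thesis unfolding T_simple by (rule LIMSEQ_unique)
qed

section \<open>Rescaled mollifiers\<close>

lemma schwartz_rescale:
  assumes "\<rho> \<in> schwartz" "\<epsilon> \<noteq> 0"
  shows "rescale \<rho> \<epsilon> \<in> schwartz"
  using schwartz_cmult[OF schwartz_affine[OF assms(1), of "inverse \<epsilon>" 0]] assms(2)
  by (simp add: rescale_def divide_inverse)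

lemma
  fixes \<rho> f :: "real ^ 'n::finite \<Rightarrow> complex"
  assumes \<rho>: "\<rho> \<in> schwartz" and [measurable]: "f \<in> borel_measurable borel" and \<epsilon>: "0 < \<epsilon>"
  shows integral_rescale_left: "(LINT y|lborel. f y * rescale \<rho> \<epsilon> (x - y)) = (LINT z|lborel. f (x - \<epsilon> *\<^sub>R z) * \<rho> z)"
    and integral_rescale_right: "(LINT y|lborel. rescale \<rho> \<epsilon> (y - x) * f y) = (LINT z|lborel. f (x + \<epsilon> *\<^sub>R z) * \<rho> z)"
proof -
  have [measurable]: "rescale \<rho> \<epsilon> \<in> borel_measurable borel"
    using \<epsilon> by (intro borel_measurable_smooth schwartz_smooth schwartz_rescale \<rho>) auto
  have r: "\<epsilon> ^ CARD('n) *\<^sub>R (h * rescale \<rho> \<epsilon> (\<epsilon> *\<^sub>R z)) = h * \<rho> z" for h and z :: "real ^ 'n"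
  proof -
    let ?c = "complex_of_real (\<epsilon> powi (- int CARD('n)))"
    have "complex_of_real (\<epsilon> ^ CARD('n)) * ?c = 1"
      using \<epsilon> by (simp add: power_int_minus flip: of_real_mult)
    moreover have "\<epsilon> ^ CARD('n) *\<^sub>R (h * rescale \<rho> \<epsilon> (\<epsilon> *\<^sub>R z)) = (complex_of_real (\<epsilon> ^ CARD('n)) * ?c) * (h * \<rho> z)"
      using \<epsilon> unfolding scaleR_conv_of_real[of _ "_ :: complex"] by (simp add: rescale_def)
    ultimately show ?thesis by simp
  qed
  have "(LINT y|lborel. f y * rescale \<rho> \<epsilon> (x - y))
    = \<bar>- \<epsilon>\<bar> ^ CARD('n) *\<^sub>R (LINT z|lborel. f (x + (- \<epsilon>) *\<^sub>R z) * rescale \<rho> \<epsilon> (x - (x + (- \<epsilon>) *\<^sub>R z)))"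
    by (rule integral_affine) (use \<epsilon> in auto)
  also have "\<dots> = (LINT z|lborel. f (x - \<epsilon> *\<^sub>R z) * \<rho> z)"
    using \<epsilon> by (simp add: r flip: integral_scaleR_right)
  finally show "(LINT y|lborel. f y * rescale \<rho> \<epsilon> (x - y)) = (LINT z|lborel. f (x - \<epsilon> *\<^sub>R z) * \<rho> z)" .
  have "(LINT y|lborel. rescale \<rho> \<epsilon> (y - x) * f y)
    = \<bar>\<epsilon>\<bar> ^ CARD('n) *\<^sub>R (LINT z|lborel. rescale \<rho> \<epsilon> (x + \<epsilon> *\<^sub>R z - x) * f (x + \<epsilon> *\<^sub>R z))"
    by (rule integral_affine) (use \<epsilon> in auto)
  also have "\<dots> = (LINT z|lborel. f (x + \<epsilon> *\<^sub>R z) * \<rho> z)"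
    using \<epsilon> by (simp add: r mult.commute[of "rescale \<rho> \<epsilon> _"] flip: integral_scaleR_right)
  finally show "(LINT y|lborel. rescale \<rho> \<epsilon> (y - x) * f y) = (LINT z|lborel. f (x + \<epsilon> *\<^sub>R z) * \<rho> z)" .
qed

text \<open>Both sides equal T applied to one function, the reflected and translated convolution of
  the two rescaled mollifiers, which is symmetric in \<epsilon> and \<delta>.\<close>

lemma distr_conv_rescale_commute:
  fixes \<rho> :: "real ^ 'n::finite \<Rightarrow> complex"
  assumes T: "T \<in> tempered" and \<rho>: "\<rho> \<in> schwartz" and \<epsilon>: "0 < \<epsilon>" and \<delta>: "0 < \<delta>"
  shows "(LINT z|lborel. distr_conv T (rescale \<rho> \<epsilon>) (x - \<delta> *\<^sub>R z) * \<rho> z)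
    = (LINT z|lborel. distr_conv T (rescale \<rho> \<delta>) (x - \<epsilon> *\<^sub>R z) * \<rho> z)"
proof -
  have conv: "(LINT z|lborel. distr_conv T (rescale \<rho> \<epsilon>) (x - \<delta> *\<^sub>R z) * \<rho> z)
     = T (\<lambda>t. LINT y|lborel. rescale \<rho> \<epsilon> (y - t) * rescale \<rho> \<delta> (x - y))"
    if \<epsilon>: "0 < \<epsilon>" and \<delta>: "0 < \<delta>" for \<epsilon> \<delta>
  proof -
    have s: "rescale \<rho> \<epsilon> \<in> schwartz" "rescale \<rho> \<delta> \<in> schwartz" using \<epsilon> \<delta> \<rho> by (auto intro: schwartz_rescale)
    have "(LINT z|lborel. distr_conv T (rescale \<rho> \<epsilon>) (x - \<delta> *\<^sub>R z) * \<rho> z)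
      = (LINT y|lborel. distr_conv T (rescale \<rho> \<epsilon>) y * rescale \<rho> \<delta> (x - y))"
      by (rule integral_rescale_left[OF \<rho> borel_measurable_continuous_onI[OF continuous_on_distr_conv[OF T s(1)]] \<delta>, symmetric])
    also have "\<dots> = T (\<lambda>t. LINT y|lborel. rescale \<rho> \<epsilon> (y - t) * rescale \<rho> \<delta> (x - y))"
      by (rule tempered_conv_integral[OF T s(1) schwartz_reflect_translate[OF s(2)]])
    finally show ?thesis .
  qed
  have [measurable]: "rescale \<rho> \<epsilon> \<in> borel_measurable borel" "rescale \<rho> \<delta> \<in> borel_measurable borel"
    using \<epsilon> \<delta> by (auto intro!: borel_measurable_smooth schwartz_smooth schwartz_rescale \<rho>)
  \<comment> \<open>The substitution of x + t - y for y exchanges the arguments y - t and x -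
    y.\<close>
  have "(LINT y|lborel. rescale \<rho> \<epsilon> (y - t) * rescale \<rho> \<delta> (x - y))
      = (LINT y|lborel. rescale \<rho> \<delta> (y - t) * rescale \<rho> \<epsilon> (x - y))" for t
    using integral_affine[of "\<lambda>y. rescale \<rho> \<epsilon> (y - t) * rescale \<rho> \<delta> (x - y)" "-1" "x + t"]
    by (simp add: mult.commute)
  with conv[OF \<epsilon> \<delta>] conv[OF \<delta> \<epsilon>] show ?thesis by simp
qed

section \<open>Taylor expansion against a mollifier\<close>

lemma sum_lists_length_Suc:
  fixes F :: "'n::finite list \<Rightarrow> 'a::comm_monoid_add"
  shows "(\<Sum>ks | length ks = Suc k. F ks) = (\<Sum>ks | length ks = k. \<Sum>i\<in>UNIV. F (i # ks))"
proof -
  have "{ks :: 'n list. length ks = Suc k} = (\<lambda>(ks, i). i # ks) ` ({ks. length ks = k} \<times> UNIV)"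
    by (auto simp: length_Suc_conv)
  then have "(\<Sum>ks | length ks = Suc k. F ks) = (\<Sum>(ks, i)\<in>{ks. length ks = k} \<times> UNIV. F (i # ks))"
    by (simp add: sum.reindex inj_on_def case_prod_unfold)
  then show ?thesis by (simp add: sum.cartesian_product)
qed

lemma norm_prod_list_components_le:
  fixes v :: "real ^ 'n::finite"
  shows "norm (prod_list (map (($) v) ks)) \<le> norm v ^ length ks"
  by (induction ks) (auto simp: abs_mult intro!: mult_mono component_le_norm_cart)

lemma card_lists_length: "card {ks :: 'n::finite list. length ks = k} = CARD('n) ^ k"
  using card_lists_length_eq[of "UNIV :: 'n set" k] by simp

text \<open>Taylor's formula on the segment from x to x + v with integral remainder. Summing over
  lists instead of multi-indices counts each \<alpha> of size k exactly k!/\<alpha>! times, so the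
  coefficient 1/k! replaces 1/\<alpha>!.\<close>

lemma smooth_taylor:
  fixes h :: "real ^ 'n::finite \<Rightarrow> complex"
  assumes h: "smooth h" and N: "0 < N"
    and bd: "\<And>ks t. length ks = N \<Longrightarrow> 0 \<le> t \<Longrightarrow> t \<le> 1 \<Longrightarrow> norm (iter_partial ks h (x + t *\<^sub>R v)) \<le> B"
  shows "norm (h (x + v) - (\<Sum>k<N. (1 / fact k) *\<^sub>R
      (\<Sum>ks | length ks = k. prod_list (map (($) v) ks) *\<^sub>R iter_partial ks h x)))
    \<le> real CARD('n) ^ N * norm v ^ N * B"
proof -
  define Df where "Df k t = (\<Sum>ks | length ks = k. prod_list (map (($) v) ks) *\<^sub>R iter_partial ks h (x + t *\<^sub>R v))" for k t
  have deriv: "(Df k has_vector_derivative Df (Suc k) t) (at t within {0..1})" for k t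
  proof -
    have "((\<lambda>t. iter_partial ks h (x + t *\<^sub>R v)) has_vector_derivative
       (\<Sum>i\<in>UNIV. v $ i *\<^sub>R iter_partial (i # ks) h (x + t *\<^sub>R v))) (at t within {0..1})" for ks
    proof -
      have "((\<lambda>t. x + t *\<^sub>R v) has_derivative (\<lambda>u. u *\<^sub>R v)) (at t within {0..1})"
        by (auto intro!: derivative_eq_intros)
      from has_derivative_compose[OF this smooth_has_derivative[OF h, of ks]]
      show ?thesis unfolding has_vector_derivative_def
        by (simp add: scaleR_sum_right del: iter_partial.simps)
    qed
    then have "(Df k has_vector_derivative (\<Sum>ks | length ks = k. prod_list (map (($) v) ks) *\<^sub>R
       (\<Sum>i\<in>UNIV. v $ i *\<^sub>R iter_partial (i # ks) h (x + t *\<^sub>R v)))) (at t within {0..1})"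
      unfolding Df_def by (intro has_vector_derivative_sum bounded_linear.has_vector_derivative[OF bounded_linear_scaleR_right])
    then show ?thesis
      by (simp add: Df_def sum_lists_length_Suc scaleR_sum_right mult.commute del: iter_partial.simps)
  qed
  define I where "I t = ((1 - t) ^ (N - 1) / fact (N - 1)) *\<^sub>R Df N t" for t
  have "(I has_integral Df 0 1 - (\<Sum>k<N. ((1 - 0) ^ k / fact k) *\<^sub>R Df k 0)) {0..1}"
    unfolding I_def by (rule Taylor_has_integral[of N Df "Df 0" 0 1]) (use N deriv in auto)
  moreover have B: "norm (I t) \<le> real CARD('n) ^ N * norm v ^ N * B" if t: "0 \<le> t" "t \<le> 1" for t
  proof -
    \<comment> \<open>Any list of length N will do as a witness; \<open>replicate\<close> merely
      provides one.\<close>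
    have B0: "0 \<le> B"
      using order_trans[OF norm_ge_zero bd[of "replicate N undefined" 0]] by simp
    have "norm (Df N t) \<le> (\<Sum>ks\<in>{ks :: 'n list. length ks = N}. norm v ^ N * B)"
      unfolding Df_def
    proof (rule sum_norm_le)
      fix ks :: "'n list" assume "ks \<in> {ks. length ks = N}"
      then have len: "length ks = N" by simp
      show "norm (prod_list (map (($) v) ks) *\<^sub>R iter_partial ks h (x + t *\<^sub>R v)) \<le> norm v ^ N * B"
        unfolding norm_scaleR using norm_prod_list_components_le[of v ks] len
        by (intro mult_mono bd[OF len t]) auto
    qed
    then have Df: "norm (Df N t) \<le> real CARD('n) ^ N * norm v ^ N * B"
      by (simp add: card_lists_length mult_ac)
    \<comment> \<open>The remainder kernel is bounded crudely by 1; the factor 1/N! that exact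
      integration would give is given away.\<close>
    have "(1 - t) ^ (N - 1) \<le> 1" using t by (intro power_le_one) auto
    moreover have "(1::real) \<le> fact (N - 1)" by (rule fact_ge_1)
    ultimately have "(1 - t) ^ (N - 1) \<le> fact (N - 1)" by (rule order_trans)
    then have "(1 - t) ^ (N - 1) / fact (N - 1) \<le> 1"
      by (simp add: pos_divide_le_eq del: One_nat_def)
    then have "\<bar>(1 - t) ^ (N - 1) / fact (N - 1)\<bar> * norm (Df N t) \<le> 1 * (real CARD('n) ^ N * norm v ^ N * B)"
      using t by (intro mult_mono Df) auto
    then show ?thesis by (simp add: I_def)
  qed
  moreover have "0 \<le> real CARD('n) ^ N * norm v ^ N * B"
    using B[of 0] norm_ge_zero[of "I 0"] by linarith
  ultimately have "norm (Df 0 1 - (\<Sum>k<N. ((1 - 0) ^ k / fact k) *\<^sub>R Df k 0)) \<le> (real CARD('n) ^ N * norm v ^ N * B) * measure lborel (cbox 0 (1::real))"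
    by (intro has_integral_bound[where f = I]) auto
  then show ?thesis by (simp add: Df_def)
qed

lemma mi_power_count_list: "mi_power z (count_list ks) = prod_list (map (($) z) ks)"
proof (induction ks)
  case (Cons k ks)
  have "mi_power z (count_list (k # ks)) = (\<Prod>i\<in>UNIV. (z $ i) ^ count_list ks i * (if k = i then z $ i else 1))"
    unfolding mi_power_def by (intro prod.cong) auto
  also have "\<dots> = mi_power z (count_list ks) * z $ k"
    by (simp add: prod.distrib mi_power_def)
  finally show ?case by (simp add: Cons mult.commute del: count_list.simps)
qed (simp add: mi_power_def)

lemma mollifier_moment:
  assumes "mollifier \<rho>"
  shows "(LINT z|lborel. of_real (prod_list (map (($) z) ks)) * \<rho> z) = (if ks = [] then 1 else 0)"
proof (cases ks)
  case (Cons k ks')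
  then have "count_list ks k \<noteq> 0" "ks \<noteq> []" by simp_all
  moreover from this(1) have "count_list ks \<noteq> (\<lambda>_. 0)" by metis
  ultimately show ?thesis using assms by (simp add: mollifier_def mi_power_count_list[symmetric])
qed (use assms in \<open>simp add: mollifier_def\<close>)

lemma mollifier_schwartz: "mollifier \<rho> \<Longrightarrow> \<rho> \<in> schwartz"
  by (simp add: mollifier_def)

text \<open>The vanishing moments remove the Taylor polynomial except its constant term, which
  leaves the remainder of order N in \<delta>. The weight \<open>w\<close> is abstract because it is
  used both as a growing power of \<open>jap\<close>, for nets, and as a decaying one, for test
  functions; the condition on \<open>w\<close> is a Peetre inequality. \<open>growth\<close> secures
  integrability and does not enter the constant.\<close>

lemma mollifier_approx:
  fixes \<rho> h :: "real ^ 'n::finite \<Rightarrow> complex"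
  assumes \<rho>: "mollifier \<rho>" and h: "smooth h" and growth: "\<And>y. norm (h y) \<le> C0 * jap y ^ q0" and N: "0 < N"
    and bd: "\<And>ks y. length ks = N \<Longrightarrow> norm (iter_partial ks h y) \<le> C * w y"
    and w: "\<And>x z. w (x + z) \<le> K * w x * jap z ^ p" and w0: "0 \<le> K" "\<And>x. 0 \<le> w x" and C: "0 \<le> C" and \<delta>: "\<bar>\<delta>\<bar> \<le> 1"
  shows "norm ((LINT z|lborel. h (x - \<delta> *\<^sub>R z) * \<rho> z) - h x)
    \<le> real CARD('n) ^ N * C * K * \<bar>\<delta>\<bar> ^ N * w x * (LINT z|lborel. jap z ^ (N + p) * norm (\<rho> z))"
proof -
  note \<rho>s = mollifier_schwartz[OF \<rho>]
  note [measurable] = borel_measurable_smooth[OF h]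
  define P where "P z = (\<Sum>k<N. (1 / fact k) *\<^sub>R
      (\<Sum>ks | length ks = k. prod_list (map (($) (- (\<delta> *\<^sub>R z))) ks) *\<^sub>R iter_partial ks h x))" for z
  define c where "c ks = ((- \<delta>) ^ length ks / fact (length ks)) *\<^sub>R iter_partial ks h x" for ks
  have prod: "prod_list (map (($) (- (\<delta> *\<^sub>R z))) ks) = (- \<delta>) ^ length ks * prod_list (map (($) z) ks)" for z ks
    by (induction ks) auto
  have P: "P z * \<rho> z = (\<Sum>k<N. \<Sum>ks | length ks = k. c ks * (of_real (prod_list (map (($) z) ks)) * \<rho> z))" for z
    unfolding P_def c_def prod scaleR_sum_right sum_distrib_right
    by (intro sum.cong refl) (simp add: scaleR_conv_of_real mult_ac)
  have mint: "integrable lborel (\<lambda>z. of_real (prod_list (map (($) z) ks)) * \<rho> z)" for ks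
  proof (rule integrable_growth_schwartz[OF \<rho>s])
    show "(\<lambda>z. complex_of_real (prod_list (map (($) z) ks))) \<in> borel_measurable borel"
      by (intro borel_measurable_continuous_onI continuous_intros) (induction ks; auto intro!: continuous_intros)
    show "norm (complex_of_real (prod_list (map (($) z) ks))) \<le> 1 * jap z ^ length ks" for z
      using order_trans[OF norm_prod_list_components_le power_mono[OF norm_le_jap]] by simp
  qed
  have Pint: "integrable lborel (\<lambda>z. P z * \<rho> z)"
    unfolding P by (intro Bochner_Integration.integrable_sum integrable_mult_right mint)
  \<comment> \<open>Only the empty list has a nonzero moment, and its coefficient is
    \<open>h x\<close>.\<close>
  have "(LINT z|lborel. P z * \<rho> z) = (\<Sum>k<N. \<Sum>ks | length ks = k. c ks * (if ks = [] then 1 else 0))"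
    unfolding P by (simp add: Bochner_Integration.integral_sum mint mollifier_moment[OF \<rho>])
  also have "\<dots> = (\<Sum>k<N. if k = 0 then h x else 0)"
  proof (intro sum.cong refl)
    fix k
    show "(\<Sum>ks | length ks = k. c ks * (if ks = [] then 1 else 0)) = (if k = 0 then h x else 0)"
      by (cases "k = 0") (auto simp: c_def intro!: sum.neutral)
  qed
  also have "\<dots> = h x" using N by (simp add: sum.delta)
  finally have Peq: "(LINT z|lborel. P z * \<rho> z) = h x" .
  have hint: "integrable lborel (\<lambda>z. h (x - \<delta> *\<^sub>R z) * \<rho> z)"
  proof (rule integrable_growth_schwartz[OF \<rho>s])
    have C0: "0 \<le> C0" by (rule jap_bound_nonneg[OF growth])
    show "norm (h (x - \<delta> *\<^sub>R z)) \<le> (C0 * 2 ^ q0 * jap x ^ q0) * jap z ^ q0" for z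
    proof -
      have "norm (h (x - \<delta> *\<^sub>R z)) \<le> C0 * jap (x - \<delta> *\<^sub>R z) ^ q0" by (rule growth)
      also have "\<dots> \<le> C0 * (2 ^ q0 * jap x ^ q0 * jap (\<delta> *\<^sub>R z) ^ q0)"
        by (intro mult_left_mono jap_diff_power C0)
      also have "\<dots> \<le> C0 * (2 ^ q0 * jap x ^ q0 * jap z ^ q0)"
        using C0 by (intro mult_left_mono power_mono jap_scaleR \<delta>) auto
      finally show ?thesis by (simp add: mult_ac)
    qed
  qed measurable
  have "norm ((LINT z|lborel. h (x - \<delta> *\<^sub>R z) * \<rho> z) - h x) = norm (LINT z|lborel. (h (x - \<delta> *\<^sub>R z) - P z) * \<rho> z)"
    using hint Pint Peq by (simp add: left_diff_distrib)
  also have "\<dots> \<le> (real CARD('n) ^ N * C * K * \<bar>\<delta>\<bar> ^ N * w x) * (LINT z|lborel. jap z ^ (N + p) * norm (\<rho> z))"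
  proof (rule integral_norm_bound_jap[OF \<rho>s])
    fix z
    have "norm (h (x + - (\<delta> *\<^sub>R z)) - P z) \<le> real CARD('n) ^ N * norm (- (\<delta> *\<^sub>R z)) ^ N * (C * (K * w x * jap z ^ p))"
      unfolding P_def
    proof (rule smooth_taylor[OF h N])
      fix ks :: "'n list" and t :: real assume "length ks = N" and t: "0 \<le> t" "t \<le> 1"
      then have "norm (iter_partial ks h (x + t *\<^sub>R - (\<delta> *\<^sub>R z))) \<le> C * w (x + t *\<^sub>R - (\<delta> *\<^sub>R z))" by (intro bd)
      also have "\<dots> \<le> C * (K * w x * jap (t *\<^sub>R - (\<delta> *\<^sub>R z)) ^ p)"
        by (intro mult_left_mono w C)
      also have "\<dots> \<le> C * (K * w x * jap z ^ p)"
      proof -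
        \<comment> \<open>Intermediate points differ from x by a multiple of z with factor at most 1
          in modulus, so the weight at z bounds all of them.\<close>
        have "\<bar>- t * \<delta>\<bar> \<le> 1" using t \<delta> by (simp add: abs_mult mult_le_one)
        then have "jap (t *\<^sub>R - (\<delta> *\<^sub>R z)) \<le> jap z" using jap_scaleR[of "- t * \<delta>" z] by simp
        then show ?thesis using C w0 by (intro mult_left_mono power_mono) auto
      qed
      finally show "norm (iter_partial ks h (x + t *\<^sub>R - (\<delta> *\<^sub>R z))) \<le> C * (K * w x * jap z ^ p)" .
    qed
    also have "\<dots> = (real CARD('n) ^ N * C * K * \<bar>\<delta>\<bar> ^ N * w x) * jap z ^ p * norm z ^ N"
      by (simp add: power_mult_distrib mult_ac)
    also have "\<dots> \<le> (real CARD('n) ^ N * C * K * \<bar>\<delta>\<bar> ^ N * w x) * jap z ^ p * jap z ^ N"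
      using C w0 by (intro mult_left_mono power_mono norm_le_jap mult_nonneg_nonneg) auto
    finally have "norm (h (x - \<delta> *\<^sub>R z) - P z) \<le> (real CARD('n) ^ N * C * K * \<bar>\<delta>\<bar> ^ N * w x) * jap z ^ (N + p)"
      by (simp add: power_add mult_ac)
    then show "norm ((h (x - \<delta> *\<^sub>R z) - P z) * \<rho> z) \<le> (real CARD('n) ^ N * C * K * \<bar>\<delta>\<bar> ^ N * w x) * jap z ^ (N + p) * norm (\<rho> z)"
      unfolding norm_mult by (rule mult_right_mono) simp
  qed
  finally show ?thesis .
qed

lemma schwartz_subset_O_M: "f \<in> schwartz \<Longrightarrow> f \<in> O_M"
  unfolding O_M_iff
proof (intro conjI allI schwartz_smooth)
  fix js assume "f \<in> schwartz"
  then obtain C where "\<And>x. jap x ^ 0 * norm (iter_partial js f x) \<le> C" using schwartzD by blast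
  then show "\<exists>q C. \<forall>x. norm (iter_partial js f x) \<le> C * jap x ^ q"
    by (intro exI[of _ 0] exI[of _ C]) simp
qed

text \<open>The mollification is moved from T to \<psi>. The reflected mollification of \<psi>
  converges to \<psi> in every Schwartz seminorm at rate \<epsilon>, already by first-order Taylor
  expansion, and T is bounded by one of these seminorms.\<close>

lemma distr_conv_rescale_tendsto:
  fixes \<rho> \<psi> :: "real ^ 'n::finite \<Rightarrow> complex"
  assumes \<rho>: "mollifier \<rho>" and T: "T \<in> tempered" and \<psi>: "\<psi> \<in> schwartz"
  shows "((\<lambda>\<epsilon>. LINT x|lborel. distr_conv T (rescale \<rho> \<epsilon>) x * \<psi> x) \<longlongrightarrow> T \<psi>) (at_right 0)"
proof -
  note \<rho>s = mollifier_schwartz[OF \<rho>]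
  note \<psi>s = schwartz_smooth[OF \<psi>]
  obtain q l C where C: "0 \<le> C" and TC: "\<And>f. f \<in> schwartz \<Longrightarrow> norm (T f) \<le> C * schwartz_seminorm q l f"
    using tempered_bounded[OF T] by blast
  define K where "K = real CARD('n) ^ 1 * schwartz_seminorm q (Suc l) \<psi> * 2 ^ q * (LINT z|lborel. jap z ^ (1 + q) * norm (\<rho> z))"
  have bound: "norm ((LINT x|lborel. distr_conv T (rescale \<rho> \<epsilon>) x * \<psi> x) - T \<psi>) \<le> C * (K * \<epsilon>)"
    if \<epsilon>: "0 < \<epsilon>" "\<epsilon> \<le> 1" for \<epsilon>
  proof -
    have r: "rescale \<rho> \<epsilon> \<in> schwartz" using \<epsilon> by (intro schwartz_rescale \<rho>s) auto
    let ?\<Psi> = "\<lambda>y. LINT x|lborel. rescale \<rho> \<epsilon> (x - y) * \<psi> x"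
    have \<Psi>: "?\<Psi> \<in> schwartz" by (rule schwartz_conv[OF r \<psi>, of "\<lambda>x. x"]) auto
    \<comment> \<open>The reflection turns up as the negative parameter \<delta> =
      -\<epsilon>.\<close>
    have \<Psi>eq: "?\<Psi> = (\<lambda>y. LINT z|lborel. \<psi> (y - (- \<epsilon>) *\<^sub>R z) * \<rho> z)"
      by (simp add: integral_rescale_right[OF \<rho>s borel_measurable_smooth[OF \<psi>s] \<epsilon>(1)])
    have "schwartz_seminorm q l (\<lambda>y. ?\<Psi> y - \<psi> y) \<le> K * \<epsilon>"
    proof (rule schwartz_seminorm_le[OF schwartz_diff[OF \<Psi> \<psi>]])
      fix js :: "'n list" and y assume l: "length js \<le> l"
      have d: "iter_partial js ?\<Psi> = (\<lambda>y. LINT z|lborel. iter_partial js \<psi> (y - (- \<epsilon>) *\<^sub>R z) * \<rho> z)"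
        unfolding \<Psi>eq using \<epsilon> by (intro iter_partial_O_M_conv schwartz_subset_O_M \<psi> \<rho>s) auto
      have "norm ((LINT z|lborel. iter_partial js \<psi> (y - (- \<epsilon>) *\<^sub>R z) * \<rho> z) - iter_partial js \<psi> y)
        \<le> real CARD('n) ^ 1 * schwartz_seminorm q (Suc l) \<psi> * 2 ^ q * \<bar>- \<epsilon>\<bar> ^ 1 * inverse (jap y ^ q) * (LINT z|lborel. jap z ^ (1 + q) * norm (\<rho> z))"
      \<comment> \<open>Applied with N = 1 and the decaying weight 1/jap^q, whose Peetre inequality
        is that of jap^q read backwards.\<close>
      proof (rule mollifier_approx[OF \<rho>])
        show "smooth (iter_partial js \<psi>)"
          using \<psi>s unfolding smooth_def by (metis iter_partial_append)
        show "norm (iter_partial js \<psi> y) \<le> schwartz_seminorm 0 (length js) \<psi> * jap y ^ 0" for y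
          using schwartz_seminorm_ge[OF \<psi>, of js "length js" y 0] by simp
        show "norm (iter_partial ks (iter_partial js \<psi>) y) \<le> schwartz_seminorm q (Suc l) \<psi> * inverse (jap y ^ q)"
          if "length ks = 1" for ks y
          using schwartz_seminorm_ge[OF \<psi>, of "ks @ js" "Suc l" y q] that l
          by (simp add: iter_partial_append divide_inverse[symmetric] pos_le_divide_eq mult.commute)
        show "inverse (jap (x + z) ^ q) \<le> 2 ^ q * inverse (jap x ^ q) * jap z ^ q" for x z :: "real ^ 'n"
        proof -
          have "jap x ^ q \<le> 2 ^ q * jap (x + z) ^ q * jap z ^ q"
            using jap_diff_power[of "x + z" z q] by simp
          then show ?thesis by (simp add: field_simps)
        qed
      qed (use \<epsilon> in \<open>auto intro: schwartz_seminorm_nonneg[OF \<psi>]\<close>)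
      then have "jap y ^ q * norm (iter_partial js (\<lambda>y. ?\<Psi> y - \<psi> y) y) \<le> jap y ^ q *
          (real CARD('n) ^ 1 * schwartz_seminorm q (Suc l) \<psi> * 2 ^ q * \<bar>- \<epsilon>\<bar> ^ 1 * inverse (jap y ^ q) * (LINT z|lborel. jap z ^ (1 + q) * norm (\<rho> z)))"
        unfolding iter_partial_diff[OF schwartz_smooth[OF \<Psi>] \<psi>s] d by (intro mult_left_mono) auto
      also have "\<dots> = K * \<epsilon>" using \<epsilon> by (simp add: K_def field_simps)
      finally show "jap y ^ q * norm (iter_partial js (\<lambda>y. ?\<Psi> y - \<psi> y) y) \<le> K * \<epsilon>" .
    qed
    from mult_left_mono[OF this C] TC[OF schwartz_diff[OF \<Psi> \<psi>]]
    show ?thesis by (simp add: tempered_conv_integral[OF T r \<psi>] tempered_diff[OF T \<Psi> \<psi>])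
  qed
  have "\<forall>\<^sub>F \<epsilon> in at_right 0. norm ((LINT x|lborel. distr_conv T (rescale \<rho> \<epsilon>) x * \<psi> x) - T \<psi>) \<le> C * (K * \<epsilon>)"
    unfolding eventually_at_right_field using bound by (intro exI[of _ 1]) auto
  moreover have "((\<lambda>\<epsilon>. C * (K * \<epsilon>)) \<longlongrightarrow> 0) (at_right 0)"
    by (intro tendsto_mult_right_zero tendsto_ident_at)
  ultimately have "((\<lambda>\<epsilon>. (LINT x|lborel. distr_conv T (rescale \<rho> \<epsilon>) x * \<psi> x) - T \<psi>) \<longlongrightarrow> 0) (at_right 0)"
    by (rule Lim_null_comparison)
  then show ?thesis by (rule LIM_zero_cancel)
qed

section \<open>Growth of regular nets\<close>

text \<open>As for \<open>schwartz_seminorm\<close>, the supremum is usable once it is known to be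
  finite: the decay of \<phi> outweighs the growth of each of the finitely many derivatives
  concerned.\<close>

lemma
  assumes \<phi>: "\<phi> \<in> schwartz" and f: "f \<in> O_M"
  shows nu_ge: "length js \<le> l \<Longrightarrow> norm (\<phi> x * iter_partial js f x) \<le> nu \<phi> l f"
    and nu_le: "(\<And>js x. length js \<le> l \<Longrightarrow> norm (\<phi> x * iter_partial js f x) \<le> B) \<Longrightarrow> nu \<phi> l f \<le> B"
proof -
  note sm = O_M_smooth[OF f]
  have "\<exists>B. \<forall>x. norm (\<phi> x * iter_partial js f x) \<le> B" for js
  proof -
    obtain q C where C: "\<And>x. norm (iter_partial js f x) \<le> C * jap x ^ q" using O_M_bound[OF f] by blast
    obtain A where A: "\<And>x. jap x ^ q * norm (\<phi> x) \<le> A" using schwartzD[OF \<phi>, of q "[]"] by auto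
    have "norm (\<phi> x * iter_partial js f x) \<le> C * A" for x
    proof -
      have "norm (\<phi> x * iter_partial js f x) \<le> norm (\<phi> x) * (C * jap x ^ q)"
        unfolding norm_mult by (intro mult_left_mono C) simp
      also have "\<dots> = C * (jap x ^ q * norm (\<phi> x))" by (simp add: mult_ac)
      also have "\<dots> \<le> C * A" by (intro mult_left_mono A jap_bound_nonneg[OF C])
      finally show ?thesis .
    qed
    then show ?thesis by blast
  qed
  then obtain D where D: "\<And>js x. norm (\<phi> x * iter_partial js f x) \<le> D js" by metis
  have D0: "0 \<le> D js" for js using order_trans[OF norm_ge_zero D] .
  have "norm (\<phi> x * iter_partial js f x) \<le> (\<Sum>js\<in>{js. length js \<le> l}. D js)" if "length js \<le> l" for x js
    by (rule order_trans[OF D]) (use that in \<open>auto intro!: member_le_sum D0 finite_index_lists\<close>)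
  then have "\<forall>x js. length js \<le> l \<longrightarrow> norm (\<phi> x * iter_partial js f x) \<le> (\<Sum>js\<in>{js. length js \<le> l}. D js)" by blast
  then have *: "\<forall>x \<alpha>. mi_size \<alpha> \<le> l \<longrightarrow> norm (\<phi> x * mi_deriv \<alpha> f x) \<le> (\<Sum>js\<in>{js. length js \<le> l}. D js)"
    unfolding ball_mi_deriv_iff[OF sm, where P = "\<lambda>x y. norm (\<phi> x * y) \<le> (\<Sum>js\<in>{js. length js \<le> l}. D js)"] .
  have "bdd_above ((\<lambda>(x, \<alpha>). norm (\<phi> x * mi_deriv \<alpha> f x)) ` (UNIV \<times> {\<alpha>. mi_size \<alpha> \<le> l}))"
    by (rule bdd_aboveI[of _ "\<Sum>js\<in>{js. length js \<le> l}. D js"]) (use * in auto)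
  note upper = cSUP_upper[OF _ this]
  have "\<forall>x \<alpha>. mi_size \<alpha> \<le> l \<longrightarrow> norm (\<phi> x * mi_deriv \<alpha> f x) \<le> nu \<phi> l f"
  proof (intro allI impI)
    fix x and \<alpha> :: "'a \<Rightarrow> nat" assume "mi_size \<alpha> \<le> l"
    then show "norm (\<phi> x * mi_deriv \<alpha> f x) \<le> nu \<phi> l f"
      using upper[of "(x, \<alpha>)"] by (simp add: nu_def)
  qed
  then have "\<forall>x js. length js \<le> l \<longrightarrow> norm (\<phi> x * iter_partial js f x) \<le> nu \<phi> l f"
    unfolding ball_mi_deriv_iff[OF sm, where P = "\<lambda>x y. norm (\<phi> x * y) \<le> nu \<phi> l f"] .
  then show "length js \<le> l \<Longrightarrow> norm (\<phi> x * iter_partial js f x) \<le> nu \<phi> l f" by blast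
  assume "\<And>js x. length js \<le> l \<Longrightarrow> norm (\<phi> x * iter_partial js f x) \<le> B"
  then have "\<forall>x js. length js \<le> l \<longrightarrow> norm (\<phi> x * iter_partial js f x) \<le> B" by blast
  then have *: "\<forall>x \<alpha>. mi_size \<alpha> \<le> l \<longrightarrow> norm (\<phi> x * mi_deriv \<alpha> f x) \<le> B"
    unfolding ball_mi_deriv_iff[OF sm, where P = "\<lambda>x y. norm (\<phi> x * y) \<le> B"] .
  have "mi_size (\<lambda>_::'a. 0) \<le> l" by (simp add: mi_size_def)
  then have "{\<alpha> :: 'a \<Rightarrow> nat. mi_size \<alpha> \<le> l} \<noteq> {}" by blast
  then show "nu \<phi> l f \<le> B"
    unfolding nu_def using * by (intro cSUP_least) auto
qed

lemma nu_nonneg: "\<phi> \<in> schwartz \<Longrightarrow> f \<in> O_M \<Longrightarrow> 0 \<le> nu \<phi> l f"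
  by (rule order_trans[OF norm_ge_zero nu_ge[of \<phi> f "[]" l 0]]) auto

lemma norm_integral_le_integral:
  fixes f :: "'a \<Rightarrow> 'b::{banach,second_countable_topology}"
  assumes "integrable M f" "integrable M g" "\<And>x. norm (f x) \<le> g x"
  shows "norm (integral\<^sup>L M f) \<le> integral\<^sup>L M g"
  by (rule order_trans[OF integral_norm_bound integral_mono]) (use assms in auto)

lemma O_M_add:
  assumes "f \<in> O_M" "g \<in> O_M"
  shows "(\<lambda>x. f x + g x) \<in> O_M"
proof -
  have "\<exists>q C. \<forall>x. norm (iter_partial js f x + iter_partial js g x) \<le> C * jap x ^ q" for js
  proof -
    obtain q C r D where C: "\<And>x. norm (iter_partial js f x) \<le> C * jap x ^ q"
      and D: "\<And>x. norm (iter_partial js g x) \<le> D * jap x ^ r"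
      using assms[THEN O_M_bound] by meson
    have "norm (iter_partial js f x + iter_partial js g x) \<le> (C + D) * jap x ^ (q + r)" for x
    proof -
      have "norm (iter_partial js f x + iter_partial js g x) \<le> C * jap x ^ q + D * jap x ^ r"
        using norm_triangle_ineq[of "iter_partial js f x" "iter_partial js g x"] C[of x] D[of x] by linarith
      also have "\<dots> \<le> C * jap x ^ (q + r) + D * jap x ^ (q + r)"
        by (intro add_mono mult_left_mono jap_power_mono jap_bound_nonneg[OF C] jap_bound_nonneg[OF D]) auto
      finally show ?thesis by (simp add: distrib_right)
    qed
    then show ?thesis by blast
  qed
  with assms show ?thesis
    by (auto simp: O_M_iff iter_partial_add smooth_add)
qed

text \<open>The function is a sum of translates of \<open>\<bar>\<rho>\<bar>\<^sup>2\<close>. All terms being nonnegative, the points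
  \<open>X k\<close> need not be separated.\<close>

lemma schwartz_bounded_below_on_sequence:
  fixes \<rho> :: "real ^ 'n::finite \<Rightarrow> complex" and X :: "nat \<Rightarrow> real ^ 'n"
  assumes \<rho>: "\<rho> \<in> schwartz" and z0: "\<rho> z0 \<noteq> 0"
  shows "\<exists>\<phi>\<in>schwartz. \<exists>c>0. \<forall>k. c * ((1/2) ^ k / jap (X k) ^ k) \<le> norm (\<phi> (X k))"
proof -
  \<comment> \<open>The shift makes \<eta>(0) positive. The product with the conjugate is the
    squared modulus, which stays smooth at zeros of \<rho>.\<close>
  define \<eta> where "\<eta> x = \<rho> (z0 + x) * cnj (\<rho> (z0 + x))" for x
  have "(\<lambda>x. \<rho> (z0 + x)) \<in> schwartz" using schwartz_affine[OF \<rho>, of 1 z0] by simp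
  then have \<eta>: "\<eta> \<in> schwartz"
    unfolding \<eta>_def by (intro schwartz_mult schwartz_cnj)
  note \<eta>s = schwartz_smooth[OF \<eta>]
  have \<eta>_real: "\<eta> x = of_real ((norm (\<rho> (z0 + x)))\<^sup>2)" for x
    by (simp add: \<eta>_def complex_norm_square del: of_real_power)
  \<comment> \<open>A translate by X k costs a factor \<open>jap (X k) ^ q\<close> in a seminorm.
    The exponent k exceeds each fixed q eventually, and the factor 2^(-k) provides summability even
    if the points stay bounded.\<close>
  define c where "c k = (1/2) ^ k / jap (X k) ^ k" for k
  have c0: "0 < c k" for k by (simp add: c_def)
  have c_sum: "summable (\<lambda>k. c k * jap (X k) ^ q)" for q
  proof (rule summable_comparison_test')
    show "summable (\<lambda>k. (1/2) ^ k :: real)" by (rule summable_geometric) simp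
    show "norm (c k * jap (X k) ^ q) \<le> (1/2) ^ k" if "q \<le> k" for k
    proof -
      have "c k * jap (X k) ^ q \<le> c k * jap (X k) ^ k"
        using c0[of k] by (intro mult_left_mono jap_power_mono that) auto
      also have "\<dots> = (1/2) ^ k" by (simp add: c_def)
      finally show ?thesis using c0[of k] by (simp add: abs_mult)
    qed
  qed
  define \<Phi> where "\<Phi> x k = of_real (c k) * \<eta> (x - X k)" for x k
  have aff: "(\<lambda>x. \<Phi> x k) = (\<lambda>x. of_real (c k) * \<eta> (- X k + 1 *\<^sub>R x))" for k
    by (simp add: \<Phi>_def)
  have eq: "iter_partial js (\<lambda>x. \<Phi> x k) = (\<lambda>x. of_real (c k) * iter_partial js \<eta> (x - X k))" for js k
    unfolding aff iter_partial_cmult[OF smooth_affine[OF \<eta>s]] iter_partial_affine[OF \<eta>s] by simp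
  have sm: "smooth (\<lambda>x. \<Phi> x k)" for k
    unfolding aff by (intro smooth_cmult smooth_affine \<eta>s)
  have bd: "\<exists>A. \<forall>k x. jap x ^ q * norm (iter_partial js (\<lambda>x. \<Phi> x k) x) \<le> A * (c k * jap (X k) ^ q)" for js q
  proof -
    obtain A where A: "\<And>x. jap x ^ q * norm (iter_partial js \<eta> x) \<le> A" using schwartzD[OF \<eta>] by blast
    have "jap x ^ q * norm (iter_partial js (\<lambda>x. \<Phi> x k) x) \<le> (2 ^ q * A) * (c k * jap (X k) ^ q)" for k x
    proof -
      have "jap x ^ q = jap ((x - X k) + X k) ^ q" by simp
      also have "\<dots> \<le> 2 ^ q * jap (x - X k) ^ q * jap (X k) ^ q" by (rule jap_add_power)
      finally have "jap x ^ q * norm (iter_partial js \<eta> (x - X k)) \<le> 2 ^ q * jap (x - X k) ^ q * jap (X k) ^ q * norm (iter_partial js \<eta> (x - X k))"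
        by (rule mult_right_mono) simp
      also have "\<dots> = 2 ^ q * jap (X k) ^ q * (jap (x - X k) ^ q * norm (iter_partial js \<eta> (x - X k)))"
        by (simp add: mult_ac)
      also have "\<dots> \<le> 2 ^ q * jap (X k) ^ q * A" by (intro mult_left_mono A) auto
      finally have "c k * (jap x ^ q * norm (iter_partial js \<eta> (x - X k))) \<le> c k * (2 ^ q * jap (X k) ^ q * A)"
        using c0[of k] by (intro mult_left_mono) auto
      then show ?thesis using c0[of k] by (simp add: eq norm_mult mult_ac)
    qed
    then show ?thesis by blast
  qed
  let ?M = "count_space (UNIV :: nat set)"
  have int_real: "integrable ?M (\<lambda>k. A * (c k * jap (X k) ^ q))" for A q
    using c0 by (intro integrable_mult_right) (simp add: integrable_count_space_nat_iff c_sum abs_mult less_imp_le)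
  have *: "\<exists>q B. integrable ?M B \<and> (\<forall>x. \<forall>k\<in>space ?M. norm (iter_partial js (\<lambda>x. \<Phi> x k) x) \<le> jap x ^ q * B k)" for js
  proof -
    obtain A where "\<And>k x. jap x ^ 0 * norm (iter_partial js (\<lambda>x. \<Phi> x k) x) \<le> A * (c k * jap (X k) ^ 0)"
      using bd[of 0 js] by blast
    then have "\<forall>x. \<forall>k\<in>space ?M. norm (iter_partial js (\<lambda>x. \<Phi> x k) x) \<le> jap x ^ 0 * (A * (c k * jap (X k) ^ 0))" by simp
    with int_real show ?thesis by blast
  qed
  note ** = sm borel_measurable_count_space *
  define \<phi> where "\<phi> x = (\<integral>k. \<Phi> x k \<partial>?M)" for x
  have deriv: "iter_partial js \<phi> = (\<lambda>x. \<integral>k. iter_partial js (\<lambda>x. \<Phi> x k) x \<partial>?M)" for js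
    unfolding \<phi>_def by (rule iter_partial_integral[where M = ?M, OF **])
  have int: "integrable ?M (\<lambda>k. iter_partial js (\<lambda>x. \<Phi> x k) x)" for js x
    by (rule integrable_iter_partial_parameter[where M = ?M, OF **])
  have "\<exists>C. \<forall>x. jap x ^ q * norm (iter_partial js \<phi> x) \<le> C" for js q
  proof -
    obtain A where A: "\<And>k x. jap x ^ q * norm (iter_partial js (\<lambda>x. \<Phi> x k) x) \<le> A * (c k * jap (X k) ^ q)"
      using bd[of q js] by blast
    have "jap x ^ q * norm (iter_partial js \<phi> x) \<le> (\<integral>k. A * (c k * jap (X k) ^ q) \<partial>?M)" for x
    proof -
      have "norm (\<integral>k. of_real (jap x ^ q) * iter_partial js (\<lambda>x. \<Phi> x k) x \<partial>?M) \<le> (\<integral>k. A * (c k * jap (X k) ^ q) \<partial>?M)"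
      proof (rule norm_integral_le_integral)
        show "integrable ?M (\<lambda>k. of_real (jap x ^ q) * iter_partial js (\<lambda>x. \<Phi> x k) x)"
          by (intro integrable_mult_right int)
        show "integrable ?M (\<lambda>k. A * (c k * jap (X k) ^ q))" by (rule int_real)
        show "norm (of_real (jap x ^ q) * iter_partial js (\<lambda>x. \<Phi> x k) x) \<le> A * (c k * jap (X k) ^ q)" for k
          using A[of x k] by (simp add: norm_mult norm_power)
      qed
      then show ?thesis by (simp add: deriv norm_mult norm_power)
    qed
    then show ?thesis by blast
  qed
  moreover have "smooth \<phi>"
    unfolding \<phi>_def by (rule smooth_integral[where M = ?M, OF **])
  ultimately have "\<phi> \<in> schwartz" by (simp add: schwartz_iff)
  moreover have "(norm (\<rho> z0))\<^sup>2 * c k \<le> norm (\<phi> (X k))" for k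
  proof -
    have Re: "Re (\<Phi> x j) = c j * (norm (\<rho> (z0 + (x - X j))))\<^sup>2" for x j
      unfolding \<Phi>_def \<eta>_real by simp
    have i: "integrable ?M (\<lambda>j. Re (\<Phi> (X k) j))"
      using int[of "[]" "X k"] by (intro integrable_Re) simp
    \<comment> \<open>All terms have nonnegative real part, so the sum at X k is at least its k-th
      term, which is c k times \<eta>(0).\<close>
    have "Re (\<Phi> (X k) k) = (\<Sum>j\<in>{k}. Re (\<Phi> (X k) j))" by simp
    also have "\<dots> \<le> (\<Sum>j. Re (\<Phi> (X k) j))"
      using i c0 by (intro sum_le_suminf) (auto simp: integrable_count_space_nat_iff Re less_imp_le intro: summable_rabs_cancel)
    also have "\<dots> = (\<integral>j. Re (\<Phi> (X k) j) \<partial>?M)" using integral_count_space_nat[OF i] by simp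
    also have "\<dots> = Re (\<phi> (X k))" using int[of "[]" "X k"] by (simp add: \<phi>_def)
    also have "\<dots> \<le> norm (\<phi> (X k))" by (rule complex_Re_le_cmod)
    finally show ?thesis by (simp add: Re mult.commute)
  qed
  moreover have "0 < (norm (\<rho> z0))\<^sup>2" using z0 by simp
  ultimately show ?thesis unfolding c_def by blast
qed

text \<open>A single order \<open>m\<close> serves all derivatives if the weight may depend on the order of
  differentiation: violating points \<open>x\<^sub>k\<close> for all \<open>m\<close> would be tested by one
  Schwartz function that is not too small along \<open>x\<^sub>k\<close>.\<close>

lemma moderate_inf_polynomial_growth:
  fixes \<rho> :: "real ^ 'n::finite \<Rightarrow> complex" and g :: "real \<Rightarrow> real ^ 'n \<Rightarrow> complex"
  assumes \<rho>: "\<rho> \<in> schwartz" and z0: "\<rho> z0 \<noteq> 0"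
    and H: "\<And>\<phi>. \<phi> \<in> schwartz \<Longrightarrow> \<exists>m. \<forall>l. \<exists>\<eta>>0. \<forall>\<epsilon> x js. 0 < \<epsilon> \<longrightarrow> \<epsilon> < \<eta> \<longrightarrow> length js \<le> l \<longrightarrow>
      norm (\<phi> x * iter_partial js (g \<epsilon>) x) \<le> 1 / \<epsilon> ^ m"
  shows "\<exists>m. \<forall>l. \<exists>k. \<forall>\<epsilon> x js. 0 < \<epsilon> \<longrightarrow> \<epsilon> < 1 / real (Suc k) \<longrightarrow> length js \<le> l \<longrightarrow>
    norm (iter_partial js (g \<epsilon>) x) \<le> 4 ^ k / \<epsilon> ^ m * jap x ^ k"
\<comment> \<open>The single index k governs the range of \<epsilon>, the constant and the weight
  exponent. The negation thus gives for every m some order \<open>L m\<close> and, for every k, one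
  violating triple of parameter, point and derivative.\<close>
proof (rule ccontr)
  assume "\<not> ?thesis"
  then have "\<forall>m. \<exists>l. \<forall>k. \<exists>\<epsilon> x js. 0 < \<epsilon> \<and> \<epsilon> < 1 / real (Suc k) \<and> length js \<le> l \<and>
    \<not> norm (iter_partial js (g \<epsilon>) x) \<le> 4 ^ k / \<epsilon> ^ m * jap x ^ k"
    unfolding not_ex not_all not_imp .
  from choice[OF this] obtain L where "\<forall>m. \<forall>k. \<exists>\<epsilon> x js. 0 < \<epsilon> \<and> \<epsilon> < 1 / real (Suc k) \<and> length js \<le> L m \<and>
    \<not> norm (iter_partial js (g \<epsilon>) x) \<le> 4 ^ k / \<epsilon> ^ m * jap x ^ k" ..
  then obtain e Y J where viol: "\<And>m k. 0 < e m k \<and> e m k < 1 / real (Suc k) \<and> length (J m k) \<le> L m \<and>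
    \<not> norm (iter_partial (J m k) (g (e m k)) (Y m k)) \<le> 4 ^ k / e m k ^ m * jap (Y m k) ^ k" by metis
  \<comment> \<open>The pairing function lists each m infinitely often, so one sequence, and hence
    one test function, carries violations with arbitrarily large k for every m.\<close>
  define X where "X k = Y (fst (prod_decode k)) k" for k
  obtain \<phi> c where \<phi>: "\<phi> \<in> schwartz" and c: "0 < c" and low: "\<And>k. c * ((1/2) ^ k / jap (X k) ^ k) \<le> norm (\<phi> (X k))"
    using schwartz_bounded_below_on_sequence[OF \<rho> z0, of X] by blast
  from H[OF \<phi>] obtain m where m: "\<forall>l. \<exists>\<eta>>0. \<forall>\<epsilon> x js. 0 < \<epsilon> \<longrightarrow> \<epsilon> < \<eta> \<longrightarrow> length js \<le> l \<longrightarrow>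
      norm (\<phi> x * iter_partial js (g \<epsilon>) x) \<le> 1 / \<epsilon> ^ m" ..
  from spec[OF m, of "L m"] obtain \<eta> where \<eta>_up: "0 < \<eta> \<and> (\<forall>\<epsilon> x js. 0 < \<epsilon> \<longrightarrow> \<epsilon> < \<eta> \<longrightarrow> length js \<le> L m \<longrightarrow>
      norm (\<phi> x * iter_partial js (g \<epsilon>) x) \<le> 1 / \<epsilon> ^ m)" ..
  then have \<eta>: "0 < \<eta>" and up: "\<And>\<epsilon> x js. 0 < \<epsilon> \<Longrightarrow> \<epsilon> < \<eta> \<Longrightarrow> length js \<le> L m \<Longrightarrow>
      norm (\<phi> x * iter_partial js (g \<epsilon>) x) \<le> 1 / \<epsilon> ^ m" by simp_all
  \<comment> \<open>With k \<ge> j this ensures 1/(k + 1) < \<eta>, so the violating parameter lies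
    in the range of \<open>up\<close>, and c 2^k \<ge> 1.\<close>
  obtain j where j: "1 / \<eta> + 1 / c < real j" using reals_Archimedean2 by blast
  define k where "k = prod_encode (m, j)"
  have k: "j \<le> k" unfolding k_def by (rule le_prod_encode_2)
  have "0 < 1 / \<eta>" "0 < 1 / c" "real j \<le> real k" using \<eta> c k by auto
  with j have "1 / \<eta> \<le> real k" "1 / c \<le> real k" by linarith+
  then have \<eta>k: "1 / real (Suc k) < \<eta>" and ck: "1 \<le> c * real k"
    using \<eta> c by (auto simp: field_simps)
  have "1 \<le> c * 2 ^ k"
  proof -
    have "c * real k \<le> c * 2 ^ k"
      using c of_nat_less_two_power[of k, where 'a = real] by (intro mult_left_mono) auto
    with ck show ?thesis by linarith
  qed
  let ?e = "e m k" let ?d = "norm (iter_partial (J m k) (g ?e) (Y m k))"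
  note v = viol[of m k]
  have X: "X k = Y m k" by (simp add: X_def k_def)
  have e0: "0 < ?e ^ m" using v by simp
  \<comment> \<open>Of 4^k = 2^k 2^k one factor cancels the (1/2)^k in the lower bound of \<phi>,
    the other outweighs 1/c.\<close>
  have "1 / ?e ^ m \<le> c * 2 ^ k / ?e ^ m"
    using e0 \<open>1 \<le> c * 2 ^ k\<close> by (simp add: divide_right_mono)
  also have "\<dots> = c * ((1/2) ^ k / jap (X k) ^ k) * (4 ^ k / ?e ^ m * jap (Y m k) ^ k)"
  proof -
    have "(4::real) ^ k = 2 ^ k * 2 ^ k" by (simp flip: power_mult_distrib)
    then show ?thesis by (simp add: X power_divide)
  qed
  also have "\<dots> < c * ((1/2) ^ k / jap (X k) ^ k) * ?d"
    using v c by (intro mult_strict_left_mono mult_pos_pos divide_pos_pos) auto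
  also have "\<dots> \<le> norm (\<phi> (X k)) * ?d"
    by (intro mult_right_mono low) auto
  also have "\<dots> \<le> 1 / ?e ^ m"
    using up[of ?e "J m k" "Y m k"] v \<eta>k by (simp add: X norm_mult)
  finally show False by simp
qed

section \<open>Limits of sequences of multipliers\<close>

lemma uniform_growth:
  fixes F :: "nat \<Rightarrow> real ^ 'n::finite \<Rightarrow> complex"
  assumes each: "\<And>j. \<exists>q C. \<forall>x. norm (F j x) \<le> C * jap x ^ q"
    and ev: "\<forall>j\<ge>J. \<forall>x. norm (F j x) \<le> C0 * jap x ^ q0 * (1/2) ^ j"
  shows "\<exists>q C. \<forall>j x. norm (F j x) \<le> C * jap x ^ q * (1/2) ^ j"
proof -
  obtain q C where C: "\<And>j x. norm (F j x) \<le> C j * jap x ^ q j" using each by metis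
  have C': "0 \<le> C j" for j by (rule jap_bound_nonneg[OF C])
  have C0: "0 \<le> C0"
  proof -
    have "norm (F J 0) \<le> (C0 * (1/2) ^ J) * jap (0 :: real ^ 'n) ^ q0" using ev by (simp add: mult_ac)
    from jap_bound_nonneg[OF this] show ?thesis using mult_neg_pos[of C0 "(1/2) ^ J"] by force
  qed
  define Q where "Q = q0 + (\<Sum>j<J. q j)"
  \<comment> \<open>The finitely many indices below J are absorbed into the constant; the factor 2^j
    offsets the (1/2)^j demanded of them.\<close>
  define D where "D = C0 + (\<Sum>j<J. C j * 2 ^ j)"
  have D0: "0 \<le> D" unfolding D_def using C0 C' by (intro add_nonneg_nonneg sum_nonneg) auto
  have "norm (F j x) \<le> D * jap x ^ Q * (1/2) ^ j" for j x
  proof (cases "j < J")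
    case True
    have "q j \<le> (\<Sum>j<J. q j)" using True by (intro member_le_sum) auto
    then have "jap x ^ q j \<le> jap x ^ Q" unfolding Q_def by (intro jap_power_mono) linarith
    moreover have "C j * 2 ^ j \<le> D"
    proof -
      have "C j * 2 ^ j \<le> (\<Sum>j<J. C j * 2 ^ j)" using True C' by (intro member_le_sum) auto
      with C0 show ?thesis by (simp add: D_def)
    qed
    ultimately have "(C j * 2 ^ j) * jap x ^ q j * (1/2) ^ j \<le> D * jap x ^ Q * (1/2) ^ j"
      using C'[of j] D0 by (intro mult_right_mono mult_mono) auto
    moreover have "(C j * 2 ^ j) * jap x ^ q j * (1/2) ^ j = C j * jap x ^ q j"
      by (simp add: power_divide)
    ultimately show ?thesis using C[of j x] by linarith
  next
    case False
    have "C0 \<le> D" unfolding D_def using C' by (simp add: sum_nonneg)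
    moreover have "jap x ^ q0 \<le> jap x ^ Q" unfolding Q_def by (intro jap_power_mono) simp
    ultimately have "C0 * jap x ^ q0 * (1/2) ^ j \<le> D * jap x ^ Q * (1/2) ^ j"
      using C0 by (intro mult_right_mono mult_mono) auto
    moreover have "norm (F j x) \<le> C0 * jap x ^ q0 * (1/2) ^ j" using ev False by simp
    ultimately show ?thesis by linarith
  qed
  then show ?thesis by blast
qed

text \<open>The limit is G 0 plus the series of differences, differentiated term by term. The index
  J from which the geometric bound holds may depend on the derivative. The common polynomial bound
  on all G j is kept as a majorant for the passage to the limit under the integral.\<close>

lemma O_M_geometric_limit:
  fixes G :: "nat \<Rightarrow> real ^ 'n::finite \<Rightarrow> complex"
  assumes G: "\<And>j. G j \<in> O_M"
    and cauchy: "\<And>js. \<exists>J q C. \<forall>j\<ge>J. \<forall>x.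
      norm (iter_partial js (G (Suc j)) x - iter_partial js (G j) x) \<le> C * jap x ^ q * (1/2) ^ j"
  shows "\<exists>f\<in>O_M. (\<forall>x. (\<lambda>j. G j x) \<longlonglongrightarrow> f x) \<and> (\<exists>q C. \<forall>j x. norm (G j x) \<le> C * jap x ^ q)"
proof -
  note Gs = O_M_smooth[OF G]
  define \<Phi> where "\<Phi> x j = G (Suc j) x - G j x" for x j
  have eq: "iter_partial js (\<lambda>x. \<Phi> x j) = (\<lambda>x. iter_partial js (G (Suc j)) x - iter_partial js (G j) x)" for js j
    unfolding \<Phi>_def by (rule iter_partial_diff[OF Gs Gs])
  have sm: "smooth (\<lambda>x. \<Phi> x j)" for j unfolding \<Phi>_def by (rule smooth_diff[OF Gs Gs])
  have bd: "\<exists>q C. \<forall>j x. norm (iter_partial js (\<lambda>x. \<Phi> x j) x) \<le> C * jap x ^ q * (1/2) ^ j" for js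
  proof -
    obtain J q0 C0 where "\<forall>j\<ge>J. \<forall>x. norm (iter_partial js (G (Suc j)) x - iter_partial js (G j) x) \<le> C0 * jap x ^ q0 * (1/2) ^ j"
      using cauchy by blast
    moreover have "\<exists>q C. \<forall>x. norm (iter_partial js (G (Suc j)) x - iter_partial js (G j) x) \<le> C * jap x ^ q" for j
    proof -
      have "(\<lambda>x. G (Suc j) x + (-1) * G j x) \<in> O_M"
      proof (rule O_M_add[OF G])
        show "(\<lambda>x. (-1) * G j x) \<in> O_M" using G[of j] by (simp only: O_M_iff smooth_cmult iter_partial_cmult norm_mult) simp
      qed
      then have "(\<lambda>x. G (Suc j) x - G j x) \<in> O_M" by simp
      from O_M_bound[OF this, of js] show ?thesis by (simp add: iter_partial_diff[OF Gs Gs])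
    qed
    ultimately show ?thesis unfolding eq by (intro uniform_growth)
  qed
  let ?M = "count_space (UNIV :: nat set)"
  have int_real: "integrable ?M (\<lambda>j. C * (1/2) ^ j :: real)" for C
    by (intro integrable_mult_right) (simp add: integrable_count_space_nat_iff)
  have *: "\<exists>q B. integrable ?M B \<and> (\<forall>x. \<forall>j\<in>space ?M. norm (iter_partial js (\<lambda>x. \<Phi> x j) x) \<le> jap x ^ q * B j)" for js
  proof -
    obtain q C where "\<And>j x. norm (iter_partial js (\<lambda>x. \<Phi> x j) x) \<le> C * jap x ^ q * (1/2) ^ j" using bd by blast
    then have "\<forall>x. \<forall>j\<in>space ?M. norm (iter_partial js (\<lambda>x. \<Phi> x j) x) \<le> jap x ^ q * (C * (1/2) ^ j)" by (simp add: mult_ac)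
    with int_real show ?thesis by blast
  qed
  note ** = sm borel_measurable_count_space *
  define S where "S x = (\<integral>j. \<Phi> x j \<partial>?M)" for x
  have deriv: "iter_partial js S = (\<lambda>x. \<integral>j. iter_partial js (\<lambda>x. \<Phi> x j) x \<partial>?M)" for js
    unfolding S_def by (rule iter_partial_integral[where M = ?M, OF **])
  have int: "integrable ?M (\<lambda>j. iter_partial js (\<lambda>x. \<Phi> x j) x)" for js x
    by (rule integrable_iter_partial_parameter[where M = ?M, OF **])
  have S: "S \<in> O_M"
    unfolding O_M_iff
  proof (intro conjI allI)
    show "smooth S" unfolding S_def by (rule smooth_integral[where M = ?M, OF **])
    fix js
    obtain q C where C: "\<And>j x. norm (iter_partial js (\<lambda>x. \<Phi> x j) x) \<le> C * jap x ^ q * (1/2) ^ j" using bd by blast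
    have "norm (iter_partial js S x) \<le> (C * (\<integral>j. (1/2) ^ j \<partial>?M)) * jap x ^ q" for x
    proof -
      have "norm (\<integral>j. iter_partial js (\<lambda>x. \<Phi> x j) x \<partial>?M) \<le> (\<integral>j. (C * jap x ^ q) * (1/2) ^ j \<partial>?M)"
        by (rule norm_integral_le_integral[OF int int_real C])
      then show ?thesis by (simp add: deriv mult_ac)
    qed
    then show "\<exists>q C. \<forall>x. norm (iter_partial js S x) \<le> C * jap x ^ q" by blast
  qed
  have tele: "(\<Sum>j<n. \<Phi> x j) = G n x - G 0 x" for n x
    unfolding \<Phi>_def by (rule sum_lessThan_telescope)
  have lim: "(\<lambda>j. G j x) \<longlonglongrightarrow> G 0 x + S x" for x
  proof -
    have "(\<lambda>j. \<Phi> x j) sums S x"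
      unfolding S_def using int[of "[]" x] by (intro sums_integral_count_space_nat) simp
    then have "(\<lambda>n. G 0 x + (G n x - G 0 x)) \<longlonglongrightarrow> G 0 x + S x"
      unfolding sums_def tele by (intro tendsto_add tendsto_const)
    then show ?thesis by simp
  qed
  have growth: "\<exists>q C. \<forall>j x. norm (G j x) \<le> C * jap x ^ q"
  proof -
    obtain q C where C: "\<And>j x. norm (\<Phi> x j) \<le> C * jap x ^ q * (1/2) ^ j" using bd[of "[]"] by auto
    obtain r D where D: "\<And>x. norm (G 0 x) \<le> D * jap x ^ r" using O_M_bound[OF G, of "[]" 0] by auto
    have D0: "0 \<le> D" by (rule jap_bound_nonneg[OF D])
    have C0: "0 \<le> C" using jap_bound_nonneg[of "\<Phi> 0 0" C 0 q] C[of 0 0] by simp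
    have "norm (G n x) \<le> (D + 2 * C) * jap x ^ (q + r)" for n x
    proof -
      have "G n x = G 0 x + (\<Sum>j<n. \<Phi> x j)" by (simp add: tele)
      then have "norm (G n x) \<le> norm (G 0 x) + norm (\<Sum>j<n. \<Phi> x j)" using norm_triangle_ineq by metis
      also have "norm (\<Sum>j<n. \<Phi> x j) \<le> (\<Sum>j<n. C * jap x ^ q * (1/2) ^ j)" by (intro sum_norm_le C)
      also have "\<dots> = C * jap x ^ q * (\<Sum>j<n. (1/2) ^ j)" by (simp add: sum_distrib_left)
      also have "\<dots> \<le> C * jap x ^ q * 2"
        using C0 by (intro mult_left_mono) (auto simp: sum_gp_strict)
      also have "norm (G 0 x) + C * jap x ^ q * 2 \<le> D * jap x ^ r + C * jap x ^ q * 2" using D by simp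
      also have "\<dots> \<le> D * jap x ^ (q + r) + C * jap x ^ (q + r) * 2"
        using C0 D0 by (intro add_mono mult_right_mono mult_left_mono jap_power_mono) auto
      finally show ?thesis by (simp add: algebra_simps)
    qed
    then show ?thesis by blast
  qed
  show ?thesis
    by (intro bexI[of _ "\<lambda>x. G 0 x + S x"] conjI allI lim growth O_M_add G S)
qed

section \<open>Multipliers define regular nets\<close>

lemma small_o_bounded:
  assumes "\<And>\<epsilon>. 0 < \<epsilon> \<Longrightarrow> \<epsilon> \<le> 1 \<Longrightarrow> \<bar>h \<epsilon>\<bar> \<le> B"
  shows "h \<in> o[at_right 0](\<lambda>\<epsilon>::real. \<epsilon> powi (- int 1) :: real)"
proof (rule landau_o.smallI)
  fix c :: real assume c: "0 < c"
  have B: "0 \<le> B" using assms[of 1] by simp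
  have "norm (h \<epsilon>) \<le> c * norm (\<epsilon> powi (- int 1))" if "0 < \<epsilon>" "\<epsilon> < min 1 (c / (B + 1))" for \<epsilon>
  proof -
    \<comment> \<open>B + 1 instead of B avoids dividing by zero when B = 0.\<close>
    have "\<epsilon> * (B + 1) < c" using that B by (simp add: pos_less_divide_eq)
    then have "B * \<epsilon> \<le> c" using that by (simp add: algebra_simps)
    then have "B \<le> c / \<epsilon>" using that by (simp add: pos_le_divide_eq)
    moreover have "norm (\<epsilon> powi (- int 1)) = 1 / \<epsilon>" using that by (simp add: power_int_minus divide_inverse)
    ultimately show ?thesis using assms[of \<epsilon>] that by simp
  qed
  moreover have "0 < min 1 (c / (B + 1))" using c B by simp
  ultimately show "\<forall>\<^sub>F \<epsilon> in at_right 0. norm (h \<epsilon>) \<le> c * norm (\<epsilon> powi (- int 1))"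
    unfolding eventually_at_right_field by blast
qed

text \<open>Needed to see that a net belongs to its own coset.\<close>

lemma zero_net_negligible: "(\<lambda>\<epsilon>\<in>{0<..1}. \<lambda>x. 0) \<in> negligible_nets"
proof -
  have z: "(\<lambda>x. 0) \<in> (O_M :: (real ^ 'a::finite \<Rightarrow> complex) set)"
    by (rule schwartz_subset_O_M[OF schwartz_zero])
  have "nu \<phi> l (\<lambda>x. 0) = 0" if "\<phi> \<in> schwartz" for \<phi> :: "real ^ 'a \<Rightarrow> complex" and l
  proof (rule antisym)
    show "nu \<phi> l (\<lambda>x. 0) \<le> 0" by (rule nu_le[OF that z]) (simp add: iter_partial_zero)
  qed (rule nu_nonneg[OF that z])
  then have "(\<lambda>\<epsilon>. nu \<phi> l ((\<lambda>\<epsilon>\<in>{0<..1}. \<lambda>x. 0) \<epsilon>)) \<in> o[at_right 0](\<lambda>\<epsilon>. \<epsilon> ^ m)"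
    if "\<phi> \<in> schwartz" for \<phi> :: "real ^ 'a \<Rightarrow> complex" and l m
    by (intro landau_o.smallI)
       (use that in \<open>auto simp: eventually_at_right_field intro!: exI[of _ 1] mult_nonneg_nonneg\<close>)
  with z show ?thesis by (auto simp: negligible_nets_def OM_nets_def)
qed

lemma distr_conv_distr_of:
  fixes f \<rho> :: "real ^ 'n::finite \<Rightarrow> complex"
  assumes f: "f \<in> O_M" and \<rho>: "\<rho> \<in> schwartz" and \<epsilon>: "0 < \<epsilon>"
  shows "distr_conv (distr_of f) (rescale \<rho> \<epsilon>) = (\<lambda>x. LINT z|lborel. f (x - \<epsilon> *\<^sub>R z) * \<rho> z)"
proof
  fix x
  have "(\<lambda>y. rescale \<rho> \<epsilon> (x - y)) \<in> schwartz"
    by (rule schwartz_reflect_translate[OF schwartz_rescale[OF \<rho>]]) (use \<epsilon> in simp)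
  then show "distr_conv (distr_of f) (rescale \<rho> \<epsilon>) x = (LINT z|lborel. f (x - \<epsilon> *\<^sub>R z) * \<rho> z)"
    using integral_rescale_left[OF \<rho> borel_measurable_smooth[OF O_M_smooth[OF f]] \<epsilon>]
    by (simp add: distr_conv_def distr_of_def)
qed

lemma iota_tau_O_M:
  fixes f \<rho> :: "real ^ 'n::finite \<Rightarrow> complex"
  assumes f: "f \<in> O_M" and \<rho>: "\<rho> \<in> schwartz"
  shows "iota_tau \<rho> (distr_of f) \<in> G_tau_inf"
proof -
  let ?g = "\<lambda>\<epsilon>\<in>{0<..1}. distr_conv (distr_of f) (rescale \<rho> \<epsilon>)"
  have g: "?g \<epsilon> = (\<lambda>x. LINT z|lborel. f (x - \<epsilon> *\<^sub>R z) * \<rho> z)" if "0 < \<epsilon>" "\<epsilon> \<le> 1" for \<epsilon>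
    using that by (simp add: distr_conv_distr_of[OF f \<rho>])
  have gO: "?g \<epsilon> \<in> O_M" if "0 < \<epsilon>" "\<epsilon> \<le> 1" for \<epsilon>
    unfolding g[OF that] by (rule O_M_conv[OF f \<rho>]) (use that in simp)
  have nets: "?g \<in> OM_nets" using gO by (auto simp: OM_nets_def)
  \<comment> \<open>Regularity asks for the order before l is given. The seminorms stay bounded as
    \<epsilon> varies, so order 1 works for all of them.\<close>
  have "(\<lambda>\<epsilon>. nu \<phi> l (?g \<epsilon>)) \<in> o[at_right 0](\<lambda>\<epsilon>. \<epsilon> powi (- int 1))" if \<phi>: "\<phi> \<in> schwartz" for \<phi> l
  proof -
    have "\<exists>B. \<forall>\<epsilon> x. 0 < \<epsilon> \<longrightarrow> \<epsilon> \<le> 1 \<longrightarrow> norm (\<phi> x * iter_partial js (?g \<epsilon>) x) \<le> B" for js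
    proof -
      obtain q C where C: "\<And>x. norm (iter_partial js f x) \<le> C * jap x ^ q" using O_M_bound[OF f] by blast
      obtain A where A: "\<And>x. jap x ^ q * norm (\<phi> x) \<le> A" using schwartzD[OF \<phi>, of q "[]"] by auto
      let ?I = "LINT z|lborel. jap z ^ q * norm (\<rho> z)"
      have I: "0 \<le> ?I" by (intro Bochner_Integration.integral_nonneg) simp
      have "norm (\<phi> x * iter_partial js (?g \<epsilon>) x) \<le> C * 2 ^ q * ?I * A" if "0 < \<epsilon>" "\<epsilon> \<le> 1" for \<epsilon> x
      proof -
        have \<epsilon>: "\<bar>\<epsilon>\<bar> \<le> 1" using that by simp
        have "norm (iter_partial js (?g \<epsilon>) x) \<le> C * 2 ^ q * jap x ^ q * ?I"
          unfolding g[OF that] iter_partial_O_M_conv[OF f \<rho> \<epsilon>] by (rule O_M_conv_bound[OF f \<rho> \<epsilon> C])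
        then have "norm (\<phi> x) * norm (iter_partial js (?g \<epsilon>) x) \<le> norm (\<phi> x) * (C * 2 ^ q * jap x ^ q * ?I)"
          by (rule mult_left_mono) simp
        also have "\<dots> = C * 2 ^ q * ?I * (jap x ^ q * norm (\<phi> x))" by (simp add: mult_ac)
        also have "\<dots> \<le> C * 2 ^ q * ?I * A"
          using jap_bound_nonneg[OF C] I by (intro mult_left_mono A) auto
        finally show ?thesis by (simp add: norm_mult)
      qed
      then show ?thesis by blast
    qed
    then obtain B where B: "\<And>js \<epsilon> x. 0 < \<epsilon> \<Longrightarrow> \<epsilon> \<le> 1 \<Longrightarrow> norm (\<phi> x * iter_partial js (?g \<epsilon>) x) \<le> B js" by metis
    have B0: "0 \<le> B js" for js using order_trans[OF norm_ge_zero B[of 1]] by simp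
    show ?thesis
    proof (rule small_o_bounded)
      fix \<epsilon> :: real assume \<epsilon>: "0 < \<epsilon>" "\<epsilon> \<le> 1"
      have "nu \<phi> l (?g \<epsilon>) \<le> (\<Sum>js | length js \<le> l. B js)"
      proof (rule nu_le[OF \<phi> gO[OF \<epsilon>]])
        fix js :: "'n list" and x assume l: "length js \<le> l"
        have "B js \<le> (\<Sum>js | length js \<le> l. B js)"
          using l by (intro member_le_sum B0) (auto simp: finite_index_lists)
        with B[OF \<epsilon>, of x js] show "norm (\<phi> x * iter_partial js (?g \<epsilon>) x) \<le> (\<Sum>js | length js \<le> l. B js)" by linarith
      qed
      then show "\<bar>nu \<phi> l (?g \<epsilon>)\<bar> \<le> (\<Sum>js | length js \<le> l. B js)"
        using nu_nonneg[OF \<phi> gO[OF \<epsilon>], of l] by simp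
    qed
  qed
  with nets have "?g \<in> moderate_inf" unfolding moderate_inf_def by blast
  then show ?thesis unfolding G_tau_inf_def iota_tau_def by blast
qed

section \<open>Regular tempered distributions are multipliers\<close>

text \<open>The factor 1/2 comes from the freedom in little-o; it lets the bounds for two nets add
  up to a bound without a constant.\<close>

lemma moderate_inf_bound:
  assumes v: "v \<in> moderate_inf" and \<phi>: "\<phi> \<in> schwartz"
  shows "\<exists>m. \<forall>l. \<forall>\<^sub>F \<epsilon> in at_right 0. \<forall>x js. length js \<le> l \<longrightarrow>
    norm (\<phi> x * iter_partial js (v \<epsilon>) x) \<le> 1/2 * (1 / \<epsilon> ^ m)"
proof -
  obtain m where m: "\<And>l. (\<lambda>\<epsilon>. nu \<phi> l (v \<epsilon>)) \<in> o[at_right 0](\<lambda>\<epsilon>. \<epsilon> powi (- int m))"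
    using v \<phi> unfolding moderate_inf_def by blast
  have vO: "v \<epsilon> \<in> O_M" if "0 < \<epsilon>" "\<epsilon> < 1" for \<epsilon>
    using v that by (auto simp: moderate_inf_def OM_nets_def PiE_def)
  have "\<forall>\<^sub>F \<epsilon> in at_right 0. \<forall>x js. length js \<le> l \<longrightarrow>
    norm (\<phi> x * iter_partial js (v \<epsilon>) x) \<le> 1/2 * (1 / \<epsilon> ^ m)" for l
  proof -
    have "\<forall>\<^sub>F \<epsilon> in at_right 0. norm (nu \<phi> l (v \<epsilon>)) \<le> 1/2 * norm (\<epsilon> powi (- int m))"
      by (rule landau_o.smallD[OF m]) simp
    moreover have "\<forall>\<^sub>F \<epsilon> in at_right (0::real). \<epsilon> \<in> {0<..<1}"
      by (rule eventually_at_right_real) simp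
    ultimately show ?thesis
    proof eventually_elim
      case (elim \<epsilon>)
      show ?case
      proof (intro allI impI)
        fix x and js :: "'a list" assume l: "length js \<le> l"
        have "v \<epsilon> \<in> O_M" using vO elim by simp
        from nu_ge[OF \<phi> this l] have "norm (\<phi> x * iter_partial js (v \<epsilon>) x) \<le> nu \<phi> l (v \<epsilon>)" .
        moreover have "norm (\<epsilon> powi (- int m)) = 1 / \<epsilon> ^ m"
          using elim(2) by (simp add: power_int_minus divide_inverse)
        moreover have "nu \<phi> l (v \<epsilon>) \<le> norm (nu \<phi> l (v \<epsilon>))" by simp
        ultimately show "norm (\<phi> x * iter_partial js (v \<epsilon>) x) \<le> 1/2 * (1 / \<epsilon> ^ m)"
          using elim(1) by linarith
      qed
    qed
  qed
  then show ?thesis by blast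
qed

text \<open>Order 0 serves every l, so the negligible correction can be estimated exactly like the
  regular representative.\<close>

lemma negligible_subset_moderate_inf: "negligible_nets \<subseteq> moderate_inf"
proof
  fix n assume n: "n \<in> negligible_nets"
  have "(\<lambda>\<epsilon>. nu \<phi> l (n \<epsilon>)) \<in> o[at_right 0](\<lambda>\<epsilon>. \<epsilon> powi (- int 0))" if "\<phi> \<in> schwartz" for \<phi> l
  proof -
    have "(\<lambda>\<epsilon>. nu \<phi> l (n \<epsilon>)) \<in> o[at_right 0](\<lambda>\<epsilon>. \<epsilon> ^ 0)"
      using n that unfolding negligible_nets_def by blast
    then show ?thesis by simp
  qed
  with n show "n \<in> moderate_inf" unfolding negligible_nets_def moderate_inf_def by blast
qed

lemma moderate_inf_add_bound:
  assumes v: "v \<in> moderate_inf" and n: "n \<in> moderate_inf" and \<phi>: "\<phi> \<in> schwartz"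
  shows "\<exists>m. \<forall>l. \<exists>\<eta>>0. \<forall>\<epsilon> x js. 0 < \<epsilon> \<longrightarrow> \<epsilon> < \<eta> \<longrightarrow> length js \<le> l \<longrightarrow>
    norm (\<phi> x * iter_partial js (\<lambda>x. v \<epsilon> x + n \<epsilon> x) x) \<le> 1 / \<epsilon> ^ m"
proof -
  obtain m where m: "\<And>l. \<forall>\<^sub>F \<epsilon> in at_right 0. \<forall>x js. length js \<le> l \<longrightarrow>
    norm (\<phi> x * iter_partial js (v \<epsilon>) x) \<le> 1/2 * (1 / \<epsilon> ^ m)" using moderate_inf_bound[OF v \<phi>] by blast
  obtain k where k: "\<And>l. \<forall>\<^sub>F \<epsilon> in at_right 0. \<forall>x js. length js \<le> l \<longrightarrow>
    norm (\<phi> x * iter_partial js (n \<epsilon>) x) \<le> 1/2 * (1 / \<epsilon> ^ k)" using moderate_inf_bound[OF n \<phi>] by blast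
  have O: "smooth (v \<epsilon>)" "smooth (n \<epsilon>)" if "0 < \<epsilon>" "\<epsilon> < 1" for \<epsilon>
    using v n that by (auto simp: moderate_inf_def OM_nets_def PiE_def intro!: O_M_smooth)
  have "\<exists>\<eta>>0. \<forall>\<epsilon> x js. 0 < \<epsilon> \<longrightarrow> \<epsilon> < \<eta> \<longrightarrow> length js \<le> l \<longrightarrow>
    norm (\<phi> x * iter_partial js (\<lambda>x. v \<epsilon> x + n \<epsilon> x) x) \<le> 1 / \<epsilon> ^ (m + k)" for l
  proof -
    have "\<forall>\<^sub>F \<epsilon> in at_right (0::real). \<epsilon> \<in> {0<..<1}"
      by (rule eventually_at_right_real) simp
    with m[of l] k[of l] have "\<forall>\<^sub>F \<epsilon> in at_right 0. \<forall>x js. length js \<le> l \<longrightarrow>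
      norm (\<phi> x * iter_partial js (\<lambda>x. v \<epsilon> x + n \<epsilon> x) x) \<le> 1 / \<epsilon> ^ (m + k)"
    proof eventually_elim
      case (elim \<epsilon>)
      show ?case
      proof (intro allI impI)
        fix x and js :: "'a list" assume l: "length js \<le> l"
        \<comment> \<open>For \<epsilon> < 1 the sum of the two orders dominates each of them, and
          it remains independent of l.\<close>
        have p: "1 / \<epsilon> ^ i \<le> 1 / \<epsilon> ^ (m + k)" if "i \<le> m + k" for i
          using elim(3) that by (intro divide_left_mono power_decreasing mult_pos_pos) auto
        have "norm (\<phi> x * iter_partial js (\<lambda>x. v \<epsilon> x + n \<epsilon> x) x)
          \<le> norm (\<phi> x * iter_partial js (v \<epsilon>) x) + norm (\<phi> x * iter_partial js (n \<epsilon>) x)"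
          using elim(3) O by (auto simp: iter_partial_add distrib_left intro: norm_triangle_ineq)
        moreover have "norm (\<phi> x * iter_partial js (v \<epsilon>) x) \<le> 1/2 * (1 / \<epsilon> ^ m)"
          "norm (\<phi> x * iter_partial js (n \<epsilon>) x) \<le> 1/2 * (1 / \<epsilon> ^ k)" using elim(1,2) l by blast+
        moreover have "1/2 * (1 / \<epsilon> ^ m) + 1/2 * (1 / \<epsilon> ^ k) \<le> 1 / \<epsilon> ^ (m + k)"
          using p[of m] p[of k] by linarith
        ultimately show "norm (\<phi> x * iter_partial js (\<lambda>x. v \<epsilon> x + n \<epsilon> x) x) \<le> 1 / \<epsilon> ^ (m + k)" by linarith
      qed
    qed
    then obtain b where "0 < b" "\<forall>\<epsilon>>0. \<epsilon> < b \<longrightarrow> (\<forall>x js. length js \<le> l \<longrightarrow>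
      norm (\<phi> x * iter_partial js (\<lambda>x. v \<epsilon> x + n \<epsilon> x) x) \<le> 1 / \<epsilon> ^ (m + k))"
      unfolding eventually_at_right_field by auto
    then show ?thesis by (intro exI[of _ b]) simp
  qed
  then show ?thesis by blast
qed

text \<open>Membership in the quotient says only that some regular representative has the same
  coset. Because the regularised net lies in that coset, it equals this representative plus a
  negligible net for each \<epsilon>, not merely asymptotically.\<close>

lemma G_tau_inf_decompose:
  assumes "iota_tau \<rho> u \<in> G_tau_inf"
  shows "\<exists>v\<in>moderate_inf. \<exists>n\<in>moderate_inf. \<forall>\<epsilon>\<in>{0<..1}. distr_conv u (rescale \<rho> \<epsilon>) = (\<lambda>x. v \<epsilon> x + n \<epsilon> x)"
proof -
  let ?U = "\<lambda>\<epsilon>\<in>{0<..1}. distr_conv u (rescale \<rho> \<epsilon>)"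
  obtain v where v: "v \<in> moderate_inf" and eq: "net_class ?U = net_class v"
    using assms unfolding G_tau_inf_def iota_tau_def by auto
  have "?U = (\<lambda>\<epsilon>\<in>{0<..1}. \<lambda>x. ?U \<epsilon> x + (\<lambda>\<epsilon>\<in>{0<..1}. \<lambda>x. 0) \<epsilon> x)" by (auto simp: restrict_def)
  then have "?U \<in> net_class ?U" unfolding net_class_def using zero_net_negligible by blast
  then obtain n where n: "n \<in> negligible_nets" and U: "?U = (\<lambda>\<epsilon>\<in>{0<..1}. \<lambda>x. v \<epsilon> x + n \<epsilon> x)"
    unfolding eq unfolding net_class_def by blast
  have "distr_conv u (rescale \<rho> \<epsilon>) = (\<lambda>x. v \<epsilon> x + n \<epsilon> x)" if "\<epsilon> \<in> {0<..1}" for \<epsilon>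
    using fun_cong[OF U, of \<epsilon>] that by simp
  with v n negligible_subset_moderate_inf show ?thesis by blast
qed

lemma iter_partial_regularisation_diff:
  fixes \<rho> :: "real ^ 'n::finite \<Rightarrow> complex"
  assumes \<rho>: "mollifier \<rho>" and u: "u \<in> tempered"
    and gO: "\<And>\<epsilon>. 0 < \<epsilon> \<Longrightarrow> \<epsilon> \<le> 1 \<Longrightarrow> distr_conv u (rescale \<rho> \<epsilon>) \<in> O_M"
    and bd: "\<And>\<epsilon> x js. 0 < \<epsilon> \<Longrightarrow> \<epsilon> < \<eta> \<Longrightarrow> length js \<le> l + Suc m \<Longrightarrow>
      norm (iter_partial js (distr_conv u (rescale \<rho> \<epsilon>)) x) \<le> A / \<epsilon> ^ m * jap x ^ k"
    and A: "0 \<le> A" and \<eta>: "\<eta> \<le> 1" and js: "length js \<le> l"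
  shows "\<exists>C. \<forall>t x. 0 < t \<longrightarrow> t < \<eta> \<longrightarrow>
    norm (iter_partial js (distr_conv u (rescale \<rho> (t / 2))) x - iter_partial js (distr_conv u (rescale \<rho> t)) x)
      \<le> C * jap x ^ k * t"
proof -
  note \<rho>s = mollifier_schwartz[OF \<rho>]
  let ?g = "\<lambda>\<epsilon>. distr_conv u (rescale \<rho> \<epsilon>)"
  let ?P = "\<lambda>\<epsilon> \<delta> x. LINT z|lborel. iter_partial js (?g \<epsilon>) (x - \<delta> *\<^sub>R z) * \<rho> z"
  \<comment> \<open>The constant of \<open>mollifier_approx\<close> for N = m + 1 and the weight
    jap^k, whose Peetre constant is 2^k; the factor \<epsilon>^(-m) is kept apart.\<close>
  define D where "D = real CARD('n) ^ Suc m * A * 2 ^ k * (LINT z|lborel. jap z ^ (Suc m + k) * norm (\<rho> z))"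
  have I: "0 \<le> (LINT z|lborel. jap z ^ (Suc m + k) * norm (\<rho> z))"
    by (intro Bochner_Integration.integral_nonneg) simp
  have D: "0 \<le> D" unfolding D_def using A I by simp
  have approx: "norm (?P \<epsilon> \<delta> x - iter_partial js (?g \<epsilon>) x) \<le> D * (\<delta> ^ Suc m / \<epsilon> ^ m) * jap x ^ k"
    if \<epsilon>: "0 < \<epsilon>" "\<epsilon> < \<eta>" and \<delta>: "0 < \<delta>" "\<delta> \<le> 1" for \<epsilon> \<delta> x
  proof -
    have O: "?g \<epsilon> \<in> O_M" by (rule gO) (use \<epsilon> \<eta> in auto)
    obtain q C where C: "\<And>x. norm (iter_partial js (?g \<epsilon>) x) \<le> C * jap x ^ q" using O_M_bound[OF O] by blast
    have "norm (?P \<epsilon> \<delta> x - iter_partial js (?g \<epsilon>) x)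
      \<le> real CARD('n) ^ Suc m * (A / \<epsilon> ^ m) * 2 ^ k * \<bar>\<delta>\<bar> ^ Suc m * jap x ^ k * (LINT z|lborel. jap z ^ (Suc m + k) * norm (\<rho> z))"
    proof (rule mollifier_approx[OF \<rho>])
      show "smooth (iter_partial js (?g \<epsilon>))"
        using O_M_smooth[OF O] unfolding smooth_def by (metis iter_partial_append)
      show "norm (iter_partial js (?g \<epsilon>) y) \<le> C * jap y ^ q" for y by (rule C)
      show "norm (iter_partial ks (iter_partial js (?g \<epsilon>)) y) \<le> A / \<epsilon> ^ m * jap y ^ k" if "length ks = Suc m" for ks y
        \<comment> \<open>Expanding a derivative of order at most l to order m + 1 uses derivatives
          up to l + m + 1, the range of \<open>bd\<close>.\<close>
        using bd[OF \<epsilon>, of "ks @ js" y] that js by (simp add: iter_partial_append)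
    qed (use \<epsilon> \<delta> A in \<open>auto intro: jap_add_power\<close>)
    also have "\<dots> = D * (\<delta> ^ Suc m / \<epsilon> ^ m) * jap x ^ k"
      using \<delta> by (simp add: D_def del: power_Suc)
    finally show ?thesis .
  qed
  \<comment> \<open>The commutation of the two mollifications is differentiated; on each side the
    derivative falls on the regularised distribution.\<close>
  have commute: "?P \<epsilon> \<delta> = ?P \<delta> \<epsilon>" if \<epsilon>: "0 < \<epsilon>" "\<epsilon> \<le> 1" and \<delta>: "0 < \<delta>" "\<delta> \<le> 1" for \<epsilon> \<delta>
  proof -
    have P: "?P \<epsilon> \<delta> = iter_partial js (\<lambda>x. LINT z|lborel. ?g \<epsilon> (x - \<delta> *\<^sub>R z) * \<rho> z)"
      if "0 < \<epsilon>" "\<epsilon> \<le> 1" "0 < \<delta>" "\<delta> \<le> 1" for \<epsilon> \<delta>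
      by (rule iter_partial_O_M_conv[OF gO \<rho>s, symmetric]) (use that in auto)
    have "(\<lambda>x. LINT z|lborel. ?g \<epsilon> (x - \<delta> *\<^sub>R z) * \<rho> z) = (\<lambda>x. LINT z|lborel. ?g \<delta> (x - \<epsilon> *\<^sub>R z) * \<rho> z)"
      by (intro ext distr_conv_rescale_commute[OF u \<rho>s \<epsilon>(1) \<delta>(1)])
    then show ?thesis unfolding P[OF \<epsilon> \<delta>] P[OF \<delta> \<epsilon>] by (rule arg_cong)
  qed
  have "norm (iter_partial js (?g (t / 2)) x - iter_partial js (?g t) x) \<le> (D * (1 + 2 ^ m)) * jap x ^ k * t"
    if t: "0 < t" "t < \<eta>" for t x
  proof -
    have eq: "?P t (t / 2) x = ?P (t / 2) t x"
      using commute[of t "t / 2"] t \<eta> by (simp add: fun_eq_iff)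
    have a: "norm (?P t (t / 2) x - iter_partial js (?g t) x) \<le> D * ((t / 2) ^ Suc m / t ^ m) * jap x ^ k"
      by (rule approx) (use t \<eta> in auto)
    have b: "norm (?P t (t / 2) x - iter_partial js (?g (t / 2)) x) \<le> D * (t ^ Suc m / (t / 2) ^ m) * jap x ^ k"
      unfolding eq by (rule approx) (use t \<eta> in auto)
    have "(t / 2) ^ Suc m / t ^ m = t / 2 ^ Suc m" using t by (simp add: power_divide)
    also have "\<dots> \<le> t / 1" using t by (intro divide_left_mono one_le_power) auto
    finally have e1: "(t / 2) ^ Suc m / t ^ m \<le> t" by simp
    \<comment> \<open>Here the smaller parameter is in the denominator; halving costs only the fixed
      factor 2^m.\<close>
    have e2: "t ^ Suc m / (t / 2) ^ m = 2 ^ m * t" using t by (simp add: power_divide)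
    have "norm (iter_partial js (?g (t / 2)) x - iter_partial js (?g t) x)
      \<le> norm (?P t (t / 2) x - iter_partial js (?g t) x) + norm (?P t (t / 2) x - iter_partial js (?g (t / 2)) x)"
      using norm_triangle_ineq4[of "?P t (t / 2) x - iter_partial js (?g t) x" "?P t (t / 2) x - iter_partial js (?g (t / 2)) x"]
      by simp
    also have "\<dots> \<le> D * t * jap x ^ k + D * (2 ^ m * t) * jap x ^ k"
    proof (rule add_mono)
      have "D * ((t / 2) ^ Suc m / t ^ m) * jap x ^ k \<le> D * t * jap x ^ k"
        using D by (intro mult_right_mono mult_left_mono e1) auto
      with a show "norm (?P t (t / 2) x - iter_partial js (?g t) x) \<le> D * t * jap x ^ k" by linarith
      show "norm (?P t (t / 2) x - iter_partial js (?g (t / 2)) x) \<le> D * (2 ^ m * t) * jap x ^ k"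
        using b unfolding e2 .
    qed
    also have "\<dots> = (D * (1 + 2 ^ m)) * jap x ^ k * t" by (simp add: algebra_simps)
    finally show ?thesis .
  qed
  then show ?thesis by blast
qed

lemma regular_imp_O_M:
  fixes \<rho> :: "real ^ 'n::finite \<Rightarrow> complex"
  assumes \<rho>: "mollifier \<rho>" and u: "u \<in> tempered" and reg: "iota_tau \<rho> u \<in> G_tau_inf"
  shows "u \<in> distr_of ` O_M"
proof -
  note \<rho>s = mollifier_schwartz[OF \<rho>]
  let ?g = "\<lambda>\<epsilon>. distr_conv u (rescale \<rho> \<epsilon>)"
  obtain v n where v: "v \<in> moderate_inf" and n: "n \<in> moderate_inf"
    and g: "\<And>\<epsilon>. 0 < \<epsilon> \<Longrightarrow> \<epsilon> \<le> 1 \<Longrightarrow> ?g \<epsilon> = (\<lambda>x. v \<epsilon> x + n \<epsilon> x)"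
    using G_tau_inf_decompose[OF reg] by fastforce
  have gO: "?g \<epsilon> \<in> O_M" if "0 < \<epsilon>" "\<epsilon> \<le> 1" for \<epsilon>
    unfolding g[OF that] using v n that by (intro O_M_add) (auto simp: moderate_inf_def OM_nets_def PiE_def)
  \<comment> \<open>A mollifier has integral 1 and so cannot vanish identically.\<close>
  obtain z0 where z0: "\<rho> z0 \<noteq> 0"
  proof (rule ccontr)
    assume "\<not> thesis"
    then have "\<rho> = (\<lambda>x. 0)" using that by blast
    with \<rho> show False by (simp add: mollifier_def)
  qed
  have "\<exists>m. \<forall>l. \<exists>k. \<forall>\<epsilon> x js. 0 < \<epsilon> \<longrightarrow> \<epsilon> < 1 / real (Suc k) \<longrightarrow> length js \<le> l \<longrightarrow>
    norm (iter_partial js (\<lambda>x. v \<epsilon> x + n \<epsilon> x) x) \<le> 4 ^ k / \<epsilon> ^ m * jap x ^ k"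
    by (rule moderate_inf_polynomial_growth[OF \<rho>s z0 moderate_inf_add_bound[OF v n]])
  then obtain m where m: "\<And>l. \<exists>k. \<forall>\<epsilon> x js. 0 < \<epsilon> \<longrightarrow> \<epsilon> < 1 / real (Suc k) \<longrightarrow> length js \<le> l \<longrightarrow>
    norm (iter_partial js (\<lambda>x. v \<epsilon> x + n \<epsilon> x) x) \<le> 4 ^ k / \<epsilon> ^ m * jap x ^ k" by (elim exE) blast
  define G where "G j = ?g ((1/2) ^ j)" for j :: nat
  have half: "0 < (1/2 :: real) ^ j" "(1/2 :: real) ^ j \<le> 1" for j by (auto intro: power_le_one)
  have G: "G j \<in> O_M" for j unfolding G_def by (intro gO half)
  have "\<exists>f\<in>O_M. (\<forall>x. (\<lambda>j. G j x) \<longlonglongrightarrow> f x) \<and> (\<exists>q C. \<forall>j x. norm (G j x) \<le> C * jap x ^ q)"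
  proof (rule O_M_geometric_limit[OF G])
    fix js :: "'n list"
    let ?l = "length js + Suc m"
    obtain k where k: "\<forall>\<epsilon> x ks. 0 < \<epsilon> \<longrightarrow> \<epsilon> < 1 / real (Suc k) \<longrightarrow> length ks \<le> ?l \<longrightarrow>
      norm (iter_partial ks (\<lambda>x. v \<epsilon> x + n \<epsilon> x) x) \<le> 4 ^ k / \<epsilon> ^ m * jap x ^ k" using m[of ?l] ..
    have le1: "1 / real (Suc k) \<le> 1" by simp
    have "\<exists>C. \<forall>t x. 0 < t \<longrightarrow> t < 1 / real (Suc k) \<longrightarrow>
      norm (iter_partial js (?g (t / 2)) x - iter_partial js (?g t) x) \<le> C * jap x ^ k * t"
    proof (rule iter_partial_regularisation_diff[OF \<rho> u gO, where l = "length js" and A = "4 ^ k"])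
      show "norm (iter_partial ks (?g \<epsilon>) x) \<le> 4 ^ k / \<epsilon> ^ m * jap x ^ k"
        if \<epsilon>: "0 < \<epsilon>" "\<epsilon> < 1 / real (Suc k)" and l: "length ks \<le> ?l" for \<epsilon> x ks
      proof -
        have "\<epsilon> \<le> 1" using \<epsilon>(2) le1 by linarith
        show ?thesis unfolding g[OF \<epsilon>(1) \<open>\<epsilon> \<le> 1\<close>] using k \<epsilon> l by blast
      qed
    qed (use le1 in auto)
    then obtain C where C: "\<And>t x. 0 < t \<Longrightarrow> t < 1 / real (Suc k) \<Longrightarrow>
      norm (iter_partial js (?g (t / 2)) x - iter_partial js (?g t) x) \<le> C * jap x ^ k * t" by blast
    \<comment> \<open>The threshold depends on k and thus on the derivative considered, as
      \<open>O_M_geometric_limit\<close> allows.\<close>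
    obtain J where J: "(1/2 :: real) ^ J < 1 / real (Suc k)"
      using real_arch_pow_inv[of "1 / real (Suc k)" "1/2"] by auto
    have "norm (iter_partial js (G (Suc j)) x - iter_partial js (G j) x) \<le> C * jap x ^ k * (1/2) ^ j" if "J \<le> j" for j x
    proof -
      have "(1/2 :: real) ^ j \<le> (1/2) ^ J" using that by (intro power_decreasing) auto
      with J have "(1/2 :: real) ^ j < 1 / real (Suc k)" by linarith
      from C[OF half(1) this, of x] show ?thesis by (simp add: G_def)
    qed
    then show "\<exists>J q C. \<forall>j\<ge>J. \<forall>x. norm (iter_partial js (G (Suc j)) x - iter_partial js (G j) x) \<le> C * jap x ^ q * (1/2) ^ j"
      by blast
  qed
  then obtain f q C where f: "f \<in> O_M" and lim: "\<And>x. (\<lambda>j. G j x) \<longlonglongrightarrow> f x"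
    and growth: "\<And>j x. norm (G j x) \<le> C * jap x ^ q" by blast
  \<comment> \<open>The pairings of G j with \<psi> have two limits: weak convergence of the
    regularisations gives u, the pointwise limit with a common majorant gives f.\<close>
  have "u \<psi> = distr_of f \<psi>" if \<psi>: "\<psi> \<in> schwartz" for \<psi>
  proof -
    have [measurable]: "\<psi> \<in> borel_measurable borel" "f \<in> borel_measurable borel" "G j \<in> borel_measurable borel" for j
      by (intro borel_measurable_smooth[OF schwartz_smooth[OF \<psi>]] borel_measurable_smooth[OF O_M_smooth[OF f]]
          borel_measurable_smooth[OF O_M_smooth[OF G]])+
    have "filterlim (\<lambda>j. (1/2 :: real) ^ j) (at_right 0) sequentially"
      by (rule tendsto_imp_filterlim_at_right) (auto intro!: LIMSEQ_power_zero)
    from filterlim_compose[OF distr_conv_rescale_tendsto[OF \<rho> u \<psi>] this]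
    have "(\<lambda>j. LINT x|lborel. G j x * \<psi> x) \<longlonglongrightarrow> u \<psi>" by (simp add: G_def)
    moreover have "(\<lambda>j. LINT x|lborel. G j x * \<psi> x) \<longlonglongrightarrow> (LINT x|lborel. f x * \<psi> x)"
    proof (rule integral_dominated_convergence)
      show "integrable lborel (\<lambda>x. C * (jap x ^ q * norm (\<psi> x)))"
        by (intro integrable_mult_right integrable_jap_schwartz \<psi>)
      show "AE x in lborel. (\<lambda>j. G j x * \<psi> x) \<longlonglongrightarrow> f x * \<psi> x"
        by (intro AE_I2 tendsto_mult tendsto_const lim)
      show "AE x in lborel. norm (G j x * \<psi> x) \<le> C * (jap x ^ q * norm (\<psi> x))" for j
        using mult_right_mono[OF growth norm_ge_zero] by (intro AE_I2) (simp add: norm_mult mult.assoc)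
    qed measurable
    ultimately show ?thesis using \<psi> by (auto simp: distr_of_def dest: LIMSEQ_unique)
  qed
  then have "u = distr_of f"
    by (intro extensionalityI[OF tempered_extensional[OF u] tempered_extensional[OF distr_of_tempered[OF f]]])
  with f show ?thesis by blast
qed

theorem proposition11:
  fixes \<rho> :: "real ^ 'n \<Rightarrow> complex"
  assumes "mollifier \<rho>"
  shows "G_tau_inf \<inter> iota_tau \<rho> ` tempered = iota_tau \<rho> ` distr_of ` O_M
    \<and> (\<forall>u\<in>tempered. iota_tau \<rho> u \<in> G_tau_inf \<longleftrightarrow> u \<in> distr_of ` O_M)"
proof -
  have iff: "iota_tau \<rho> u \<in> G_tau_inf \<longleftrightarrow> u \<in> distr_of ` O_M" if "u \<in> tempered" for u
    using regular_imp_O_M[OF assms that] iota_tau_O_M[OF _ mollifier_schwartz[OF assms]] by blast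
  \<comment> \<open>This places the classes of multipliers in the image of \<open>tempered\<close>,
    so the equality of sets follows from the equivalence.\<close>
  moreover have "distr_of ` O_M \<subseteq> tempered" using distr_of_tempered by blast
  ultimately show ?thesis by blast
qed

end
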